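(* Let $F_\varepsilon$ be a holomorphic family of regular polynomial maps of $\mathbb{C}^2$ of the form $$F_\varepsilon(x,y)=\Big(x+(x^2+\varepsilon^2)\big(1+(q+1)x+ry+O(x^2,xy,y^2)+O(\varepsilon^2)\big),\ y\big(1+\rho x+O(x^2,xy,y^2)+O(\varepsilon^2)\big)\Big),$$ with $\rho>1$ real and $q,r\in\mathbb{C}$. Let $T_\alpha:\mathcal{U}\to\mathbb{C}^2$, $\mathcal{U}\subset\tilde C_0$, be a Lavaurs map such that $F_{\varepsilon_\nu}^{n_\nu}\to T_\alpha$ on $\mathcal{U}$ for some $\alpha$-sequence $(\varepsilon_\nu,n_\nu)$. Then $$K(F_0,T_\alpha)\supset\limsup_{\nu\to\infty}K(F_{\varepsilon_\nu}).$$ Moreover, the set-valued map $\varepsilon\mapsto K(F_\varepsilon)$ is discontinuous at $\varepsilon=0$ (for the Hausdorff topology).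
   Context: Notation: $O(f_1,\dots,f_k)$ denotes some element of the ideal generated by $f_1,\dots,f_k$ (in germs at the origin of holomorphic functions of $(x,y,\varepsilon)$); $F^n$ is the $n$-th iterate. The parameter $\varepsilon$ ranges in a neighbourhood of $0\in\mathbb{C}$. A regular polynomial map of $\mathbb{C}^2$ is a polynomial endomorphism of $\mathbb{C}^2$ admitting an extension to a holomorphic endomorphism of $\mathbb{P}^2(\mathbb{C})$. Its filled Julia set $K(F)$ is the set of points of $\mathbb{C}^2$ whose forward orbit is bounded. For $\alpha\in\mathbb{C}$, an $\alpha$-sequence is a sequence $(\varepsilon_\nu,n_\nu)\in(\mathbb{C}\times\mathbb{N})^{\mathbb{N}}$ with $n_\nu\to\infty$ and $n_\nu-\frac{\pi}{\varepsilon_\nu}\to\alpha$. $\tilde C_0=\{(x,y)\in\mathbb{C}^2:\ |\mathrm{Im}\,x|<-\gamma\,\mathrm{Re}\,x,\ |x|<R,\ |y|<s|x|\}$, where $\gamma,R,s>0$ are fixed small enough that: $F_0(\tilde C_0)\subset\tilde C_0$ and all points of $\tilde C_0$ are attracted to the origin under $F_0$ tangentially to $[1:0]$; the same holds for $-\tilde C_0$ and the local inverse $F_0^{-1}$ of $F_0$ at the origin; and both $\tilde C_0$ and $-\tilde C_0$ are contained in a neighbourhood of the origin where $F_0$ is invertible. Given an open set $\mathcal{U}\subset\tilde C_0$, a map $T_\alpha:\mathcal{U}\to\mathbb{C}^2$ is a Lavaurs map if there is an $\alpha$-sequence $(\varepsilon_\nu,n_\nu)$ such that $F_{\varepsilon_\nu}^{n_\nu}\to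 T_\alpha$ locally uniformly on $\mathcal{U}$. The filled Lavaurs-Julia set $K(F_0,T_\alpha)$ is the complement of the set of points $p$ for which there exists $m\ge0$ such that $T_\alpha^m(p)$ is defined and is not in $K(F_0)$. For a sequence of compact sets $X_\nu$, $\limsup X_\nu$ is the set of points every neighbourhood of which meets $X_\nu$ for infinitely many $\nu$. *)

theory Defs
  imports "HOL-Analysis.Analysis"
begin

section \<open>Holomorphic maps of several complex variables\<close>

text \<open>
  Points of the plane are pairs, and points of the space of \<open>(\<epsilon>, x, y)\<close> are nested pairs. The class
  supplies the complex scalar multiplication of these spaces, so that holomorphic can mean real
  differentiable with complex-linear differential.
\<close>

class complex_scaled = real_normed_vector +
  fixes cscale :: "complex \<Rightarrow> 'a \<Rightarrow> 'a"  (infixr "*\<^sub>C" 75)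
  assumes cscale_add_right: "c *\<^sub>C (v + w) = c *\<^sub>C v + c *\<^sub>C w"
    and cscale_add_left: "(c + d) *\<^sub>C v = c *\<^sub>C v + d *\<^sub>C v"
    and cscale_cscale: "c *\<^sub>C d *\<^sub>C v = (c * d) *\<^sub>C v"
    and cscale_of_real: "complex_of_real t *\<^sub>C v = t *\<^sub>R v"

instantiation complex :: complex_scaled
begin

definition cscale_complex :: "complex \<Rightarrow> complex \<Rightarrow> complex" where
  "cscale_complex c z = c * z"

instance
  by standard (simp_all add: cscale_complex_def algebra_simps scaleR_conv_of_real)

end

instantiation prod :: (complex_scaled, complex_scaled) complex_scaled
begin

definition cscale_prod :: "complex \<Rightarrow> 'a \<times> 'b \<Rightarrow> 'a \<times> 'b" where
  "cscale_prod c p = (c *\<^sub>C fst p, c *\<^sub>C snd p)"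

instance
  by standard
    (simp_all add: cscale_prod_def cscale_add_right cscale_add_left cscale_cscale cscale_of_real
      scaleR_prod_def)

end

definition holo_on :: "('a::complex_scaled \<Rightarrow> 'b::complex_scaled) \<Rightarrow> 'a set \<Rightarrow> bool" where
  "holo_on f S \<longleftrightarrow>
     (\<forall>p\<in>S. \<exists>L. (f has_derivative L) (at p) \<and> (\<forall>c v. L (c *\<^sub>C v) = c *\<^sub>C L v))"

definition holo_germ :: "('a::complex_scaled \<Rightarrow> complex) \<Rightarrow> bool" where
  "holo_germ f \<longleftrightarrow> (\<exists>V. open V \<and> 0 \<in> V \<and> holo_on f V)"

text \<open>
  \<open>big_O [f\<^sub>1, \<dots>, f\<^sub>k]\<close> consists of the functions whose germ at the origin lies in the ideal
  generated by \<open>f\<^sub>1, \<dots>, f\<^sub>k\<close> in the ring of holomorphic germs.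
\<close>

definition big_O :: "('a::complex_scaled \<Rightarrow> complex) list \<Rightarrow> ('a \<Rightarrow> complex) set" where
  "big_O gs = {f. \<exists>hs. length hs = length gs \<and> (\<forall>h\<in>set hs. holo_germ h) \<and>
     (\<forall>\<^sub>F p in nhds 0. f p = (\<Sum>i<length gs. (hs ! i) p * (gs ! i) p))}"


section \<open>The complex projective plane\<close>

definition proportional :: "complex \<times> complex \<times> complex \<Rightarrow> complex \<times> complex \<times> complex \<Rightarrow> bool"
  where "proportional v w \<longleftrightarrow> v \<noteq> 0 \<and> w \<noteq> 0 \<and> (\<exists>t. w = t *\<^sub>C v)"

lemma part_equivp_proportional: "part_equivp proportional"
proof (rule part_equivpI)
  show "\<exists>v. proportional v v"
    by (rule exI[of _ "(1, 0, 0)"], unfold proportional_def)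
      (auto simp: zero_prod_def cscale_prod_def cscale_complex_def)
  show "symp proportional"
  proof (rule sympI)
    fix v w assume "proportional v w"
    then obtain t where t: "v \<noteq> 0" "w \<noteq> 0" "w = t *\<^sub>C v"
      unfolding proportional_def by blast
    then have "t \<noteq> 0"
      using cscale_of_real[of 0 v] by auto
    then have "v = inverse t *\<^sub>C w"
      using t cscale_of_real[of 1 v] by (simp add: cscale_cscale)
    then show "proportional w v"
      using t unfolding proportional_def by blast
  qed
  show "transp proportional"
    by (rule transpI) (auto simp: proportional_def cscale_cscale)
qed

quotient_type cp2 = "complex \<times> complex \<times> complex" / partial: proportional
  by (rule part_equivp_proportional)

text \<open>Homogeneous coordinates; meaningful only when they are not all zero.\<close>

definition hcoord :: "complex \<Rightarrow> complex \<Rightarrow> complex \<Rightarrow> cp2"  ("\<lbrakk>_ : _ : _\<rbrakk>") where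
  "hcoord a b c = abs_cp2 (a, b, c)"

definition affine_charts :: "(complex \<times> complex \<Rightarrow> cp2) set" where
  "affine_charts = {\<lambda>(u, v). hcoord u v 1, \<lambda>(u, v). hcoord u 1 v, \<lambda>(u, v). hcoord 1 u v}"

definition holo_into_cp2 :: "('a::complex_scaled \<Rightarrow> cp2) \<Rightarrow> 'a set \<Rightarrow> bool" where
  "holo_into_cp2 g S \<longleftrightarrow>
     (\<forall>p\<in>S. \<exists>\<psi>\<in>affine_charts. \<exists>V h. open V \<and> p \<in> V \<and> holo_on h V \<and> (\<forall>z\<in>V. g z = \<psi> (h z)))"

definition holo_endo_cp2 :: "(cp2 \<Rightarrow> cp2) \<Rightarrow> bool" where
  "holo_endo_cp2 G \<longleftrightarrow> (\<forall>\<phi>\<in>affine_charts. holo_into_cp2 (\<lambda>z. G (\<phi> z)) UNIV)"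

definition holo_family_cp2 :: "complex set \<Rightarrow> (complex \<Rightarrow> cp2 \<Rightarrow> cp2) \<Rightarrow> bool" where
  "holo_family_cp2 D G \<longleftrightarrow>
     (\<forall>\<phi>\<in>affine_charts. holo_into_cp2 (\<lambda>(\<epsilon>, z). G \<epsilon> (\<phi> z)) (D \<times> UNIV))"


section \<open>Regular polynomial maps\<close>

definition polynomial_fun2 :: "(complex \<times> complex \<Rightarrow> complex) \<Rightarrow> bool" where
  "polynomial_fun2 f \<longleftrightarrow>
     (\<exists>N a. \<forall>x y. f (x, y) = (\<Sum>i\<le>(N::nat). \<Sum>j\<le>N. a i j * x ^ i * y ^ j))"

definition polynomial_endo :: "(complex \<times> complex \<Rightarrow> complex \<times> complex) \<Rightarrow> bool" where
  "polynomial_endo f \<longleftrightarrow> polynomial_fun2 (\<lambda>z. fst (f z)) \<and> polynomial_fun2 (\<lambda>z. snd (f z))"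

definition extends_to_cp2 :: "(complex \<times> complex \<Rightarrow> complex \<times> complex) \<Rightarrow> (cp2 \<Rightarrow> cp2) \<Rightarrow> bool" where
  "extends_to_cp2 f G \<longleftrightarrow> (\<forall>x y. G (hcoord x y 1) = hcoord (fst (f (x, y))) (snd (f (x, y))) 1)"

definition regular_polynomial_map :: "(complex \<times> complex \<Rightarrow> complex \<times> complex) \<Rightarrow> bool" where
  "regular_polynomial_map f \<longleftrightarrow>
     polynomial_endo f \<and> (\<exists>G. holo_endo_cp2 G \<and> extends_to_cp2 f G)"

text \<open>
  The extensions to the projective plane are required to depend holomorphically on the parameter
  as well. In particular the degree is locally constant; joint holomorphy of \<open>(\<epsilon>, z) \<mapsto> F \<epsilon> z\<close> alone
  would allow it to drop at isolated parameters.
\<close>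

definition holo_family_regular ::
    "complex set \<Rightarrow> (complex \<Rightarrow> complex \<times> complex \<Rightarrow> complex \<times> complex) \<Rightarrow> bool" where
  "holo_family_regular D F \<longleftrightarrow>
     (\<forall>\<epsilon>\<in>D. regular_polynomial_map (F \<epsilon>)) \<and>
     holo_on (\<lambda>(\<epsilon>, z). F \<epsilon> z) (D \<times> UNIV) \<and>
     (\<exists>G. holo_family_cp2 D G \<and> (\<forall>\<epsilon>\<in>D. extends_to_cp2 (F \<epsilon>) (G \<epsilon>)))"

definition filled_Julia :: "('a::real_normed_vector \<Rightarrow> 'a) \<Rightarrow> 'a set" where
  "filled_Julia f = {z. bounded (range (\<lambda>n. (f ^^ n) z))}"


section \<open>Lavaurs maps\<close>

definition alpha_sequence :: "complex \<Rightarrow> (nat \<Rightarrow> complex) \<Rightarrow> (nat \<Rightarrow> nat) \<Rightarrow> bool" where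
  "alpha_sequence \<alpha> eps n \<longleftrightarrow>
     (\<forall>\<nu>. eps \<nu> \<noteq> 0) \<and> filterlim n at_top sequentially \<and>
     (\<lambda>\<nu>. of_nat (n \<nu>) - of_real pi / eps \<nu>) \<longlonglongrightarrow> \<alpha>"

definition sector :: "real \<Rightarrow> real \<Rightarrow> real \<Rightarrow> (complex \<times> complex) set" where
  "sector \<gamma> R s =
     {(x, y). \<bar>Im x\<bar> < - \<gamma> * Re x \<and> cmod x < R \<and> cmod y < s * cmod x}"

text \<open>The orbit of \<open>p\<close> converges to the origin, and in the projective line \<open>[x\<^sub>n : y\<^sub>n]\<close> tends to
  \<open>[1 : 0]\<close>.\<close>

definition attracted_tangentially ::
    "(complex \<times> complex \<Rightarrow> complex \<times> complex) \<Rightarrow> complex \<times> complex \<Rightarrow> bool" where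
  "attracted_tangentially f p \<longleftrightarrow>
     (\<lambda>n. (f ^^ n) p) \<longlonglongrightarrow> 0 \<and>
     (\<forall>\<^sub>F n in sequentially. fst ((f ^^ n) p) \<noteq> 0) \<and>
     (\<lambda>n. snd ((f ^^ n) p) / fst ((f ^^ n) p)) \<longlonglongrightarrow> 0"

definition attracting_region ::
    "(complex \<times> complex \<Rightarrow> complex \<times> complex) \<Rightarrow> (complex \<times> complex) set \<Rightarrow> bool" where
  "attracting_region f C \<longleftrightarrow> f ` C \<subseteq> C \<and> (\<forall>p\<in>C. attracted_tangentially f p)"

text \<open>
  \<open>N\<close> is a neighbourhood of the origin on which \<open>f\<close> is invertible, and \<open>inv_into N f\<close> is the local
  inverse, defined on \<open>f ` N\<close>.
\<close>

definition admissible_sector ::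
    "(complex \<times> complex \<Rightarrow> complex \<times> complex) \<Rightarrow> real \<Rightarrow> real \<Rightarrow> real \<Rightarrow> bool" where
  "admissible_sector f \<gamma> R s \<longleftrightarrow>
     \<gamma> > 0 \<and> R > 0 \<and> s > 0 \<and>
     attracting_region f (sector \<gamma> R s) \<and>
     (\<exists>N. open N \<and> 0 \<in> N \<and> inj_on f N \<and> open (f ` N) \<and> holo_on (inv_into N f) (f ` N) \<and>
          sector \<gamma> R s \<subseteq> N \<and> uminus ` sector \<gamma> R s \<subseteq> N \<inter> f ` N \<and>
          attracting_region (inv_into N f) (uminus ` sector \<gamma> R s))"

definition locally_uniform_limit ::
    "'a::topological_space set \<Rightarrow> (nat \<Rightarrow> 'a \<Rightarrow> 'b::metric_space) \<Rightarrow> ('a \<Rightarrow> 'b) \<Rightarrow> bool" where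
  "locally_uniform_limit U f g \<longleftrightarrow>
     (\<forall>p\<in>U. \<exists>V. open V \<and> p \<in> V \<and> uniform_limit (V \<inter> U) f g sequentially)"

text \<open>
  \<open>T\<close> is a partial map with domain \<open>U\<close>; its values elsewhere are irrelevant.
\<close>

definition lavaurs_map ::
    "(complex \<Rightarrow> complex \<times> complex \<Rightarrow> complex \<times> complex) \<Rightarrow> (complex \<times> complex) set \<Rightarrow> complex \<Rightarrow>
     (nat \<Rightarrow> complex) \<Rightarrow> (nat \<Rightarrow> nat) \<Rightarrow> (complex \<times> complex) set \<Rightarrow>
     (complex \<times> complex \<Rightarrow> complex \<times> complex) \<Rightarrow> bool" where
  "lavaurs_map F C \<alpha> eps n U T \<longleftrightarrow>
     open U \<and> U \<subseteq> C \<and> alpha_sequence \<alpha> eps n \<and>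
     locally_uniform_limit U (\<lambda>\<nu>. F (eps \<nu>) ^^ n \<nu>) T"

definition filled_Lavaurs_Julia :: "('a::real_normed_vector \<Rightarrow> 'a) \<Rightarrow> 'a set \<Rightarrow> ('a \<Rightarrow> 'a) \<Rightarrow> 'a set" where
  "filled_Lavaurs_Julia f U T =
     - {p. \<exists>m. (\<forall>j<m. (T ^^ j) p \<in> U) \<and> (T ^^ m) p \<notin> filled_Julia f}"


section \<open>Limits of sets\<close>

definition set_limsup :: "(nat \<Rightarrow> 'a::topological_space set) \<Rightarrow> 'a set" where
  "set_limsup X = {p. \<forall>V. open V \<and> p \<in> V \<longrightarrow> infinite {\<nu>. X \<nu> \<inter> V \<noteq> {}}}"

text \<open>Meaningful for nonempty bounded sets.\<close>

definition hausdorff_distance :: "'a::metric_space set \<Rightarrow> 'a set \<Rightarrow> real" where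
  "hausdorff_distance A B = max (SUP a\<in>A. infdist a B) (SUP b\<in>B. infdist b A)"

definition hausdorff_continuous_at ::
    "('a::topological_space \<Rightarrow> 'b::metric_space set) \<Rightarrow> 'a \<Rightarrow> bool" where
  "hausdorff_continuous_at K a \<longleftrightarrow> ((\<lambda>t. hausdorff_distance (K t) (K a)) \<longlongrightarrow> 0) (at a)"

end

theory Submission
  imports Defs "HOL-Complex_Analysis.Complex_Analysis"
begin

text \<open>
  Both assertions rest on a uniform escape radius: for small \<open>\<epsilon>\<close>, points outside a fixed ball are moved
  to at least twice their norm (\<open>uniform_escape\<close>). To see this, the projective extension is written as
  \<open>[1 : h : g]\<close> or \<open>[h : 1 : g]\<close> near a point at infinity. Here \<open>v = 0\<close> is the line at infinity, and \<open>g\<close>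
  is the reciprocal of the size of the image up to a bounded factor. The quadratic term \<open>x\<^sup>2\<close> of \<open>F\<^sub>0\<close>
  excludes linear growth along lines that are not vertical, by Liouville's theorem; hence \<open>g\<close> vanishes to second order in \<open>v\<close> for \<open>\<epsilon> = 0\<close>. For \<open>\<epsilon> \<noteq> 0\<close>
  it still vanishes at \<open>v = 0\<close>, and the Schwarz lemma gives \<open>\<bar>g\<bar> \<le> \<bar>v\<bar> / 4\<close>.

  The inclusion for the upper limit is then a matter of continuity: if the Lavaurs orbit of a point
  leaves \<open>K(F\<^sub>0)\<close>, the iterates \<open>F\<^sub>\<epsilon>\<^sup>n\<close> carry a whole neighbourhood of the point along this orbit and
  then out of the escape radius (\<open>limsup_filled_Julia_subset\<close>).

  For the discontinuity one follows orbits through the gate between the fixed points \<open>(\<plusminus> \<i> \<epsilon>, 0)\<close>. In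
  the coordinate \<open>e\<close> with \<open>x = - \<epsilon> cot (\<epsilon> e)\<close> the map is nearly the translation by one, and the passage
  takes about \<open>\<pi> / \<epsilon>\<close> steps. With \<open>\<epsilon> = \<pi> / (k - t)\<close>, a small ball around a point \<open>p\<close> of the
  attracting side is carried in \<open>k - A - M\<close> steps through the gate without leaving the unit ball, and
  the image of \<open>p\<close> has first coordinate about \<open>1 / (M - t)\<close> (\<open>gate_passage\<close>). Suppose that \<open>K(F\<^sub>\<epsilon>)\<close> tends
  to \<open>K(F\<^sub>0)\<close>. As \<open>p\<close> lies in \<open>K(F\<^sub>0)\<close>, there are points of \<open>K(F\<^sub>\<epsilon>)\<close> arbitrarily close to \<open>p\<close>, and since the
  passage is Lipschitz uniformly in \<open>k\<close>, the further orbit of \<open>p\<close> stays within bounded distance of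
  \<open>K(F\<^sub>\<epsilon>)\<close>. So the exit position at a fixed depth is a bounded holomorphic function of the phase \<open>t\<close> on
  discs of arbitrarily large radius. By the Schwarz lemma it is nearly constant, which contradicts
  the asymptotics \<open>1 / (M - t)\<close> (\<open>filled_Julia_discontinuous\<close>).
\<close>

section \<open>Calculus of holomorphic maps\<close>

type_synonym map_family = "complex \<Rightarrow> complex \<times> complex \<Rightarrow> complex \<times> complex"

lemma holo_on_subset: "holo_on f S \<Longrightarrow> T \<subseteq> S \<Longrightarrow> holo_on f T"
  unfolding holo_on_def by (intro ballI) (erule bspec, erule subsetD)

lemma holo_on_const: "holo_on (\<lambda>z::'a::complex_scaled. c::'b::complex_scaled) S"
proof -
  have "d *\<^sub>C (0::'b) = 0" for d
    using cscale_add_right[of d "0::'b" 0] by simp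
  then show ?thesis unfolding holo_on_def by (intro ballI exI[of _ "\<lambda>_. 0"]) simp
qed

lemma holo_on_id: "holo_on (\<lambda>z. z) S"
  unfolding holo_on_def by (intro ballI exI[of _ "\<lambda>z. z"]) simp

lemma holo_on_Pair:
  assumes "holo_on f S" "holo_on g S"
  shows "holo_on (\<lambda>z. (f z, g z)) S"
  unfolding holo_on_def
proof
  fix p assume p: "p \<in> S"
  obtain L where L: "(f has_derivative L) (at p)" "\<forall>c v. L (c *\<^sub>C v) = c *\<^sub>C L v"
    using assms(1) p unfolding holo_on_def by blast
  obtain M where M: "(g has_derivative M) (at p)" "\<forall>c v. M (c *\<^sub>C v) = c *\<^sub>C M v"
    using assms(2) p unfolding holo_on_def by blast
  have "((\<lambda>z. (f z, g z)) has_derivative (\<lambda>v. (L v, M v))) (at p)"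
    using L(1) M(1) by (rule has_derivative_Pair)
  then show "\<exists>L. ((\<lambda>z. (f z, g z)) has_derivative L) (at p) \<and> (\<forall>c v. L (c *\<^sub>C v) = c *\<^sub>C L v)"
    using L(2) M(2) by (intro exI[of _ "\<lambda>v. (L v, M v)"]) (simp add: cscale_prod_def)
qed

lemma holo_on_compose:
  assumes "holo_on f S" "holo_on g T" "\<And>z. z \<in> S \<Longrightarrow> f z \<in> T"
  shows "holo_on (\<lambda>z. g (f z)) S"
  unfolding holo_on_def
proof
  fix p assume p: "p \<in> S"
  obtain L where L: "(f has_derivative L) (at p)" "\<forall>c v. L (c *\<^sub>C v) = c *\<^sub>C L v"
    using assms(1) p unfolding holo_on_def by blast
  obtain M where M: "(g has_derivative M) (at (f p))" "\<forall>c v. M (c *\<^sub>C v) = c *\<^sub>C M v"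
    using assms(2) assms(3)[OF p] unfolding holo_on_def by blast
  have "((\<lambda>z. g (f z)) has_derivative (\<lambda>v. M (L v))) (at p)"
    using L(1) M(1) by (rule has_derivative_compose)
  then show "\<exists>L. ((\<lambda>z. g (f z)) has_derivative L) (at p) \<and> (\<forall>c v. L (c *\<^sub>C v) = c *\<^sub>C L v)"
    using L(2) M(2) by (intro exI[of _ "\<lambda>v. M (L v)"]) simp
qed

lemma holo_on_fst:
  assumes "holo_on f S" shows "holo_on (\<lambda>z. fst (f z)) S"
proof (rule holo_on_compose[OF assms, where T = UNIV])
  show "holo_on fst (UNIV :: ('b \<times> 'c) set)"
    unfolding holo_on_def
    by (intro ballI exI[of _ fst] conjI has_derivative_fst has_derivative_ident)
      (simp add: cscale_prod_def)
qed simp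

lemma holo_on_snd:
  assumes "holo_on f S" shows "holo_on (\<lambda>z. snd (f z)) S"
proof (rule holo_on_compose[OF assms, where T = UNIV])
  show "holo_on snd (UNIV :: ('b \<times> 'c) set)"
    unfolding holo_on_def
    by (intro ballI exI[of _ snd] conjI has_derivative_snd has_derivative_ident)
      (simp add: cscale_prod_def)
qed simp

lemma holo_on_imp_isCont:
  assumes "holo_on f S" "p \<in> S" shows "isCont f p"
proof -
  obtain L where "(f has_derivative L) (at p)"
    using assms unfolding holo_on_def by blast
  then show ?thesis by (rule has_derivative_continuous)
qed

lemma holo_on_imp_continuous_on: "holo_on f S \<Longrightarrow> continuous_on S f"
  by (rule continuous_at_imp_continuous_on, rule ballI, rule holo_on_imp_isCont)

lemma holo_on_imp_holomorphic_on:
  assumes "holo_on f S" shows "f holomorphic_on S"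
  unfolding holomorphic_on_def
proof
  fix z assume z: "z \<in> S"
  obtain L where L: "(f has_derivative L) (at z)" "\<forall>c v. L (c *\<^sub>C v) = c *\<^sub>C L v"
    using assms z unfolding holo_on_def by blast
  have "L v = L 1 * v" for v
    using L(2)[rule_format, of v 1] by (simp add: cscale_complex_def mult.commute)
  then have "L = (*) (L 1)" by (rule ext)
  then have "(f has_field_derivative L 1) (at z)"
    using L(1) by (simp add: has_field_derivative_def)
  then have "f field_differentiable at z"
    unfolding field_differentiable_def by blast
  then show "f field_differentiable at z within S"
    by (rule field_differentiable_at_within)
qed

lemma holomorphic_on_imp_holo_on:
  assumes "f holomorphic_on S" "open S" shows "holo_on f S"
  unfolding holo_on_def
proof
  fix z assume z: "z \<in> S"
  have "f field_differentiable at z"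
    using assms z by (rule holomorphic_on_imp_differentiable_at)
  then obtain d where "(f has_field_derivative d) (at z)"
    unfolding field_differentiable_def by blast
  then show "\<exists>L. (f has_derivative L) (at z) \<and> (\<forall>c v. L (c *\<^sub>C v) = c *\<^sub>C L v)"
    unfolding has_field_derivative_def
    by (intro exI[of _ "(*) d"]) (simp add: cscale_complex_def)
qed

lemma holo_on_line: "holo_on (\<lambda>s::complex. (a + s * u, b + s * v)) S"
proof (rule holo_on_subset[where S = UNIV])
  show "holo_on (\<lambda>s::complex. (a + s * u, b + s * v)) UNIV"
    by (intro holo_on_Pair holomorphic_on_imp_holo_on holomorphic_intros open_UNIV)
qed simp

text \<open>
  The Schwarz lemma is used in this form in place of Cauchy's estimate: it bounds functions that
  vanish on the line at infinity, and it makes bounded iterates Lipschitz with a constant that does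
  not depend on the number of iterations.
\<close>

lemma Schwarz_lemma_ball:
  fixes f :: "complex \<Rightarrow> complex"
  assumes hol: "f holomorphic_on ball a R" and f0: "f a = 0"
    and bd: "\<And>z. z \<in> ball a R \<Longrightarrow> norm (f z) \<le> b" and z: "z \<in> ball a R"
  shows "norm (f z) \<le> b / R * norm (z - a)"
proof -
  have R: "R > 0" using z by (metis ball_eq_empty emptyE not_le)
  have b: "b \<ge> 0" using bd[OF z] norm_ge_zero order_trans by blast
  have main: "norm (f z) \<le> c / R * norm (z - a)" if c: "c > b" for c
  proof -
    have c0: "c > 0" using b c by simp
    define g where "g w = f (a + of_real R * w) / of_real c" for w
    have im: "a + of_real R * w \<in> ball a R" if "norm w < 1" for w
      using that R by (simp add: dist_norm norm_mult)
    have holg: "g holomorphic_on ball 0 1"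
      unfolding g_def using im c0
      by (intro holomorphic_intros holomorphic_on_compose_gen[OF _ hol, unfolded o_def]) auto
    have g0: "g 0 = 0" by (simp add: g_def f0)
    have gb: "norm (g w) < 1" if "norm w < 1" for w
      using bd[OF im[OF that]] c c0 by (simp add: g_def norm_divide)
    define w where "w = (z - a) / of_real R"
    have w1: "norm w < 1" using z R by (simp add: w_def norm_divide dist_norm norm_minus_commute)
    have "norm (g w) \<le> norm w" by (rule Schwarz_Lemma(1)[OF holg g0 gb w1])
    moreover have "g w = f z / of_real c" using R by (simp add: g_def w_def)
    ultimately have "norm (f z / of_real c) \<le> norm w" by simp
    then show ?thesis using c0 R by (simp add: w_def norm_divide field_simps)
  qed
  show ?thesis
  proof (rule field_le_epsilon)
    fix e :: real assume e: "e > 0"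
    define n where "n = norm (z - a)"
    have nR: "n / R < 1" using z R by (simp add: n_def dist_norm norm_minus_commute)
    have "norm (f z) \<le> (b + e) / R * n" using main[of "b + e"] e by (simp add: n_def)
    also have "\<dots> = b / R * n + e * (n / R)" using R by (simp add: field_simps)
    also have "\<dots> \<le> b / R * n + e" using mult_left_le[of "n / R" e] nR e by simp
    finally show "norm (f z) \<le> b / R * norm (z - a) + e" by (simp add: n_def)
  qed
qed

lemma bounded_holomorphic_Lipschitz_centre:
  fixes f :: "complex \<Rightarrow> complex"
  assumes hol: "f holomorphic_on ball a R"
    and bd: "\<And>z. z \<in> ball a R \<Longrightarrow> norm (f z) \<le> b" and z: "z \<in> ball a R"
  shows "norm (f z - f a) \<le> 2 * b / R * norm (z - a)"
proof -
  have "R > 0" using z by (metis ball_eq_empty emptyE not_le)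
  then have ab: "norm (f a) \<le> b" using bd[of a] by simp
  have "norm (f w - f a) \<le> 2 * b" if "w \<in> ball a R" for w
    using norm_triangle_ineq4[of "f w" "f a"] bd[OF that] ab by linarith
  then show ?thesis
    using z by (intro Schwarz_lemma_ball[of "\<lambda>z. f z - f a" a R "2 * b" z])
      (auto intro!: holomorphic_intros hol)
qed

lemma norm_fst_le_norm: "norm (fst p) \<le> norm p"
  using norm_fst_le[of "fst p" "snd p"] by simp

lemma norm_snd_le_norm: "norm (snd p) \<le> norm p"
  using norm_snd_le[of "snd p" "fst p"] by simp

text \<open>
  The complex line through a point of the ball and the centre meets the ball in a disc, so the
  one-variable estimate carries over.
\<close>

lemma bounded_holo_Lipschitz_centre:
  fixes f :: "complex \<times> complex \<Rightarrow> complex \<times> complex"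
  assumes hol: "holo_on f (ball p c)"
    and bd: "\<And>z. z \<in> ball p c \<Longrightarrow> norm (f z) \<le> b" and z: "z \<in> ball p c"
  shows "norm (f z - f p) \<le> 4 * b / c * norm (z - p)"
proof (cases "z = p")
  case False
  define v where "v = z - p"
  have v0: "norm v > 0" using False by (simp add: v_def)
  have c: "norm v < c" using z by (simp add: v_def dist_norm norm_minus_commute)
  define l where "l s = (fst p + s * fst v, snd p + s * snd v)" for s
  have nl: "norm (l s - p) = norm s * norm v" for s
    by (simp add: l_def norm_prod_def norm_mult power_mult_distrib flip: distrib_left)
      (simp add: real_sqrt_mult)
  define r where "r = c / norm v"
  have lim: "l s \<in> ball p c" if "s \<in> ball 0 r" for s
    using nl[of s] that v0 by (simp add: r_def dist_norm norm_minus_commute field_simps)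
  have r1: "1 < r" using c v0 by (simp add: r_def)
  have hl: "holo_on (\<lambda>s. f (l s)) (ball 0 r)"
    by (rule holo_on_compose[OF _ hol]) (use lim in \<open>auto simp: l_def intro: holo_on_line\<close>)
  have l01: "l 0 = p" "l 1 = z" by (auto simp: l_def v_def)
  have e1: "norm (fst (f z) - fst (f p)) \<le> 2 * b / r"
    using bounded_holomorphic_Lipschitz_centre[of "\<lambda>s. fst (f (l s))" 0 r b 1]
      holo_on_imp_holomorphic_on[OF holo_on_fst[OF hl]] order_trans[OF norm_fst_le_norm bd[OF lim]] r1
    by (simp add: l01)
  have e2: "norm (snd (f z) - snd (f p)) \<le> 2 * b / r"
    using bounded_holomorphic_Lipschitz_centre[of "\<lambda>s. snd (f (l s))" 0 r b 1]
      holo_on_imp_holomorphic_on[OF holo_on_snd[OF hl]] order_trans[OF norm_snd_le_norm bd[OF lim]] r1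
    by (simp add: l01)
  have "norm (f z - f p) \<le> norm (fst (f z) - fst (f p)) + norm (snd (f z) - snd (f p))"
    by (metis fst_diff norm_Pair_le snd_diff surjective_pairing)
  also have "\<dots> \<le> 4 * b / r" using e1 e2 by simp
  also have "\<dots> = 4 * b / c * norm (z - p)" by (simp add: r_def v_def)
  finally show ?thesis .
qed simp

lemma holo_on_iterate:
  fixes F :: "complex \<Rightarrow> 'a::complex_scaled \<Rightarrow> 'a"
  assumes "holo_on (\<lambda>(\<epsilon>, z). F \<epsilon> z) (D \<times> UNIV)"
  shows "holo_on (\<lambda>(\<epsilon>, z). (F \<epsilon> ^^ n) z) (D \<times> UNIV)"
proof (induction n)
  case 0
  show ?case using holo_on_snd[OF holo_on_id] by (simp add: case_prod_unfold)
next
  case (Suc n)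
  have "holo_on (\<lambda>p. (fst p, (F (fst p) ^^ n) (snd p))) (D \<times> UNIV)"
    by (rule holo_on_Pair[OF holo_on_fst[OF holo_on_id]]) (use Suc in \<open>simp only: case_prod_unfold\<close>)
  from holo_on_compose[OF this assms]
  have "holo_on (\<lambda>p. F (fst p) ((F (fst p) ^^ n) (snd p))) (D \<times> UNIV)"
    by (simp only: case_prod_unfold fst_conv snd_conv mem_Times_iff UNIV_I simp_thms)
  then show ?case by (simp only: case_prod_unfold funpow.simps o_apply)
qed

lemma continuous_on_iterate:
  fixes F :: "complex \<Rightarrow> 'a::complex_scaled \<Rightarrow> 'a"
  assumes "holo_on (\<lambda>(\<epsilon>, z). F \<epsilon> z) (D \<times> UNIV)"
  shows "continuous_on (D \<times> UNIV) (\<lambda>(\<epsilon>, z). (F \<epsilon> ^^ n) z)"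
  by (rule holo_on_imp_continuous_on[OF holo_on_iterate[OF assms]])

section \<open>Coordinates at infinity\<close>

text \<open>Equality of points is proportionality only for nonzero coordinate vectors.\<close>

lemma hcoord_eqD:
  assumes "hcoord a b c = hcoord a' b' c'" "(a, b, c) \<noteq> 0" "(a', b', c') \<noteq> 0"
  obtains t where "a' = t * a" "b' = t * b" "c' = t * c"
proof -
  have refl: "proportional v v" if "v \<noteq> 0" for v
    using that cscale_of_real[of 1 v] unfolding proportional_def by (metis of_real_1 scaleR_one)
  have "proportional (a, b, c) (a', b', c')"
    using assms refl unfolding hcoord_def
    by (subst Quotient3_rel[OF Quotient3_cp2, symmetric]) simp
  then obtain t where "(a', b', c') = t *\<^sub>C (a, b, c)"
    unfolding proportional_def by blast
  then show ?thesis
    using that[of t] by (simp only: cscale_prod_def cscale_complex_def fst_conv snd_conv prod.inject)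
qed

lemma hcoord_cong_scale:
  assumes "t \<noteq> 0" "(a, b, c) \<noteq> 0"
  shows "hcoord (t * a) (t * b) (t * c) = hcoord a b c"
proof -
  have p: "proportional (t * a, t * b, t * c) (a, b, c)"
    using assms unfolding proportional_def
    by (auto intro!: exI[of _ "inverse t"] simp: cscale_prod_def cscale_complex_def zero_prod_def)
  show ?thesis
    unfolding hcoord_def using Quotient3_rel_abs[OF Quotient3_cp2 p] .
qed

lemma holo_on_divide:
  fixes f g :: "'a::complex_scaled \<Rightarrow> complex"
  assumes "holo_on f S" "holo_on g S" "\<And>p. p \<in> S \<Longrightarrow> g p \<noteq> 0"
  shows "holo_on (\<lambda>p. f p / g p) S"
  unfolding holo_on_def
proof
  fix p assume p: "p \<in> S"
  obtain L where L: "(f has_derivative L) (at p)" "\<forall>c v. L (c *\<^sub>C v) = c *\<^sub>C L v"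
    using assms(1) p unfolding holo_on_def by blast
  obtain M where M: "(g has_derivative M) (at p)" "\<forall>c v. M (c *\<^sub>C v) = c *\<^sub>C M v"
    using assms(2) p unfolding holo_on_def by blast
  have "((\<lambda>p. f p / g p) has_derivative (\<lambda>h. (L h * g p - f p * M h) / (g p * g p))) (at p)"
    using L(1) M(1) assms(3)[OF p] by (rule has_derivative_divide')
  then show "\<exists>L. ((\<lambda>p. f p / g p) has_derivative L) (at p) \<and> (\<forall>c v. L (c *\<^sub>C v) = c *\<^sub>C L v)"
    using L(2) M(2)
    by (intro exI[of _ "\<lambda>h. (L h * g p - f p * M h) / (g p * g p)"])
      (simp add: cscale_complex_def algebra_simps diff_divide_distrib)
qed

lemma open_contains_box:
  fixes a :: "'a::real_normed_vector" and b :: "'b::real_normed_vector" and c :: "'c::real_normed_vector"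
  assumes "open Q" "(a, b, c) \<in> Q"
  obtains \<delta> where "\<delta> > 0" "ball a \<delta> \<times> ball b \<delta> \<times> ball c \<delta> \<subseteq> Q"
proof -
  obtain e where e: "e > 0" "ball (a, b, c) e \<subseteq> Q"
    using assms open_contains_ball by blast
  have "ball a (e/3) \<times> ball b (e/3) \<times> ball c (e/3) \<subseteq> Q"
  proof clarify
    fix x y z assume *: "x \<in> ball a (e/3)" "y \<in> ball b (e/3)" "z \<in> ball c (e/3)"
    have "norm (a - x, b - y, c - z) \<le> norm (a - x) + (norm (b - y) + norm (c - z))"
      by (meson add_left_mono norm_Pair_le order_trans)
    then have "dist (a, b, c) (x, y, z) < e"
      using * by (simp add: dist_norm)
    then show "(x, y, z) \<in> Q" using e by auto
  qed
  then show ?thesis using that[of "e/3"] e by simp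
qed

text \<open>
  The projective extension in coordinates at infinity: \<open>w\<close> is a direction and \<open>v\<close> the reciprocal of
  the size, so that \<open>v = 0\<close> is the line at infinity.
\<close>

lemma chart_at_infinity:
  fixes F :: map_family
  assumes G: "holo_family_cp2 D G" and ext: "\<forall>\<epsilon>\<in>D. extends_to_cp2 (F \<epsilon>) (G \<epsilon>)"
    and D: "open D" "0 \<in> D" and w0: "w0 \<noteq> 0"
  obtains \<psi> \<delta> H b where "\<psi> \<in> affine_charts" "\<delta> > 0" "ball 0 \<delta> \<subseteq> D"
    "holo_on H (ball 0 \<delta> \<times> ball w0 \<delta> \<times> ball 0 \<delta>)"
    "\<And>p. p \<in> ball 0 \<delta> \<times> ball w0 \<delta> \<times> ball 0 \<delta> \<Longrightarrow> norm (H p) \<le> b"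
    "\<And>\<epsilon> w v. norm \<epsilon> < \<delta> \<Longrightarrow> w \<in> ball w0 \<delta> \<Longrightarrow> norm v < \<delta> \<Longrightarrow> v \<noteq> 0 \<Longrightarrow>
       hcoord (fst (F \<epsilon> (fst w / v, snd w / v))) (snd (F \<epsilon> (fst w / v, snd w / v))) 1 = \<psi> (H (\<epsilon>, w, v))"
proof -
  define X where "X = D \<times> (UNIV :: (complex \<times> complex) set)"
  \<comment> \<open>the source chart that divides by a coordinate \<open>a\<close> with \<open>a w0 \<noteq> 0\<close>\<close>
  obtain \<phi> a b where \<phi>: "\<phi> \<in> affine_charts"
    and ab: "a = fst \<and> b = snd \<or> a = snd \<and> b = fst" and a0: "a w0 \<noteq> 0"
    and \<phi>_eq: "\<And>w (v::complex). a w \<noteq> 0 \<Longrightarrow> v \<noteq> 0 \<Longrightarrow>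
        \<phi> (b w / a w, v / a w) = hcoord (fst w / v) (snd w / v) 1"
  proof (cases "fst w0 = 0")
    case False
    have "(\<lambda>(u, v). hcoord 1 u v) (snd w / fst w, v / fst w) = hcoord (fst w / v) (snd w / v) 1"
      if "fst w \<noteq> 0" "v \<noteq> 0" for w :: "complex \<times> complex" and v
      using hcoord_cong_scale[of "v / fst w" "fst w / v" "snd w / v" 1] that
      by (simp add: zero_prod_def)
    then show ?thesis
      using False by (intro that[of "\<lambda>(u, v). hcoord 1 u v" fst snd]) (auto simp: affine_charts_def)
  next
    case True
    then have "snd w0 \<noteq> 0" using w0 by (simp add: prod_eq_iff)
    have "(\<lambda>(u, v). hcoord u 1 v) (fst w / snd w, v / snd w) = hcoord (fst w / v) (snd w / v) 1"
      if "snd w \<noteq> 0" "v \<noteq> 0" for w :: "complex \<times> complex" and v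
      using hcoord_cong_scale[of "v / snd w" "fst w / v" "snd w / v" 1] that
      by (simp add: zero_prod_def)
    then show ?thesis
      using \<open>snd w0 \<noteq> 0\<close>
      by (intro that[of "\<lambda>(u, v). hcoord u 1 v" snd fst]) (auto simp: affine_charts_def)
  qed
  have hol_ab: "holo_on (\<lambda>p::complex \<times> (complex \<times> complex) \<times> complex. a (fst (snd p))) S"
    "holo_on (\<lambda>p::complex \<times> (complex \<times> complex) \<times> complex. b (fst (snd p))) S" for S
    using ab by (auto intro!: holo_on_fst holo_on_snd holo_on_id)
  have cont_a: "continuous_on UNIV (\<lambda>p::complex \<times> (complex \<times> complex) \<times> complex. a (fst (snd p)))"
    by (rule holo_on_imp_continuous_on[OF hol_ab(1)])
  have "holo_into_cp2 (\<lambda>(\<epsilon>, z). G \<epsilon> (\<phi> z)) (D \<times> UNIV)"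
    using G \<phi> unfolding holo_family_cp2_def by blast
  then obtain \<psi> V h where \<psi>: "\<psi> \<in> affine_charts" and V: "open V" "(0, b w0 / a w0, 0) \<in> V"
    and h: "holo_on h V" and hV: "\<forall>z\<in>V. (\<lambda>(\<epsilon>, z). G \<epsilon> (\<phi> z)) z = \<psi> (h z)"
    using D(2) unfolding holo_into_cp2_def by (metis (no_types, lifting) SigmaI UNIV_I)
  define m where "m p = (fst p, b (fst (snd p)) / a (fst (snd p)), snd (snd p) / a (fst (snd p)))"
    for p :: "complex \<times> (complex \<times> complex) \<times> complex"
  define Z where "Z = {p :: complex \<times> (complex \<times> complex) \<times> complex. a (fst (snd p)) \<noteq> 0}"
  have oZ: "open Z"
    unfolding Z_def using cont_a by (intro open_Collect_neq) (auto intro: continuous_intros)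
  have hm: "holo_on m Z"
    unfolding m_def
    by (intro holo_on_Pair holo_on_divide hol_ab holo_on_fst holo_on_snd holo_on_id)
      (auto simp: Z_def)
  define Q where "Q = Z \<inter> m -` V"
  have oQ: "open Q"
    unfolding Q_def
    using continuous_open_preimage[OF holo_on_imp_continuous_on[OF hm] oZ V(1)] by simp
  define H where "H p = h (m p)" for p
  have hH: "holo_on H Q"
    unfolding H_def by (rule holo_on_compose[OF holo_on_subset[OF hm] h]) (auto simp: Q_def)
  define p0 where "p0 = (0::complex, w0, 0::complex)"
  have p0: "p0 \<in> Q" using V(2) a0 by (simp add: Q_def Z_def m_def p0_def)
  define Q' where "Q' = (Q \<inter> H -` ball 0 (norm (H p0) + 1)) \<inter> (D \<times> UNIV)"
  have "open (Q \<inter> H -` ball 0 (norm (H p0) + 1))"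
    by (rule continuous_open_preimage[OF holo_on_imp_continuous_on[OF hH] oQ open_ball])
  then have "open Q'" unfolding Q'_def by (rule open_Int) (intro open_Times D(1) open_UNIV)
  moreover have "(0, w0, 0) \<in> Q'"
    using p0 D(2) unfolding Q'_def p0_def by (simp add: add.commute)
  ultimately obtain \<delta> where \<delta>: "\<delta> > 0" "ball 0 \<delta> \<times> ball w0 \<delta> \<times> ball 0 \<delta> \<subseteq> Q'"
    by (rule open_contains_box)
  show thesis
  proof (rule that[OF \<psi> \<delta>(1), of H "norm (H p0) + 1"])
    show "ball 0 \<delta> \<subseteq> D"
    proof
      fix \<epsilon> :: complex assume "\<epsilon> \<in> ball 0 \<delta>"
      then have "(\<epsilon>, w0, 0) \<in> Q'" using \<delta> by auto
      then show "\<epsilon> \<in> D" by (simp add: Q'_def)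
    qed
    show "holo_on H (ball 0 \<delta> \<times> ball w0 \<delta> \<times> ball 0 \<delta>)"
      by (rule holo_on_subset[OF hH]) (use \<delta>(2) in \<open>auto simp: Q'_def\<close>)
    show "norm (H p) \<le> norm (H p0) + 1" if "p \<in> ball 0 \<delta> \<times> ball w0 \<delta> \<times> ball 0 \<delta>" for p
    proof -
      have "p \<in> Q'" using that \<delta>(2) by blast
      then show ?thesis by (simp add: Q'_def dist_norm)
    qed
    fix \<epsilon> v :: complex and w
    assume *: "norm \<epsilon> < \<delta>" "w \<in> ball w0 \<delta>" "norm v < \<delta>" "v \<noteq> 0"
    then have "(\<epsilon>, w, v) \<in> Q'" using \<delta>(2) by (auto simp: dist_norm)
    then have Z: "a w \<noteq> 0" "m (\<epsilon>, w, v) \<in> V" and "\<epsilon> \<in> D"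
      by (auto simp: Q'_def Q_def Z_def)
    have "\<psi> (H (\<epsilon>, w, v)) = G \<epsilon> (\<phi> (b w / a w, v / a w))"
      using hV Z(2) by (auto simp: H_def m_def)
    also have "\<dots> = G \<epsilon> (hcoord (fst w / v) (snd w / v) 1)"
      using \<phi>_eq Z(1) * by simp
    also have "\<dots> = hcoord (fst (F \<epsilon> (fst w / v, snd w / v))) (snd (F \<epsilon> (fst w / v, snd w / v))) 1"
      using ext \<open>\<epsilon> \<in> D\<close> unfolding extends_to_cp2_def by blast
    finally show "hcoord (fst (F \<epsilon> (fst w / v, snd w / v))) (snd (F \<epsilon> (fst w / v, snd w / v))) 1
        = \<psi> (H (\<epsilon>, w, v))" by simp
  qed
qed

definition reciprocal_size ::
    "map_family \<Rightarrow> complex \<times> complex \<Rightarrow> real \<Rightarrow> real \<Rightarrow>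
      (complex \<times> (complex \<times> complex) \<times> complex \<Rightarrow> complex) \<Rightarrow> bool" where
  "reciprocal_size F w0 \<delta> b g \<longleftrightarrow> holo_on g (ball 0 \<delta> \<times> ball w0 \<delta> \<times> ball 0 \<delta>) \<and>
     (\<forall>p \<in> ball 0 \<delta> \<times> ball w0 \<delta> \<times> ball 0 \<delta>. norm (g p) \<le> b) \<and>
     (\<forall>\<epsilon> w v. norm \<epsilon> < \<delta> \<and> w \<in> ball w0 \<delta> \<and> norm v < \<delta> \<and> v \<noteq> 0 \<longrightarrow> g (\<epsilon>, w, v) \<noteq> 0 \<and>
        1 / norm (g (\<epsilon>, w, v)) \<le> norm (F \<epsilon> (fst w / v, snd w / v)) \<and>
        norm (F \<epsilon> (fst w / v, snd w / v)) \<le> b / norm (g (\<epsilon>, w, v)))"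

text \<open>
  Where the image is described in the affine chart, the map is bounded. In the charts \<open>[1 : h : g]\<close>
  and \<open>[h : 1 : g]\<close> the affine image is \<open>(1/g, h/g)\<close> or \<open>(h/g, 1/g)\<close>, and \<open>h\<close> is bounded.
\<close>

lemma size_near_infinity:
  fixes F :: map_family
  assumes G: "holo_family_cp2 D G" and ext: "\<forall>\<epsilon>\<in>D. extends_to_cp2 (F \<epsilon>) (G \<epsilon>)"
    and D: "open D" "0 \<in> D" and w0: "w0 \<noteq> 0"
  obtains \<delta> b where "\<delta> > 0" "b > 0" "ball 0 \<delta> \<subseteq> D"
    "(\<forall>\<epsilon> w v. norm \<epsilon> < \<delta> \<and> w \<in> ball w0 \<delta> \<and> norm v < \<delta> \<and> v \<noteq> 0 \<longrightarrow>
        norm (F \<epsilon> (fst w / v, snd w / v)) \<le> b) \<or>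
     (\<exists>g. reciprocal_size F w0 \<delta> b g)"
proof (rule chart_at_infinity[OF G ext D w0])
  fix \<psi> H and \<delta> b :: real
  assume \<psi>: "\<psi> \<in> affine_charts" and \<delta>: "\<delta> > 0" "ball 0 \<delta> \<subseteq> D"
    and H: "holo_on H (ball 0 \<delta> \<times> ball w0 \<delta> \<times> ball 0 \<delta>)"
    and b: "\<And>p. p \<in> ball 0 \<delta> \<times> ball w0 \<delta> \<times> ball 0 \<delta> \<Longrightarrow> norm (H p) \<le> b"
    and eq: "\<And>\<epsilon> w v. norm \<epsilon> < \<delta> \<Longrightarrow> w \<in> ball w0 \<delta> \<Longrightarrow> norm v < \<delta> \<Longrightarrow> v \<noteq> 0 \<Longrightarrow>
       hcoord (fst (F \<epsilon> (fst w / v, snd w / v))) (snd (F \<epsilon> (fst w / v, snd w / v))) 1 = \<psi> (H (\<epsilon>, w, v))"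
  define S where "S = ball (0::complex) \<delta> \<times> ball w0 \<delta> \<times> ball (0::complex) \<delta>"
  have mem: "(\<epsilon>, w, v) \<in> S" if "norm \<epsilon> < \<delta>" "w \<in> ball w0 \<delta>" "norm v < \<delta>" for \<epsilon> w v
    using that by (simp add: S_def)
  have "norm (H (0, w0, 0)) \<le> b" by (rule b) (simp add: \<delta>(1))
  then have "b \<ge> 0" using norm_ge_zero order_trans by blast
  have bS: "norm (fst (H p)) \<le> b" "norm (snd (H p)) \<le> b" if "p \<in> S" for p
    using b[of p] that norm_fst_le_norm[of "H p"] norm_snd_le_norm[of "H p"] by (auto simp: S_def)
  consider (affine) "\<psi> = (\<lambda>(u, v). hcoord u v 1)"
    | (infinite) "\<psi> = (\<lambda>(u, v). hcoord u 1 v) \<or> \<psi> = (\<lambda>(u, v). hcoord 1 u v)"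
    using \<psi> unfolding affine_charts_def by blast
  then show ?thesis
  proof cases
    case affine
    have "norm (F \<epsilon> (fst w / v, snd w / v)) \<le> b + 1"
      if *: "norm \<epsilon> < \<delta>" "w \<in> ball w0 \<delta>" "norm v < \<delta>" "v \<noteq> 0" for \<epsilon> w v
    proof -
      define P where "P = F \<epsilon> (fst w / v, snd w / v)"
      have "hcoord (fst P) (snd P) 1 = hcoord (fst (H (\<epsilon>, w, v))) (snd (H (\<epsilon>, w, v))) 1"
        using eq[OF *] by (simp add: affine P_def case_prod_unfold)
      then obtain t where "fst (H (\<epsilon>, w, v)) = t * fst P" "snd (H (\<epsilon>, w, v)) = t * snd P" "1 = t * 1"
        by (rule hcoord_eqD) (auto simp: zero_prod_def)
      then have "P = H (\<epsilon>, w, v)" by (simp add: prod_eq_iff)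
      then show ?thesis using b[of "(\<epsilon>, w, v)"] mem[of \<epsilon> w v] * by (auto simp: P_def S_def)
    qed
    then show ?thesis using that[of \<delta> "b + 1"] \<delta> \<open>b \<ge> 0\<close> by force
  next
    case infinite
    have coords: "g \<noteq> 0 \<and> (fst P = c / g \<and> snd P = 1 / g \<or> fst P = 1 / g \<and> snd P = c / g)"
      if "hcoord (fst P) (snd P) 1 = \<psi> (c, g)" for P c g
      using infinite
    proof
      assume "\<psi> = (\<lambda>(u, v). hcoord u 1 v)"
      then have "hcoord (fst P) (snd P) 1 = hcoord c 1 g" using that by simp
      then obtain t where "c = t * fst P" "1 = t * snd P" "g = t * 1"
        by (rule hcoord_eqD) (auto simp: zero_prod_def)
      then show ?thesis by (auto simp: eq_divide_eq mult.commute)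
    next
      assume "\<psi> = (\<lambda>(u, v). hcoord 1 u v)"
      then have "hcoord (fst P) (snd P) 1 = hcoord 1 c g" using that by simp
      then obtain t where "1 = t * fst P" "c = t * snd P" "g = t * 1"
        by (rule hcoord_eqD) (auto simp: zero_prod_def)
      then show ?thesis by (auto simp: eq_divide_eq mult.commute)
    qed
    have key: "snd (H (\<epsilon>, w, v)) \<noteq> 0 \<and>
        norm (F \<epsilon> (fst w / v, snd w / v)) \<ge> 1 / norm (snd (H (\<epsilon>, w, v))) \<and>
        norm (F \<epsilon> (fst w / v, snd w / v)) \<le> (b + 1) / norm (snd (H (\<epsilon>, w, v)))"
      if *: "norm \<epsilon> < \<delta>" "w \<in> ball w0 \<delta>" "norm v < \<delta>" "v \<noteq> 0" for \<epsilon> w v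
    proof -
      define P where "P = F \<epsilon> (fst w / v, snd w / v)"
      define c g where "c = fst (H (\<epsilon>, w, v))" and "g = snd (H (\<epsilon>, w, v))"
      have P: "g \<noteq> 0" "fst P = c / g \<and> snd P = 1 / g \<or> fst P = 1 / g \<and> snd P = c / g"
        using eq[OF *] coords[of P c g] unfolding P_def c_def g_def prod.collapse by blast+
      have cb: "norm c \<le> b" using bS(1)[OF mem] * by (simp add: c_def)
      have "norm P \<le> norm (fst P) + norm (snd P)" by (metis norm_Pair_le prod.collapse)
      also have "\<dots> = (norm c + 1) / norm g"
        using P(2) by (elim disjE) (simp_all add: norm_divide add_divide_distrib)
      also have "\<dots> \<le> (b + 1) / norm g"
        using cb by (intro divide_right_mono) auto
      finally have "norm P \<le> (b + 1) / norm g" .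
      moreover have "1 / norm g \<le> norm P"
        using norm_fst_le_norm[of P] norm_snd_le_norm[of P] P(2) by (elim disjE) (simp_all add: norm_divide)
      ultimately show ?thesis using P(1) by (simp add: P_def g_def)
    qed
    have "reciprocal_size F w0 \<delta> (b + 1) (\<lambda>p. snd (H p))"
      unfolding reciprocal_size_def
    proof (intro conjI)
      show "holo_on (\<lambda>p. snd (H p)) (ball 0 \<delta> \<times> ball w0 \<delta> \<times> ball 0 \<delta>)" by (rule holo_on_snd[OF H])
      show "\<forall>p\<in>ball 0 \<delta> \<times> ball w0 \<delta> \<times> ball 0 \<delta>. norm (snd (H p)) \<le> b + 1"
        using bS(2) unfolding S_def by (intro ballI) (rule add_increasing2, auto)
    qed (intro allI impI, elim conjE, rule key)
    then have "\<exists>g. reciprocal_size F w0 \<delta> (b + 1) g"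
      by (rule exI[where P = "reciprocal_size F w0 \<delta> (b + 1)"])
    then show ?thesis using that[of \<delta> "b + 1"] \<delta> \<open>b \<ge> 0\<close> by simp
  qed
qed

section \<open>The local form of the family\<close>

text \<open>
  The estimates below see the family only through the two cofactors \<open>s\<close> and \<open>m\<close>, each known up to a
  multiple of \<open>\<bar>x\<bar>\<^sup>2 + \<bar>y\<bar> + \<bar>\<epsilon>\<bar>\<^sup>2\<close>. The term \<open>r y\<close> of the expansion is part of this error: along an
  orbit that passes the origin the sum of \<open>\<bar>y\<bar>\<close> is as harmless as that of \<open>\<bar>x\<bar>\<^sup>2\<close>.
\<close>

definition gate_form ::
    "map_family \<Rightarrow> real \<Rightarrow> complex \<Rightarrow> real \<Rightarrow> real \<Rightarrow> bool" where
  "gate_form F \<rho> q C r \<longleftrightarrow> C > 0 \<and> r > 0 \<and>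
     (\<forall>\<epsilon> x y. norm \<epsilon> < r \<and> norm x < r \<and> norm y < r \<longrightarrow>
       (\<exists>s m. F \<epsilon> (x, y) = (x + (x^2 + \<epsilon>^2) * s, y * m) \<and>
          norm (s - 1 - (q + 1) * x) \<le> C * ((norm x)^2 + norm y + (norm \<epsilon>)^2) \<and>
          norm (m - 1 - of_real \<rho> * x) \<le> C * ((norm x)^2 + norm y + (norm \<epsilon>)^2)))"

lemma gate_formE:
  assumes "gate_form F \<rho> q C r" "norm \<epsilon> < r" "norm x < r" "norm y < r"
  obtains s m where "F \<epsilon> (x, y) = (x + (x^2 + \<epsilon>^2) * s, y * m)"
    "norm (s - 1 - (q + 1) * x) \<le> C * ((norm x)^2 + norm y + (norm \<epsilon>)^2)"
    "norm (m - 1 - of_real \<rho> * x) \<le> C * ((norm x)^2 + norm y + (norm \<epsilon>)^2)"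
  using assms unfolding gate_form_def by blast

lemma gate_form_pos: "gate_form F \<rho> q C r \<Longrightarrow> C > 0" "gate_form F \<rho> q C r \<Longrightarrow> r > 0"
  unfolding gate_form_def by blast+

lemma gate_form_0:
  assumes "gate_form F \<rho> q C r" shows "F 0 (0, 0) = (0, 0)"
  by (rule gate_formE[OF assms, of 0 0 0]) (use gate_form_pos(2)[OF assms] in simp_all)

lemma big_O_bound:
  assumes "f \<in> big_O gs"
  obtains K where "K \<ge> 0" "\<forall>\<^sub>F p in nhds 0. norm (f p) \<le> K * (\<Sum>i<length gs. norm ((gs ! i) p))"
proof -
  obtain hs where hs: "length hs = length gs" "\<forall>h\<in>set hs. holo_germ h"
    "\<forall>\<^sub>F p in nhds 0. f p = (\<Sum>i<length gs. (hs ! i) p * (gs ! i) p)"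
    using assms unfolding big_O_def by blast
  have germ: "\<exists>B. \<forall>\<^sub>F p in nhds 0. norm (h p) \<le> B" if h: "holo_germ h" for h :: "'a \<Rightarrow> complex"
  proof -
    obtain V where V: "0 \<in> V" "holo_on h V" using h unfolding holo_germ_def by blast
    have "isCont h 0" using V(2,1) by (rule holo_on_imp_isCont)
    then have "(h \<longlongrightarrow> h 0) (nhds 0)"
      by (simp add: isCont_def tendsto_at_iff_tendsto_nhds)
    then have "((\<lambda>p. norm (h p)) \<longlongrightarrow> norm (h 0)) (nhds 0)"
      by (rule tendsto_norm)
    then have "\<forall>\<^sub>F p in nhds 0. norm (h p) < norm (h 0) + 1"
      by (rule order_tendstoD) simp
    then show ?thesis by (intro exI[of _ "norm (h 0) + 1"]) (auto elim: eventually_mono)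
  qed
  have "\<exists>B\<ge>0. \<forall>\<^sub>F p in nhds 0. \<forall>h\<in>set hs. norm (h p) \<le> B"
    using hs(2)
  proof (induction hs)
    case Nil
    then show ?case by (auto intro!: exI[of _ 0])
  next
    case (Cons h hs)
    then obtain B where B: "B \<ge> 0" "\<forall>\<^sub>F p in nhds 0. \<forall>h\<in>set hs. norm (h p) \<le> B" by auto
    obtain B' where B': "\<forall>\<^sub>F p in nhds 0. norm (h p) \<le> B'" using germ Cons.prems by auto
    have "\<forall>\<^sub>F p in nhds 0. \<forall>h\<in>set (h # hs). norm (h p) \<le> max B B'"
      using B(2) B' by eventually_elim force
    then show ?case using B(1) by (intro exI[of _ "max B B'"]) simp
  qed
  then obtain B where B: "B \<ge> 0" "\<forall>\<^sub>F p in nhds 0. \<forall>h\<in>set hs. norm (h p) \<le> B" by blast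
  have "\<forall>\<^sub>F p in nhds 0. norm (f p) \<le> B * (\<Sum>i<length gs. norm ((gs ! i) p))"
    using hs(3) B(2)
  proof eventually_elim
    case (elim p)
    have "norm (f p) \<le> (\<Sum>i<length gs. norm ((hs ! i) p * (gs ! i) p))"
      unfolding elim(1) by (rule norm_sum)
    also have "\<dots> \<le> (\<Sum>i<length gs. B * norm ((gs ! i) p))"
      using elim(2) hs(1) by (intro sum_mono) (simp add: norm_mult mult_right_mono)
    finally show ?case by (simp add: sum_distrib_left)
  qed
  then show ?thesis using that B(1) by blast
qed

text \<open>
  For coordinates bounded by one, \<open>x y\<close>, \<open>y\<^sup>2\<close> and \<open>r y\<close> are all dominated by \<open>\<bar>y\<bar>\<close>.
\<close>

lemma gate_formI:
  assumes "A \<in> big_O [\<lambda>(\<epsilon>, x, y). x^2, \<lambda>(\<epsilon>, x, y). x * y, \<lambda>(\<epsilon>, x, y). y^2]"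
    and "B \<in> big_O [\<lambda>(\<epsilon>, x, y). \<epsilon>^2]"
    and "A' \<in> big_O [\<lambda>(\<epsilon>, x, y). x^2, \<lambda>(\<epsilon>, x, y). x * y, \<lambda>(\<epsilon>, x, y). y^2]"
    and "B' \<in> big_O [\<lambda>(\<epsilon>, x, y). \<epsilon>^2]"
    and "\<forall>\<^sub>F (\<epsilon>, x, y) in nhds 0. F \<epsilon> (x, y) =
           (x + (x^2 + \<epsilon>^2) * (1 + (q + 1) * x + r * y + A (\<epsilon>, x, y) + B (\<epsilon>, x, y)),
            y * (1 + of_real \<rho> * x + A' (\<epsilon>, x, y) + B' (\<epsilon>, x, y)))"
  obtains C r' where "gate_form F \<rho> q C r'"
proof -
  define E where "E p = (norm (fst (snd p)))^2 + norm (fst (snd p)) * norm (snd (snd p)) + (norm (snd (snd p)))^2"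
    for p :: "complex \<times> complex \<times> complex"
  have quad: "\<exists>K\<ge>0. \<forall>\<^sub>F p in nhds 0. norm (f p) \<le> K * E p"
    if "f \<in> big_O [\<lambda>(\<epsilon>, x, y). x^2, \<lambda>(\<epsilon>, x, y). x * y, \<lambda>(\<epsilon>, x, y). y^2]" for f
  proof (rule big_O_bound[OF that])
    fix K :: real assume "K \<ge> 0" and *: "\<forall>\<^sub>F p in nhds 0. norm (f p) \<le> K * (\<Sum>i<length
      [\<lambda>(\<epsilon>, x, y). x^2, \<lambda>(\<epsilon>, x, y). x * y, \<lambda>(\<epsilon>, x, y). y^2].
      norm (([\<lambda>(\<epsilon>, x, y). x^2, \<lambda>(\<epsilon>, x, y). x * y, \<lambda>(\<epsilon>, x, y). y^2] ! i) p))"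
    then show ?thesis
      by (intro exI[of _ K] conjI) (simp_all add: E_def case_prod_unfold eval_nat_numeral norm_mult)
  qed
  have eps: "\<exists>K\<ge>0. \<forall>\<^sub>F p in nhds 0. norm (f p) \<le> K * (norm (fst p))^2"
    if "f \<in> big_O [\<lambda>(\<epsilon>::complex, x::complex, y::complex). \<epsilon>^2]" for f
  proof (rule big_O_bound[OF that])
    fix K :: real assume "K \<ge> 0" and *: "\<forall>\<^sub>F p in nhds 0. norm (f p) \<le> K * (\<Sum>i<length
      [\<lambda>(\<epsilon>::complex, x::complex, y::complex). \<epsilon>^2].
      norm (([\<lambda>(\<epsilon>::complex, x::complex, y::complex). \<epsilon>^2] ! i) p))"
    then show ?thesis
      by (intro exI[of _ K] conjI) (simp_all add: case_prod_unfold norm_power)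
  qed
  obtain K1 where K1: "K1 \<ge> 0" "\<forall>\<^sub>F p in nhds 0. norm (A p) \<le> K1 * E p" using quad[OF assms(1)] by blast
  obtain K2 where K2: "K2 \<ge> 0" "\<forall>\<^sub>F p in nhds 0. norm (B p) \<le> K2 * (norm (fst p))^2" using eps[OF assms(2)] by blast
  obtain K3 where K3: "K3 \<ge> 0" "\<forall>\<^sub>F p in nhds 0. norm (A' p) \<le> K3 * E p" using quad[OF assms(3)] by blast
  obtain K4 where K4: "K4 \<ge> 0" "\<forall>\<^sub>F p in nhds 0. norm (B' p) \<le> K4 * (norm (fst p))^2" using eps[OF assms(4)] by blast
  have "\<forall>\<^sub>F p in nhds 0. norm (A p) \<le> K1 * E p \<and> norm (B p) \<le> K2 * (norm (fst p))^2 \<and>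
      norm (A' p) \<le> K3 * E p \<and> norm (B' p) \<le> K4 * (norm (fst p))^2 \<and>
      F (fst p) (snd p) =
           (fst (snd p) + ((fst (snd p))^2 + (fst p)^2) * (1 + (q + 1) * fst (snd p) + r * snd (snd p) + A p + B p),
            snd (snd p) * (1 + of_real \<rho> * fst (snd p) + A' p + B' p))"
    using K1(2) K2(2) K3(2) K4(2) assms(5) by eventually_elim (auto simp: case_prod_unfold)
  then obtain S where S: "open S" "0 \<in> S" and
    bnd: "\<And>p. p \<in> S \<Longrightarrow> norm (A p) \<le> K1 * E p" "\<And>p. p \<in> S \<Longrightarrow> norm (B p) \<le> K2 * (norm (fst p))^2"
      "\<And>p. p \<in> S \<Longrightarrow> norm (A' p) \<le> K3 * E p" "\<And>p. p \<in> S \<Longrightarrow> norm (B' p) \<le> K4 * (norm (fst p))^2" and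
    eq: "\<And>p. p \<in> S \<Longrightarrow> F (fst p) (snd p) =
           (fst (snd p) + ((fst (snd p))^2 + (fst p)^2) * (1 + (q + 1) * fst (snd p) + r * snd (snd p) + A p + B p),
            snd (snd p) * (1 + of_real \<rho> * fst (snd p) + A' p + B' p))"
    unfolding eventually_nhds by blast
  obtain d where d: "d > 0" "ball 0 d \<times> ball 0 d \<times> ball 0 d \<subseteq> S"
    by (rule open_contains_box[OF S(1), of 0 0 0]) (use S(2) in \<open>simp_all add: zero_prod_def\<close>)
  define C where "C = norm r + 2 * (K1 + K3) + K2 + K4 + 1"
  have "gate_form F \<rho> q C (min d 1)"
    unfolding gate_form_def
  proof (intro conjI allI impI)
    show "C > 0" "min d 1 > 0" using K1(1) K2(1) K3(1) K4(1) d(1) by (auto simp: C_def add_nonneg_pos)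
    fix \<epsilon> x y :: complex
    assume *: "norm \<epsilon> < min d 1 \<and> norm x < min d 1 \<and> norm y < min d 1"
    then have p: "(\<epsilon>, x, y) \<in> S" using d(2) by auto
    define Z where "Z = (norm x)^2 + norm y + (norm \<epsilon>)^2"
    have Z: "norm y \<le> Z" "(norm \<epsilon>)^2 \<le> Z" "0 \<le> Z" by (auto simp: Z_def)
    have "norm x * norm y \<le> norm y" "(norm y)^2 \<le> norm y"
      using * mult_left_le_one_le[of "norm y" "norm x"] mult_left_le_one_le[of "norm y" "norm y"]
      by (simp_all add: power2_eq_square)
    then have E: "E (\<epsilon>, x, y) \<le> 2 * Z"
      unfolding E_def Z_def fst_conv snd_conv by (smt (verit) norm_ge_zero zero_le_power2)
    have le: "K * E (\<epsilon>, x, y) \<le> 2 * K * Z" if "K \<ge> 0" for K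
      using mult_left_mono[OF E that] by simp
    have le': "K * (norm \<epsilon>)^2 \<le> K * Z" if "K \<ge> 0" for K
      using mult_left_mono[OF Z(2) that] by simp
    define s where "s = 1 + (q + 1) * x + r * y + A (\<epsilon>, x, y) + B (\<epsilon>, x, y)"
    define m where "m = 1 + of_real \<rho> * x + A' (\<epsilon>, x, y) + B' (\<epsilon>, x, y)"
    have "norm (s - 1 - (q + 1) * x) = norm (r * y + A (\<epsilon>, x, y) + B (\<epsilon>, x, y))"
      by (simp add: s_def add.assoc)
    also have "\<dots> \<le> norm (r * y) + norm (A (\<epsilon>, x, y)) + norm (B (\<epsilon>, x, y))"
      by (rule order_trans[OF norm_triangle_ineq add_right_mono[OF norm_triangle_ineq]])
    also have "\<dots> \<le> norm r * Z + 2 * K1 * Z + K2 * Z"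
      using bnd(1,2)[OF p] le[OF K1(1)] le'[OF K2(1)] mult_left_mono[OF Z(1), of "norm r"]
      by (simp add: norm_mult)
    also have "\<dots> = (norm r + 2 * K1 + K2) * Z" by (simp add: algebra_simps)
    also have "\<dots> \<le> C * Z" using K1(1) K3(1) K4(1) Z(3) by (intro mult_right_mono) (simp_all add: C_def)
    finally have 1: "norm (s - 1 - (q + 1) * x) \<le> C * Z" .
    have "norm (m - 1 - of_real \<rho> * x) = norm (A' (\<epsilon>, x, y) + B' (\<epsilon>, x, y))"
      by (simp add: m_def)
    also have "\<dots> \<le> norm (A' (\<epsilon>, x, y)) + norm (B' (\<epsilon>, x, y))"
      by (rule norm_triangle_ineq)
    also have "\<dots> \<le> 2 * K3 * Z + K4 * Z"
      using bnd(3,4)[OF p] le[OF K3(1)] le'[OF K4(1)] by simp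
    also have "\<dots> = (2 * K3 + K4) * Z" by (simp add: algebra_simps)
    also have "\<dots> \<le> C * Z" using K1(1) K2(1) Z(3) by (intro mult_right_mono) (simp_all add: C_def)
    finally have 2: "norm (m - 1 - of_real \<rho> * x) \<le> C * Z" .
    have "F \<epsilon> (x, y) = (x + (x^2 + \<epsilon>^2) * s, y * m)"
      using eq[OF p] by (simp add: s_def m_def)
    then show "\<exists>s m. F \<epsilon> (x, y) = (x + (x^2 + \<epsilon>^2) * s, y * m) \<and>
          norm (s - 1 - (q + 1) * x) \<le> C * ((norm x)^2 + norm y + (norm \<epsilon>)^2) \<and>
          norm (m - 1 - of_real \<rho> * x) \<le> C * ((norm x)^2 + norm y + (norm \<epsilon>)^2)"
      using 1 2 unfolding Z_def by (intro exI[of _ s] exI[of _ m] conjI)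
  qed
  then show ?thesis using that by blast
qed

text \<open>
  A point that keeps \<open>K(F\<^sub>\<epsilon>)\<close> from being empty; the Hausdorff distance to the empty set would carry no
  information.
\<close>

lemma gate_form_fixed_point:
  assumes gf: "gate_form F \<rho> q C r" and \<epsilon>: "norm \<epsilon> < r"
  shows "(\<i> * \<epsilon>, 0) \<in> filled_Julia (F \<epsilon>)"
proof -
  have "norm (\<i> * \<epsilon>) < r" "norm (0::complex) < r"
    using \<epsilon> gate_form_pos(2)[OF gf] by (simp_all add: norm_mult)
  then have fp: "F \<epsilon> (\<i> * \<epsilon>, 0) = (\<i> * \<epsilon>, 0)"
    by (rule gate_formE[OF gf \<epsilon>]) (simp add: power_mult_distrib)
  have "(F \<epsilon> ^^ n) (\<i> * \<epsilon>, 0) = (\<i> * \<epsilon>, 0)" for n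
    by (induction n) (simp_all add: fp)
  then show ?thesis by (simp add: filled_Julia_def)
qed

section \<open>A uniform escape radius\<close>

text \<open>
  Along a direction that is not vertical, the first component has the quadratic coefficient
  \<open>(fst w)\<^sup>2 \<noteq> 0\<close>, so Liouville forbids linear growth.
\<close>

lemma no_linear_growth:
  assumes gf: "gate_form F \<rho> q C r"
    and hol: "holo_on (F 0) UNIV"
    and w: "fst w \<noteq> 0"
    and lin: "\<And>t. norm t \<ge> A \<Longrightarrow> norm (F 0 (t * fst w, t * snd w)) \<le> B * norm t"
  shows False
proof -
  define x y where "x = fst w" and "y = snd w"
  define f where "f t = fst (F 0 (t * x, t * y))" for t
  have "holo_on f UNIV"
    unfolding f_def
    by (rule holo_on_fst, rule holo_on_compose[OF _ hol])
      (use holo_on_line[of 0 x 0 y UNIV] in auto)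
  then have holf: "f holomorphic_on UNIV" by (rule holo_on_imp_holomorphic_on)
  have f0: "f 0 = 0" using gate_form_0[OF gf] by (simp add: f_def)
  have lin': "norm (f t) \<le> B * norm t ^ 1" if "norm t \<ge> A" for t
    using lin[OF that] norm_fst_le_norm[of "F 0 (t * x, t * y)"] by (simp add: f_def x_def y_def)
  have "f t = (\<Sum>k\<le>1. (deriv ^^ k) f 0 / fact k * t ^ k)" for t
    using Liouville_polynomial[OF holf lin'] .
  then have odd: "f t + f (- t) = 0" for t
    using f0 by (simp add: atMost_Suc)
  note C = gate_form_pos(1)[OF gf] and r = gate_form_pos(2)[OF gf]
  define K where "K = norm x ^ 2 * (norm (q + 1) * norm x + C * (norm x ^ 2 + norm y))"
  have K: "K \<ge> 0" unfolding K_def using C by (intro mult_nonneg_nonneg add_nonneg_nonneg) auto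
  have quad: "norm (f t - t * x - t^2 * x^2) \<le> K * norm t ^ 3"
    if t: "norm t < 1" "norm t * norm x < r" "norm t * norm y < r" for t
  proof -
    obtain s m where sm: "F 0 (t * x, t * y) = (t * x + ((t * x)^2 + 0^2) * s, t * y * m)"
      "norm (s - 1 - (q + 1) * (t * x)) \<le> C * ((norm (t * x))^2 + norm (t * y) + (norm (0::complex))^2)"
      by (rule gate_formE[OF gf, of 0 "t * x" "t * y"]) (use t r in \<open>auto simp: norm_mult\<close>)
    have "norm (s - 1) \<le> norm ((q + 1) * (t * x)) + norm (s - 1 - (q + 1) * (t * x))"
      using norm_triangle_ineq[of "(q + 1) * (t * x)" "s - 1 - (q + 1) * (t * x)"] by simp
    also have "\<dots> \<le> norm t * (norm (q + 1) * norm x) + C * ((norm t * norm x)^2 + norm t * norm y)"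
      using sm(2) by (simp add: norm_mult mult_ac)
    also have "\<dots> \<le> norm t * (norm (q + 1) * norm x) + C * (norm t * norm x ^ 2 + norm t * norm y)"
    proof -
      have "(norm t * norm x)^2 \<le> norm t * norm x ^ 2"
        using t(1) mult_right_mono[OF mult_left_le[of "norm t" "norm t"], of "norm x ^ 2"]
        by (simp add: power2_eq_square mult_ac)
      then show ?thesis using C by simp
    qed
    finally have s: "norm (s - 1) \<le> norm t * (norm (q + 1) * norm x + C * (norm x ^ 2 + norm y))"
      by (simp add: algebra_simps)
    have "f t - t * x - t^2 * x^2 = (t * x)^2 * (s - 1)"
      by (simp add: f_def sm(1) algebra_simps power2_eq_square)
    then have "norm (f t - t * x - t^2 * x^2) = (norm t * norm x)^2 * norm (s - 1)"
      by (simp add: norm_mult norm_power)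
    also have "\<dots> \<le> (norm t * norm x)^2 * (norm t * (norm (q + 1) * norm x + C * (norm x ^ 2 + norm y)))"
      by (rule mult_left_mono[OF s]) simp
    also have "\<dots> = K * norm t ^ 3"
      by (simp add: K_def power2_eq_square power3_eq_cube mult_ac)
    finally show ?thesis .
  qed
  have "norm x ^ 2 \<le> K * \<tau>" if "\<tau> > 0" "\<tau> < 1" "\<tau> * norm x < r" "\<tau> * norm y < r" for \<tau> :: real
  proof -
    define t where "t = complex_of_real \<tau>"
    have n: "norm t = \<tau>" "norm (- t) = \<tau>" using that by (simp_all add: t_def)
    have "2 * t^2 * x^2 = - ((f t - t * x - t^2 * x^2) + (f (- t) - (- t) * x - (- t)^2 * x^2))"
      using odd[of t] by (simp add: algebra_simps)
    then have "norm (2 * t^2 * x^2) \<le> norm (f t - t * x - t^2 * x^2) + norm (f (- t) - (- t) * x - (- t)^2 * x^2)"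
      by (simp only: norm_minus_cancel norm_triangle_ineq)
    also have "\<dots> \<le> 2 * (K * \<tau> ^ 3)"
      using quad[of t] quad[of "- t"] that unfolding n by simp
    finally have "\<tau>^2 * norm x ^ 2 \<le> \<tau>^2 * (K * \<tau>)"
      by (simp add: norm_mult norm_power n(1) power2_eq_square power3_eq_cube mult_ac)
    then show ?thesis using that by simp
  qed
  moreover have small: "\<forall>\<^sub>F \<tau> in at_right 0. \<tau> * c < d" if "d > 0" for c d :: real
  proof (rule order_tendstoD(2))
    show "((\<lambda>\<tau>. \<tau> * c) \<longlongrightarrow> 0 * c) (at_right 0)" by (intro tendsto_intros)
  qed (use that in simp)
  have "\<forall>\<^sub>F \<tau> in at_right 0. \<tau> > 0 \<and> \<tau> < 1 \<and> \<tau> * norm x < r \<and> \<tau> * norm y < r"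
    using small[of 1 1] small[OF r] by (intro eventually_conj eventually_at_right_less) simp_all
  ultimately have ev: "\<forall>\<^sub>F \<tau> in at_right 0. norm x ^ 2 \<le> K * \<tau>"
    by (auto elim: eventually_mono)
  have "((\<lambda>\<tau>. K * \<tau>) \<longlongrightarrow> K * 0) (at_right (0::real))"
    by (intro tendsto_intros)
  then have "norm x ^ 2 \<le> K * 0"
    using ev by (rule tendsto_lowerbound) simp
  then show False using w by (simp add: x_def)
qed

text \<open>
  For a direction that is not vertical this is again the absence of linear growth. On the vertical
  axis the second component is \<open>y (1 + O(y))\<close>.
\<close>

lemma gate_form_nonzero:
  assumes gf: "gate_form F \<rho> q C r" and hol: "holo_on (F 0) UNIV" and w: "w \<noteq> 0"
  obtains t where "F 0 (t * fst w, t * snd w) \<noteq> (0, 0)"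
proof (cases "fst w = 0")
  case False
  have "\<exists>t. F 0 (t * fst w, t * snd w) \<noteq> (0, 0)"
  proof (rule ccontr)
    assume "\<not> ?thesis"
    then have "norm (F 0 (t * fst w, t * snd w)) \<le> 0 * norm t" for t
      by (simp flip: zero_prod_def)
    then show False by (rule no_linear_growth[OF gf hol False])
  qed
  then show ?thesis using that by blast
next
  case True
  then have y: "snd w \<noteq> 0" using w by (simp add: prod_eq_iff)
  note C = gate_form_pos(1)[OF gf] and r = gate_form_pos(2)[OF gf]
  define \<eta> where "\<eta> = min r (1 / C) / 2"
  have \<eta>: "\<eta> > 0" "\<eta> < r" using C r by (auto simp: \<eta>_def min_def)
  have "C * \<eta> \<le> C * (1 / C / 2)" using C by (intro mult_left_mono) (auto simp: \<eta>_def)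
  then have C\<eta>: "C * \<eta> < 1" using C by simp
  have pr: "norm (0::complex) < r" "norm (complex_of_real \<eta>) < r" using \<eta> r by simp_all
  obtain s m where sm: "F 0 (0, of_real \<eta>) = (0 + (0^2 + 0^2) * s, of_real \<eta> * m)"
    "norm (m - 1 - of_real \<rho> * 0) \<le> C * ((norm (0::complex))^2 + norm (complex_of_real \<eta>) + (norm (0::complex))^2)"
    by (rule gate_formE[OF gf pr(1,1,2)]) (rule that)
  then have "m \<noteq> 0" using C\<eta> \<eta> by auto
  then have "F 0 (0, of_real \<eta>) \<noteq> (0, 0)" using sm(1) \<eta> by simp
  then show ?thesis using that[of "of_real \<eta> / snd w"] y True by simp
qed

lemma nonzero_bounded_below:
  fixes h :: "complex \<Rightarrow> complex"
  assumes "continuous_on (ball 0 \<delta>) h" "\<delta> > 0" "h 0 \<noteq> 0"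
  obtains \<eta> c where "0 < \<eta>" "\<eta> \<le> \<delta>" "c > 0" "\<And>v. norm v < \<eta> \<Longrightarrow> norm (h v) \<ge> c"
proof -
  have "norm (h 0) / 2 > 0" using assms(3) by simp
  then obtain d where d: "d > 0" "\<And>v. v \<in> ball 0 \<delta> \<Longrightarrow> dist v 0 < d \<Longrightarrow> dist (h v) (h 0) < norm (h 0) / 2"
    using assms(1,2) unfolding continuous_on_iff by (metis centre_in_ball)
  have "norm (h v) \<ge> norm (h 0) / 2" if "norm v < min d \<delta>" for v
  proof -
    have "norm (h v - h 0) < norm (h 0) / 2" using d(2)[of v] that by (simp add: dist_norm)
    then show ?thesis using norm_triangle_ineq2[of "h 0" "h v"] by (simp add: norm_minus_commute)
  qed
  then show ?thesis using that[of "min d \<delta>" "norm (h 0) / 2"] d(1) assms(2,3) by simp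
qed

text \<open>
  Here \<open>\<gamma>\<close> is the function \<open>v \<mapsto> g (0, w, v)\<close>. A zero of order at most one at \<open>v = 0\<close> would bound \<open>F\<^sub>0\<close>
  linearly along the line spanned by \<open>w\<close>.
\<close>

lemma double_zero_at_infinity:
  assumes gf: "gate_form F \<rho> q C r"
    and hol: "holo_on (F 0) UNIV"
    and w: "fst w \<noteq> 0" and \<delta>: "\<delta> > 0"
    and \<gamma>: "\<gamma> holomorphic_on ball 0 \<delta>"
    and bd: "\<And>v. norm v < \<delta> \<Longrightarrow> norm (\<gamma> v) \<le> b"
    and size: "\<And>v. norm v < \<delta> \<Longrightarrow> v \<noteq> 0 \<Longrightarrow> norm (F 0 (fst w / v, snd w / v)) \<le> b / norm (\<gamma> v)"
    and v: "norm v < \<delta>"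
  shows "norm (\<gamma> v) \<le> b / \<delta> / \<delta> * norm v ^ 2"
proof -
  have b: "b \<ge> 0" using bd[of 0] \<delta> norm_ge_zero order_trans by (metis norm_zero)
  have no_lower: False if "c > 0" "\<eta> > 0" "\<eta> \<le> \<delta>" and low: "\<And>v. norm v < \<eta> \<Longrightarrow> norm (\<gamma> v) \<ge> c * norm v" for c \<eta>
  proof (rule no_linear_growth[OF gf hol w])
    fix t :: complex assume t: "norm t \<ge> 2 / \<eta>"
    have t0: "norm t > 0" using t that by (meson divide_pos_pos less_le_trans zero_less_numeral)
    then have t1: "t \<noteq> 0" by auto
    have "1 / norm t \<le> \<eta> / 2" using t t0 that by (simp add: field_simps)
    then have inv: "norm (1 / t) < \<eta>" using that by (simp add: norm_divide)
    then have "norm (F 0 (fst w / (1 / t), snd w / (1 / t))) \<le> b / norm (\<gamma> (1 / t))"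
      using size[of "1 / t"] that t1 by simp
    also have "\<dots> \<le> b / (c * norm (1 / t))"
    proof -
      have "0 < c * norm (1 / t)" using t1 \<open>c > 0\<close> by simp
      then show ?thesis
        using low[OF inv] by (intro divide_left_mono[OF low[OF inv] b], intro mult_pos_pos[of "norm (\<gamma> (1 / t))"]) linarith+
    qed
    also have "\<dots> = b / c * norm t" using t0 by (simp add: norm_divide)
    finally show "norm (F 0 (t * fst w, t * snd w)) \<le> b / c * norm t"
      by (simp add: mult.commute)
  qed
  have \<gamma>0: "\<gamma> 0 = 0"
  proof (rule ccontr)
    assume "\<gamma> 0 \<noteq> 0"
    then obtain \<eta> c where *: "0 < \<eta>" "\<eta> \<le> \<delta>" "c > 0" "\<And>v. norm v < \<eta> \<Longrightarrow> norm (\<gamma> v) \<ge> c"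
      using nonzero_bounded_below[OF holomorphic_on_imp_continuous_on[OF \<gamma>] \<delta>] by blast
    have "norm (\<gamma> v) \<ge> c * norm v" if "norm v < min \<eta> 1" for v
    proof -
      have "c * norm v \<le> c" using mult_left_le[of "norm v" c] that *(3) by linarith
      then show ?thesis using *(4)[of v] that by linarith
    qed
    then show False using no_lower[of c "min \<eta> 1"] * min.coboundedI1[of \<eta> \<delta> 1] by simp
  qed
  obtain h where h: "h holomorphic_on ball 0 \<delta>" "\<And>z. norm z < \<delta> \<Longrightarrow> \<gamma> z = z * h z"
    using Schwarz3[OF \<gamma> \<gamma>0] by blast
  have h0: "h 0 = 0"
  proof (rule ccontr)
    assume "h 0 \<noteq> 0"
    then obtain \<eta> c where *: "0 < \<eta>" "\<eta> \<le> \<delta>" "c > 0" "\<And>v. norm v < \<eta> \<Longrightarrow> norm (h v) \<ge> c"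
      using nonzero_bounded_below[OF holomorphic_on_imp_continuous_on[OF h(1)] \<delta>] by blast
    have "norm (\<gamma> v) \<ge> c * norm v" if "norm v < \<eta>" for v
      using *(4)[OF that] h(2)[of v] *(2) that mult_left_mono[of c "norm (h v)" "norm v"]
      by (simp add: norm_mult mult.commute)
    then show False using no_lower[of c \<eta>] * by simp
  qed
  have \<gamma>b: "norm (\<gamma> z) \<le> b / \<delta> * norm z" if "norm z < \<delta>" for z
    using Schwarz_lemma_ball[OF \<gamma> \<gamma>0, of b z] bd that by simp
  have hb: "norm (h z) \<le> b / \<delta>" if "norm z < \<delta>" for z
  proof (cases "z = 0")
    case True
    then show ?thesis using h0 b \<delta> by simp
  next
    case False
    then have z0: "norm z > 0" by simp
    have "norm z * norm (h z) \<le> norm z * (b / \<delta>)"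
      using \<gamma>b[OF that] unfolding h(2)[OF that] norm_mult by (simp only: mult.commute)
    then show ?thesis using z0 by (simp only: mult_le_cancel_left_pos)
  qed
  have "norm (h v) \<le> b / \<delta> / \<delta> * norm v"
    using Schwarz_lemma_ball[OF h(1) h0, of "b / \<delta>" v] hb v by simp
  then have "norm v * norm (h v) \<le> norm v * (b / \<delta> / \<delta> * norm v)"
    by (rule mult_left_mono) simp
  then show ?thesis
    unfolding h(2)[OF v] norm_mult by (simp only: power2_eq_square mult_ac)
qed

lemma constant_on_line:
  assumes hol: "holo_on f (UNIV :: (complex \<times> complex) set)"
    and bd: "\<And>t. norm t \<ge> A \<Longrightarrow> norm (f (t * x, t * y) :: complex \<times> complex) \<le> B"
  shows "f (t * x, t * y) = f (0, 0)"
proof -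
  have h: "holo_on (\<lambda>t. f (t * x, t * y)) UNIV"
    by (rule holo_on_compose[OF _ hol]) (use holo_on_line[of 0 x 0 y UNIV] in simp_all)
  have a: "norm (fst (f (t * x, t * y))) \<le> B * norm t ^ 0" if "norm t \<ge> A" for t
    using bd[OF that] norm_fst_le_norm[of "f (t * x, t * y)"] by simp
  have b: "norm (snd (f (t * x, t * y))) \<le> B * norm t ^ 0" if "norm t \<ge> A" for t
    using bd[OF that] norm_snd_le_norm[of "f (t * x, t * y)"] by simp
  have "fst (f (t * x, t * y)) = fst (f (0 * x, 0 * y))"
    using Liouville_polynomial[OF holo_on_imp_holomorphic_on[OF holo_on_fst[OF h]] a, where \<xi> = t] by simp
  moreover have "snd (f (t * x, t * y)) = snd (f (0 * x, 0 * y))"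
    using Liouville_polynomial[OF holo_on_imp_holomorphic_on[OF holo_on_snd[OF h]] b, where \<xi> = t] by simp
  ultimately show ?thesis by (simp add: prod_eq_iff)
qed

text \<open>
  Near a point at infinity the function \<open>g\<close> vanishes on \<open>v = 0\<close>: otherwise the map would be bounded,
  hence constant, on a complex line through the origin. For \<open>\<epsilon> = 0\<close> the zero is at least double, and
  the Schwarz lemma carries a small bound over to \<open>\<epsilon> \<noteq> 0\<close>.
\<close>

lemma expanding_near_direction:
  fixes F :: map_family
  assumes gf: "gate_form F \<rho> q C r"
    and G: "holo_family_cp2 D G" and ext: "\<forall>\<epsilon>\<in>D. extends_to_cp2 (F \<epsilon>) (G \<epsilon>)"
    and hol: "holo_on (\<lambda>(\<epsilon>, z). F \<epsilon> z) (D \<times> UNIV)"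
    and D: "open D" "0 \<in> D" and w0: "w0 \<noteq> 0"
  shows "\<exists>\<delta>>0. \<forall>\<epsilon> w v. norm \<epsilon> < \<delta> \<and> w \<in> ball w0 \<delta> \<and> 0 < norm v \<and> norm v < \<delta> \<longrightarrow>
            norm (F \<epsilon> (fst w / v, snd w / v)) \<ge> 2 / norm v"
proof (rule size_near_infinity[OF G ext D w0])
  fix \<delta> b :: real
  assume \<delta>: "\<delta> > 0" and b: "b > 0" and \<delta>D: "ball 0 \<delta> \<subseteq> D"
    and alt: "(\<forall>\<epsilon> w v. norm \<epsilon> < \<delta> \<and> w \<in> ball w0 \<delta> \<and> norm v < \<delta> \<and> v \<noteq> 0 \<longrightarrow>
        norm (F \<epsilon> (fst w / v, snd w / v)) \<le> b) \<or>
     (\<exists>g. reciprocal_size F w0 \<delta> b g)"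
  have holF: "holo_on (F \<epsilon>) UNIV" if "\<epsilon> \<in> D" for \<epsilon>
  proof -
    have "holo_on (\<lambda>z. (\<epsilon>, z)) UNIV" by (intro holo_on_Pair holo_on_const holo_on_id)
    from holo_on_compose[OF this hol] show ?thesis using that by simp
  qed
  have hol0: "holo_on (F 0) UNIV" using holF D(2) .
  have nearby: "\<forall>\<^sub>F s::complex in at 0. fst w + s \<noteq> 0 \<and> (fst w + s, snd w) \<in> ball w0 \<delta>"
    if "w \<in> ball w0 \<delta>" for w
  proof -
    have "\<forall>\<^sub>F s in at 0. fst w + s \<noteq> 0"
    proof (cases "fst w = 0")
      case True
      then show ?thesis by (simp add: eventually_at_filter)
    next
      case False
      have "((\<lambda>s. fst w + s) \<longlongrightarrow> fst w + 0) (at 0)" by (intro tendsto_intros)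
      then show ?thesis using False by (intro tendsto_imp_eventually_ne) auto
    qed
    moreover have "((\<lambda>s. (fst w + s, snd w)) \<longlongrightarrow> (fst w + 0, snd w)) (at 0)" by (intro tendsto_intros)
    then have "\<forall>\<^sub>F s in at 0. (fst w + s, snd w) \<in> ball w0 \<delta>"
      using that by (intro topological_tendstoD) auto
    ultimately show ?thesis by (rule eventually_conj)
  qed
  have "\<not> (\<forall>\<epsilon> w v. norm \<epsilon> < \<delta> \<and> w \<in> ball w0 \<delta> \<and> norm v < \<delta> \<and> v \<noteq> 0 \<longrightarrow>
        norm (F \<epsilon> (fst w / v, snd w / v)) \<le> b)"
  proof
    assume bdd: "\<forall>\<epsilon> w v. norm \<epsilon> < \<delta> \<and> w \<in> ball w0 \<delta> \<and> norm v < \<delta> \<and> v \<noteq> 0 \<longrightarrow>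
        norm (F \<epsilon> (fst w / v, snd w / v)) \<le> b"
    have "w0 \<in> ball w0 \<delta>" using \<delta> by simp
    then obtain s where s: "fst w0 + s \<noteq> 0" "(fst w0 + s, snd w0) \<in> ball w0 \<delta>"
      using eventually_happens[OF nearby[OF \<open>w0 \<in> ball w0 \<delta>\<close>]] at_neq_bot by blast
    define w where "w = (fst w0 + s, snd w0)"
    show False
    proof (rule no_linear_growth[OF gf hol0, of w "max 1 (2 / \<delta>)" b])
      show "fst w \<noteq> 0" using s by (simp add: w_def)
      fix t :: complex assume t: "norm t \<ge> max 1 (2 / \<delta>)"
      then have t0: "t \<noteq> 0" "norm t > 0" by auto
      have "norm (1 / t) < \<delta>" using t t0 \<delta> by (simp add: norm_divide field_simps)
      then have "norm (F 0 (fst w / (1 / t), snd w / (1 / t))) \<le> b"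
        using bdd[rule_format, of 0 w "1 / t"] s(2) \<delta> t0 by (simp add: w_def)
      then have "norm (F 0 (t * fst w, t * snd w)) \<le> b"
        by (simp add: mult.commute)
      also have "\<dots> \<le> b * norm t" using t b by simp
      finally show "norm (F 0 (t * fst w, t * snd w)) \<le> b * norm t" .
    qed
  qed
  with alt obtain g where g: "reciprocal_size F w0 \<delta> b g" by blast
  have holg: "holo_on g (ball 0 \<delta> \<times> ball w0 \<delta> \<times> ball 0 \<delta>)"
    and gb: "\<forall>p \<in> ball 0 \<delta> \<times> ball w0 \<delta> \<times> ball 0 \<delta>. norm (g p) \<le> b"
    and size: "\<forall>\<epsilon> w v. norm \<epsilon> < \<delta> \<and> w \<in> ball w0 \<delta> \<and> norm v < \<delta> \<and> v \<noteq> 0 \<longrightarrow> g (\<epsilon>, w, v) \<noteq> 0 \<and>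
          1 / norm (g (\<epsilon>, w, v)) \<le> norm (F \<epsilon> (fst w / v, snd w / v)) \<and>
          norm (F \<epsilon> (fst w / v, snd w / v)) \<le> b / norm (g (\<epsilon>, w, v))"
    using g unfolding reciprocal_size_def by blast+
  have holgv: "(\<lambda>v. g (\<epsilon>, w, v)) holomorphic_on ball 0 \<delta>" if "norm \<epsilon> < \<delta>" "w \<in> ball w0 \<delta>" for \<epsilon> w
    using that
    by (intro holo_on_imp_holomorphic_on holo_on_compose[OF _ holg] holo_on_Pair holo_on_const holo_on_id) auto
  have contg: "continuous_on (ball 0 \<delta> \<times> ball w0 \<delta> \<times> ball 0 \<delta>) g"
    by (rule holo_on_imp_continuous_on[OF holg])
  have oN: "open (ball (0::complex) \<delta> \<times> ball w0 \<delta> \<times> ball (0::complex) \<delta>)"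
    by (intro open_Times open_ball)
  \<comment> \<open>the double zero, first for directions that are not vertical and then in the limit\<close>
  have dz: "norm (g (0, w, v)) \<le> b / \<delta> / \<delta> * norm v ^ 2"
    if w: "w \<in> ball w0 \<delta>" "fst w \<noteq> 0" and v: "norm v < \<delta>" for w v
  proof (rule double_zero_at_infinity[OF gf hol0 w(2) \<delta> holgv _ _ v])
    show "norm (g (0, w, v)) \<le> b" if "norm v < \<delta>" for v using gb w(1) that \<delta> by simp
    show "norm (F 0 (fst w / v, snd w / v)) \<le> b / norm (g (0, w, v))" if "norm v < \<delta>" "v \<noteq> 0" for v
      using size[rule_format, of 0 w v] w(1) that \<delta> by simp
  qed (use w \<delta> in simp_all)
  have dz': "norm (g (0, w, v)) \<le> b / \<delta> / \<delta> * norm v ^ 2"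
    if w: "w \<in> ball w0 \<delta>" and v: "norm v < \<delta>" for w v
  proof -
    have "isCont g (0, w, v)"
      using contg oN w v \<delta> by (simp add: continuous_on_eq_continuous_at)
    moreover have "((\<lambda>s. (0, (fst w + s, snd w), v)) \<longlongrightarrow> (0, (fst w + 0, snd w), v)) (at (0::complex))"
      by (intro tendsto_intros)
    ultimately have "((\<lambda>s. g (0, (fst w + s, snd w), v)) \<longlongrightarrow> g (0, w, v)) (at 0)"
      using isCont_tendsto_compose[of "(0, w, v)" g] by simp
    then have "((\<lambda>s. norm (g (0, (fst w + s, snd w), v))) \<longlongrightarrow> norm (g (0, w, v))) (at 0)"
      by (rule tendsto_norm)
    moreover have "\<forall>\<^sub>F s in at 0. norm (g (0, (fst w + s, snd w), v)) \<le> b / \<delta> / \<delta> * norm v ^ 2"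
      using nearby[OF w] by (rule eventually_mono) (rule dz, simp_all add: v)
    ultimately show ?thesis by (rule tendsto_upperbound) simp
  qed
  define \<eta> where "\<eta> = min (\<delta> / 2) (\<delta> * \<delta> / (8 * b))"
  have \<eta>: "\<eta> > 0" "\<eta> < \<delta>" "b / \<delta> / \<delta> * \<eta> \<le> 1 / 8"
  proof -
    show "\<eta> > 0" "\<eta> < \<delta>" using \<delta> b by (auto simp: \<eta>_def min_def)
    have "b / \<delta> / \<delta> * \<eta> \<le> b / \<delta> / \<delta> * (\<delta> * \<delta> / (8 * b))"
      using \<delta> b by (intro mult_left_mono) (simp_all add: \<eta>_def)
    then show "b / \<delta> / \<delta> * \<eta> \<le> 1 / 8" using \<delta> b by simp
  qed
  define K where "K = cball (0::complex) (\<delta> / 2) \<times> cball w0 (\<delta> / 2) \<times> cball (0::complex) \<eta>"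
  have "K \<subseteq> ball 0 \<delta> \<times> ball w0 \<delta> \<times> ball 0 \<delta>" using \<delta> \<eta> by (auto simp: K_def)
  moreover have "compact K" unfolding K_def by (intro compact_Times compact_cball)
  ultimately have "uniformly_continuous_on K g"
    by (intro compact_uniformly_continuous continuous_on_subset[OF contg])
  then obtain d where d: "d > 0" "\<And>p p'. p \<in> K \<Longrightarrow> p' \<in> K \<Longrightarrow> dist p' p < d \<Longrightarrow> dist (g p') (g p) < \<eta> / 8"
    unfolding uniformly_continuous_on_def using \<eta>(1) by (metis zero_less_divide_iff zero_less_numeral)
  have small: "norm (g (\<epsilon>, w, v)) \<le> \<eta> / 4"
    if "norm \<epsilon> < min d (\<delta> / 2)" "w \<in> ball w0 (\<delta> / 2)" "norm v < \<eta>" for \<epsilon> w v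
  proof -
    have "dist (\<epsilon>, w, v) (0, w, v) < d" using that by (simp add: dist_Pair_Pair)
    then have "dist (g (\<epsilon>, w, v)) (g (0, w, v)) < \<eta> / 8"
      using that \<delta> by (intro d(2)) (auto simp: K_def)
    then have 1: "norm (g (\<epsilon>, w, v)) < norm (g (0, w, v)) + \<eta> / 8"
      using norm_triangle_ineq2[of "g (\<epsilon>, w, v)" "g (0, w, v)"] unfolding dist_norm by linarith
    have "norm (g (0, w, v)) \<le> b / \<delta> / \<delta> * norm v ^ 2"
      using that \<eta> by (intro dz') auto
    also have "\<dots> \<le> b / \<delta> / \<delta> * \<eta> ^ 2"
      using that b \<delta> by (intro mult_left_mono power_mono) auto
    also have "\<dots> = (b / \<delta> / \<delta> * \<eta>) * \<eta>" by (simp add: power2_eq_square)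
    also have "\<dots> \<le> 1 / 8 * \<eta>" using \<eta> by (intro mult_right_mono) auto
    finally show ?thesis using 1 by simp
  qed
  \<comment> \<open>a point of the line through \<open>w0\<close> that is moved to a point other than the image of the origin\<close>
  obtain t0 where t0: "F 0 (t0 * fst w0, t0 * snd w0) \<noteq> (0, 0)"
    using gate_form_nonzero[OF gf hol0 w0] by blast
  define \<Delta> where "\<Delta> p = F (fst p) (t0 * fst (snd p), t0 * snd (snd p)) - F (fst p) (0, 0)"
    for p :: "complex \<times> complex \<times> complex"
  have contF: "continuous_on (D \<times> UNIV) (\<lambda>p. F (fst p) (snd p))"
    using holo_on_imp_continuous_on[OF hol] by (simp add: case_prod_unfold)
  have "continuous_on (D \<times> UNIV) (\<lambda>p. F (fst p) (t0 * fst (snd p), t0 * snd (snd p)))"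
    using continuous_on_compose2[OF contF, of "D \<times> UNIV" "\<lambda>p. (fst p, (t0 * fst (snd p), t0 * snd (snd p)))"]
    by (simp add: continuous_intros image_subset_iff mem_Times_iff)
  moreover have "continuous_on (D \<times> (UNIV :: (complex \<times> complex) set)) (\<lambda>p. F (fst p) (0, 0))"
    using continuous_on_compose2[OF contF, of "D \<times> UNIV" "\<lambda>p. (fst p, (0, 0))"]
    by (simp add: continuous_intros image_subset_iff mem_Times_iff)
  ultimately have "continuous_on (D \<times> UNIV) \<Delta>"
    unfolding \<Delta>_def by (rule continuous_on_diff)
  then have "isCont \<Delta> (0, w0)"
    using D continuous_on_eq_continuous_at[OF open_Times[OF D(1) open_UNIV], THEN iffD1, THEN bspec, of \<Delta> "(0, w0)"]
    by blast
  moreover have "\<Delta> (0, w0) \<noteq> 0"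
    using t0 gate_form_0[OF gf] by (simp add: \<Delta>_def)
  ultimately obtain e where e: "e > 0" "\<And>p. dist (0, w0) p < e \<Longrightarrow> \<Delta> p \<noteq> 0"
    using continuous_at_avoid[of "(0, w0)" \<Delta> 0] by blast
  have g0: "g (\<epsilon>, w, 0) = 0"
    if \<epsilon>: "norm \<epsilon> < min \<delta> (e / 2)" and w: "w \<in> ball w0 (min \<delta> (e / 2))" for \<epsilon> w
  proof (rule ccontr)
    assume "g (\<epsilon>, w, 0) \<noteq> 0"
    then obtain \<eta>' c where c: "0 < \<eta>'" "\<eta>' \<le> \<delta>" "c > 0" "\<And>v. norm v < \<eta>' \<Longrightarrow> norm (g (\<epsilon>, w, v)) \<ge> c"
      using nonzero_bounded_below[OF holomorphic_on_imp_continuous_on[OF holgv[of \<epsilon> w]] \<delta>] \<epsilon> w by auto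
    have \<epsilon>D: "\<epsilon> \<in> D" using \<epsilon> \<delta>D by auto
    have "F \<epsilon> (t0 * fst w, t0 * snd w) = F \<epsilon> (0, 0)"
    proof (rule constant_on_line[OF holF[OF \<epsilon>D], of "max 1 (2 / \<eta>')" _ _ "b / c"])
      fix t :: complex assume t: "norm t \<ge> max 1 (2 / \<eta>')"
      then have t1: "t \<noteq> 0" "norm t > 0" by auto
      have inv: "norm (1 / t) < \<eta>'" using t t1 c(1) by (simp add: norm_divide field_simps)
      then have "norm (F \<epsilon> (fst w / (1 / t), snd w / (1 / t))) \<le> b / norm (g (\<epsilon>, w, 1 / t))"
        using size[rule_format, of \<epsilon> w "1 / t"] \<epsilon> w t1 c(2) by simp
      also have "\<dots> \<le> b / c"
        using c(3) c(4)[OF inv] b by (intro divide_left_mono mult_pos_pos) auto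
      finally show "norm (F \<epsilon> (t * fst w, t * snd w)) \<le> b / c"
        by (simp add: mult.commute)
    qed
    then have "\<Delta> (\<epsilon>, w) = 0" by (simp add: \<Delta>_def)
    moreover have "norm (0 - \<epsilon>, w0 - w) \<le> norm (0 - \<epsilon>) + norm (w0 - w)" by (rule norm_Pair_le)
    then have "dist (0, w0) (\<epsilon>, w) < e"
      using \<epsilon> w by (simp add: dist_norm)
    ultimately show False using e(2) by blast
  qed
  define \<delta>' where "\<delta>' = min (min d (\<delta> / 2)) (min (e / 2) \<eta>)"
  show ?thesis
  proof (intro exI[of _ \<delta>'] conjI allI impI)
    show "\<delta>' > 0" using d(1) \<delta> e(1) \<eta>(1) by (simp add: \<delta>'_def)
    fix \<epsilon> v :: complex and w assume *: "norm \<epsilon> < \<delta>' \<and> w \<in> ball w0 \<delta>' \<and> 0 < norm v \<and> norm v < \<delta>'"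
    then have **: "norm \<epsilon> < \<delta>" "w \<in> ball w0 \<delta>" "norm v < \<delta>" "v \<noteq> 0" "norm v < \<eta>"
      "norm \<epsilon> < min d (\<delta> / 2)" "w \<in> ball w0 (\<delta> / 2)" "norm \<epsilon> < min \<delta> (e / 2)" "w \<in> ball w0 (min \<delta> (e / 2))"
      using \<delta> by (simp_all add: \<delta>'_def)
    have "norm (g (\<epsilon>, w, v)) \<le> \<eta> / 4 / \<eta> * norm (v - 0)"
    proof (rule Schwarz_lemma_ball)
      show "(\<lambda>v. g (\<epsilon>, w, v)) holomorphic_on ball 0 \<eta>"
        using holgv[OF **(1,2)] \<eta>(2) by (auto intro: holomorphic_on_subset)
      show "g (\<epsilon>, w, 0) = 0" using g0 ** by simp
      show "norm (g (\<epsilon>, w, z)) \<le> \<eta> / 4" if "z \<in> ball 0 \<eta>" for z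
        using small[OF **(6,7)] that by simp
    qed (use ** in simp)
    then have 1: "norm (g (\<epsilon>, w, v)) \<le> norm v / 4" using \<eta>(1) by simp
    have g: "g (\<epsilon>, w, v) \<noteq> 0" "norm (F \<epsilon> (fst w / v, snd w / v)) \<ge> 1 / norm (g (\<epsilon>, w, v))"
      using size ** by blast+
    have "2 / norm v \<le> 1 / (norm v / 4)" by (simp add: divide_right_mono)
    also have "\<dots> \<le> 1 / norm (g (\<epsilon>, w, v))"
      using 1 g(1) ** by (intro divide_left_mono mult_pos_pos) auto
    finally show "norm (F \<epsilon> (fst w / v, snd w / v)) \<ge> 2 / norm v" using g(2) by simp
  qed
qed

text \<open>The directions form a compact sphere, so finitely many of the local estimates suffice.\<close>

lemma uniform_escape:
  fixes F :: map_family
  assumes gf: "gate_form F \<rho> q C r" and fam: "holo_family_regular D F" and D: "open D" "0 \<in> D"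
  obtains \<delta> R where "\<delta> > 0" "R \<ge> 1" "ball 0 \<delta> \<subseteq> D"
    "\<And>\<epsilon> z. norm \<epsilon> < \<delta> \<Longrightarrow> norm z \<ge> R \<Longrightarrow> norm (F \<epsilon> z) \<ge> 2 * norm z"
proof -
  have hol: "holo_on (\<lambda>(\<epsilon>, z). F \<epsilon> z) (D \<times> UNIV)"
    using fam unfolding holo_family_regular_def by blast
  obtain G where G: "holo_family_cp2 D G" "\<forall>\<epsilon>\<in>D. extends_to_cp2 (F \<epsilon>) (G \<epsilon>)"
    using fam unfolding holo_family_regular_def by blast
  define S where "S = sphere (0 :: complex \<times> complex) 1"
  have "\<exists>\<delta>>0. \<forall>\<epsilon> w v. norm \<epsilon> < \<delta> \<and> w \<in> ball w0 \<delta> \<and> 0 < norm v \<and> norm v < \<delta> \<longrightarrow>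
            norm (F \<epsilon> (fst w / v, snd w / v)) \<ge> 2 / norm v" if "w0 \<in> S" for w0
  proof (rule expanding_near_direction[OF gf G hol D])
    show "w0 \<noteq> 0" using that by (auto simp: S_def)
  qed
  then obtain d where d: "\<And>w0. w0 \<in> S \<Longrightarrow> d w0 > 0"
    "\<And>w0 \<epsilon> w v. w0 \<in> S \<Longrightarrow> norm \<epsilon> < d w0 \<Longrightarrow> w \<in> ball w0 (d w0) \<Longrightarrow> 0 < norm v \<Longrightarrow> norm v < d w0 \<Longrightarrow>
            norm (F \<epsilon> (fst w / v, snd w / v)) \<ge> 2 / norm v"
    by metis
  have "compact S" by (simp add: S_def)
  moreover have "S \<subseteq> (\<Union>w0\<in>S. ball w0 (d w0))" using d(1) by force
  ultimately obtain T where T: "T \<subseteq> S" "finite T" "S \<subseteq> (\<Union>w0\<in>T. ball w0 (d w0))"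
    using compactE_image[of S S "\<lambda>w0. ball w0 (d w0)"] by (metis open_ball)
  obtain e where e: "e > 0" "ball 0 e \<subseteq> D" using D open_contains_ball by blast
  define \<delta> where "\<delta> = Min (insert (min 1 e) (d ` T))"
  have \<delta>0: "\<delta> > 0" using T d(1) e(1) by (auto simp: \<delta>_def)
  have \<delta>le: "\<delta> \<le> 1" "\<delta> \<le> e" "\<And>w0. w0 \<in> T \<Longrightarrow> \<delta> \<le> d w0"
  proof -
    have "\<delta> \<le> min 1 e" unfolding \<delta>_def by (rule Min_le) (use T in auto)
    then show "\<delta> \<le> 1" "\<delta> \<le> e" by auto
    show "\<delta> \<le> d w0" if "w0 \<in> T" for w0
      unfolding \<delta>_def by (rule Min_le) (use T that in auto)
  qed
  show thesis
  proof (rule that[of \<delta> "2 / \<delta>"])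
    show "\<delta> > 0" by (rule \<delta>0)
    show "2 / \<delta> \<ge> 1" using \<delta>0 \<delta>le(1) by (simp add: field_simps)
    show "ball 0 \<delta> \<subseteq> D" using e(2) \<delta>le(2) by auto
    fix \<epsilon> :: complex and z :: "complex \<times> complex" assume \<epsilon>: "norm \<epsilon> < \<delta>" and z: "norm z \<ge> 2 / \<delta>"
    have z0: "norm z > 0" using z \<delta>0 by (meson divide_pos_pos less_le_trans zero_less_numeral)
    define v where "v = complex_of_real (1 / norm z)"
    define w where "w = (fst z * v, snd z * v)"
    have "w = (1 / norm z) *\<^sub>R z"
      by (simp add: w_def v_def prod_eq_iff scaleR_conv_of_real)
    then have "w \<in> S" using z0 by (simp add: S_def)
    then obtain w0 where w0: "w0 \<in> T" "w \<in> ball w0 (d w0)" using T(3) by blast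
    have nv: "norm v = 1 / norm z" using z0 by (simp add: v_def norm_divide)
    have v0: "v \<noteq> 0" using nv z0 by auto
    have "1 / norm z < \<delta>" using z z0 \<delta>0 by (simp add: field_simps)
    then have "norm (F \<epsilon> (fst w / v, snd w / v)) \<ge> 2 / norm v"
      using w0 \<epsilon> \<delta>le(3)[OF w0(1)] T(1) z0 by (intro d(2)[of w0]) (auto simp: nv)
    then show "norm (F \<epsilon> z) \<ge> 2 * norm z" using v0 z0 by (simp add: w_def nv)
  qed
qed

lemma escape_orbit:
  fixes f :: "'a::real_normed_vector \<Rightarrow> 'a"
  assumes esc: "\<And>z. norm z \<ge> R \<Longrightarrow> norm (f z) \<ge> 2 * norm z" and R: "R \<ge> 1"
    and z: "norm z \<ge> R"
  shows "norm ((f ^^ n) z) \<ge> 2 ^ n * norm z"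
proof (induction n)
  case (Suc n)
  have "1 * norm z \<le> 2 ^ n * norm z" by (rule mult_right_mono) auto
  then have "R \<le> norm ((f ^^ n) z)" using Suc z by linarith
  then have "norm ((f ^^ Suc n) z) \<ge> 2 * norm ((f ^^ n) z)" using esc by simp
  then show ?case using Suc by simp
qed simp

lemma filled_Julia_iterate_bound:
  fixes f :: "'a::real_normed_vector \<Rightarrow> 'a"
  assumes esc: "\<And>z. norm z \<ge> R \<Longrightarrow> norm (f z) \<ge> 2 * norm z" and R: "R \<ge> 1"
    and z: "z \<in> filled_Julia f"
  shows "norm ((f ^^ n) z) < R"
proof (rule ccontr)
  assume "\<not> ?thesis"
  then have w: "norm ((f ^^ n) z) \<ge> R" by simp
  obtain b where b: "\<And>k. norm ((f ^^ k) z) \<le> b"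
    using z unfolding filled_Julia_def bounded_iff by auto
  obtain k :: nat where k: "b < 2 ^ k"
    using real_arch_pow[of 2 b] by auto
  have "2 ^ k * 1 \<le> 2 ^ k * norm ((f ^^ n) z)" using w R by (intro mult_left_mono) auto
  also have "\<dots> \<le> norm ((f ^^ k) ((f ^^ n) z))" by (rule escape_orbit[OF esc R w])
  also have "\<dots> \<le> b" using b[of "k + n"] by (simp add: funpow_add)
  finally show False using k by simp
qed

section \<open>The upper limit of the filled Julia sets\<close>

lemma alpha_sequence_tendsto_0:
  assumes "alpha_sequence \<alpha> eps n" shows "eps \<longlonglongrightarrow> 0"
proof -
  have ne: "eps \<nu> \<noteq> 0" for \<nu> using assms by (simp add: alpha_sequence_def)
  have n: "filterlim n at_top sequentially" and
    a: "(\<lambda>\<nu>. of_nat (n \<nu>) - of_real pi / eps \<nu>) \<longlonglongrightarrow> \<alpha>"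
    using assms by (simp_all add: alpha_sequence_def)
  have "filterlim (\<lambda>\<nu>. of_nat (n \<nu>) :: complex) at_infinity sequentially"
    by (rule filterlim_compose[OF tendsto_of_nat n])
  from tendsto_add_filterlim_at_infinity[OF tendsto_minus[OF a] this]
  have "filterlim (\<lambda>\<nu>. of_real pi / eps \<nu>) at_infinity sequentially" by simp
  from tendsto_divide_0[OF tendsto_const[of "of_real pi"] this]
  show ?thesis using ne by simp
qed

text \<open>
  A point whose Lavaurs orbit reaches the complement of \<open>K(F\<^sub>0)\<close> escapes, together with a
  neighbourhood, under all nearby maps of the sequence: the iterates follow the Lavaurs orbit, and
  then the orbit under \<open>F\<^sub>0\<close> out of the escape radius.
\<close>

lemma limsup_filled_Julia_subset:
  fixes F :: map_family
  assumes hol: "holo_on (\<lambda>(\<epsilon>, z). F \<epsilon> z) (D \<times> UNIV)" and D: "open D" "0 \<in> D"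
    and \<delta>: "\<delta> > 0" and R: "R \<ge> 1"
    and esc: "\<And>\<epsilon> z. norm \<epsilon> < \<delta> \<Longrightarrow> norm z \<ge> R \<Longrightarrow> norm (F \<epsilon> z) \<ge> 2 * norm z"
    and lav: "lavaurs_map F S \<alpha> eps n U T"
  shows "set_limsup (\<lambda>\<nu>. filled_Julia (F (eps \<nu>))) \<subseteq> filled_Lavaurs_Julia (F 0) U T"
proof
  fix p assume p: "p \<in> set_limsup (\<lambda>\<nu>. filled_Julia (F (eps \<nu>)))"
  have U: "open U" and \<alpha>: "alpha_sequence \<alpha> eps n"
    and lim: "locally_uniform_limit U (\<lambda>\<nu>. F (eps \<nu>) ^^ n \<nu>) T"
    using lav unfolding lavaurs_map_def by blast+
  note eps = alpha_sequence_tendsto_0[OF \<alpha>]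
  have contn: "continuous_on (D \<times> UNIV) (\<lambda>p. (F (fst p) ^^ k) (snd p))" for k
    using continuous_on_iterate[OF hol, of k] by (simp add: case_prod_unfold)
  have cont: "continuous_on S (F \<epsilon> ^^ k)" if "\<epsilon> \<in> D" for \<epsilon> k S
    using continuous_on_compose2[OF contn[of k], of S "\<lambda>z. (\<epsilon>, z)"] that
    by (simp add: continuous_intros image_subset_iff)
  have epsD: "\<forall>\<^sub>F \<nu> in sequentially. eps \<nu> \<in> D"
    using topological_tendstoD[OF eps D] .
  show "p \<in> filled_Lavaurs_Julia (F 0) U T"
  proof (rule ccontr)
    assume "\<not> ?thesis"
    then obtain m where m: "\<And>j. j < m \<Longrightarrow> (T ^^ j) p \<in> U" "(T ^^ m) p \<notin> filled_Julia (F 0)"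
      unfolding filled_Lavaurs_Julia_def by blast
    have follow: "\<exists>W. open W \<and> p \<in> W \<and> (\<forall>\<^sub>F \<nu> in sequentially. \<forall>z\<in>W. (F (eps \<nu>) ^^ (j * n \<nu>)) z \<in> V)"
      if "j \<le> m" "open V" "(T ^^ j) p \<in> V" for j V
      using that
    proof (induction j arbitrary: V)
      case 0
      then show ?case by (intro exI[of _ V]) simp
    next
      case (Suc j)
      define b where "b = (T ^^ j) p"
      have b: "b \<in> U" using m(1)[of j] Suc.prems(1) by (simp add: b_def)
      obtain e where e: "e > 0" "ball (T b) e \<subseteq> V"
        using openE[OF Suc.prems(2), of "T b"] Suc.prems(3) by (auto simp: b_def)
      obtain V0 where V0: "open V0" "b \<in> V0" "uniform_limit (V0 \<inter> U) (\<lambda>\<nu>. F (eps \<nu>) ^^ n \<nu>) T sequentially"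
        using lim b unfolding locally_uniform_limit_def by blast
      have "continuous_on (V0 \<inter> U) T"
        by (rule uniform_limit_theorem[OF _ V0(3)]) (use epsD cont in \<open>auto elim: eventually_mono\<close>)
      then have "open (V0 \<inter> U \<inter> T -` ball (T b) (e / 2))"
        using V0(1) U by (intro continuous_open_preimage open_Int) auto
      moreover have "b \<in> V0 \<inter> U \<inter> T -` ball (T b) (e / 2)" using V0(2) b e(1) by simp
      ultimately obtain W where W: "open W" "p \<in> W" and
        ev: "\<forall>\<^sub>F \<nu> in sequentially. \<forall>z\<in>W. (F (eps \<nu>) ^^ (j * n \<nu>)) z \<in> V0 \<inter> U \<inter> T -` ball (T b) (e / 2)"
        using Suc.IH[of "V0 \<inter> U \<inter> T -` ball (T b) (e / 2)"] Suc_leD[OF Suc.prems(1)]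
        unfolding b_def by blast
      have "\<forall>\<^sub>F \<nu> in sequentially. \<forall>x\<in>V0 \<inter> U. dist ((F (eps \<nu>) ^^ n \<nu>) x) (T x) < e / 2"
        using V0(3) half_gt_zero[OF e(1)] unfolding uniform_limit_iff by blast
      with ev have "\<forall>\<^sub>F \<nu> in sequentially. \<forall>z\<in>W. (F (eps \<nu>) ^^ (Suc j * n \<nu>)) z \<in> V"
      proof eventually_elim
        case (elim \<nu>)
        show ?case
        proof
          fix z assume "z \<in> W"
          define x where "x = (F (eps \<nu>) ^^ (j * n \<nu>)) z"
          have x: "x \<in> V0 \<inter> U" "dist (T b) (T x) < e / 2"
            using elim(1) \<open>z \<in> W\<close> by (auto simp: x_def)
          have "dist (T b) ((F (eps \<nu>) ^^ n \<nu>) x) < e"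
            using bspec[OF elim(2) x(1)] x(2) dist_triangle[of "T b" "(F (eps \<nu>) ^^ n \<nu>) x" "T x"]
            by (simp only: dist_commute)
          then have "(F (eps \<nu>) ^^ n \<nu>) x \<in> V" using e(2) by auto
          then show "(F (eps \<nu>) ^^ (Suc j * n \<nu>)) z \<in> V" by (simp add: x_def funpow_add)
        qed
      qed
      then show ?case using W by blast
    qed
    define w where "w = (T ^^ m) p"
    obtain N where N: "norm ((F 0 ^^ N) w) > R"
      using m(2) unfolding filled_Julia_def bounded_iff w_def[symmetric] by (auto simp: not_le)
    have "open ((D \<times> UNIV) \<inter> (\<lambda>p. (F (fst p) ^^ N) (snd p)) -` (- cball 0 R))"
      using D(1) by (intro continuous_open_preimage[OF contn]) (auto intro: open_Times)
    moreover have "(0, w) \<in> (D \<times> UNIV) \<inter> (\<lambda>p. (F (fst p) ^^ N) (snd p)) -` (- cball 0 R)"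
      using D(2) N by simp
    ultimately obtain P V where PV: "open P" "open V" "(0, w) \<in> P \<times> V"
      "P \<times> V \<subseteq> (D \<times> UNIV) \<inter> (\<lambda>p. (F (fst p) ^^ N) (snd p)) -` (- cball 0 R)"
      by (rule open_prod_elim)
    have far: "norm ((F \<epsilon> ^^ N) z) > R" if "\<epsilon> \<in> P" "z \<in> V" for \<epsilon> z
      using PV(4) that by (auto simp: not_le)
    obtain W where W: "open W" "p \<in> W" and
      ev: "\<forall>\<^sub>F \<nu> in sequentially. \<forall>z\<in>W. (F (eps \<nu>) ^^ (m * n \<nu>)) z \<in> V"
      using follow[of m V] PV(2,3) by (auto simp: w_def)
    have "\<forall>\<^sub>F \<nu> in sequentially. eps \<nu> \<in> P"
      using topological_tendstoD[OF eps PV(1)] PV(3) by simp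
    moreover have "\<forall>\<^sub>F \<nu> in sequentially. eps \<nu> \<in> ball 0 \<delta>"
      using topological_tendstoD[OF eps open_ball, of 0 \<delta>] \<delta> by simp
    ultimately have "\<forall>\<^sub>F \<nu> in sequentially. filled_Julia (F (eps \<nu>)) \<inter> W = {}"
      using ev
    proof eventually_elim
      case (elim \<nu>)
      have "z \<notin> filled_Julia (F (eps \<nu>))" if "z \<in> W" for z
      proof
        assume "z \<in> filled_Julia (F (eps \<nu>))"
        then have "norm ((F (eps \<nu>) ^^ (N + m * n \<nu>)) z) < R"
          using elim(2) by (intro filled_Julia_iterate_bound[OF esc R]) auto
        moreover have "norm ((F (eps \<nu>) ^^ (N + m * n \<nu>)) z) > R"
          using far elim(1,3) that by (simp add: funpow_add)
        ultimately show False by simp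
      qed
      then show ?case by blast
    qed
    then have "finite {\<nu>. filled_Julia (F (eps \<nu>)) \<inter> W \<noteq> {}}"
      by (simp add: eventually_cofinite flip: cofinite_eq_sequentially)
    then show False using p W unfolding set_limsup_def by blast
  qed
qed

section \<open>One step in the coordinate of the gate\<close>

lemma Arctan_approx:
  assumes "norm \<tau> \<le> 1/2"
  shows "norm (Arctan \<tau> - \<tau>) \<le> 2 * norm \<tau> ^ 3"
proof -
  define S where "S = cball (0::complex) (norm \<tau>)"
  have der: "((\<lambda>z. Arctan z - z) has_field_derivative (inverse (1 + z^2) - 1)) (at z within S)"
    and bd: "norm (inverse (1 + z^2) - 1) \<le> 2 * norm \<tau> ^ 2" if z: "z \<in> S" for z
  proof -
    have nz: "norm z \<le> norm \<tau>" "norm z \<le> 1/2" using z assms by (simp_all add: S_def)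
    have "\<bar>Im z\<bar> < 1" using abs_Im_le_cmod[of z] nz by linarith
    then have "((\<lambda>z. Arctan z - z) has_field_derivative (inverse (1 + z^2) - 1)) (at z)"
      by (intro DERIV_diff has_field_derivative_Arctan DERIV_ident)
    then show "((\<lambda>z. Arctan z - z) has_field_derivative (inverse (1 + z^2) - 1)) (at z within S)"
      by (rule has_field_derivative_at_within)
    have z2: "norm z ^ 2 \<le> (1/2)^2" by (rule power_mono[OF nz(2)]) simp
    have low: "norm (1 + z^2) \<ge> 1/2"
      using norm_triangle_ineq4[of "1 + z^2" "z^2"] z2 by (simp add: norm_power power2_eq_square norm_mult)
    then have ne: "1 + z^2 \<noteq> 0" by auto
    have "norm (inverse (1 + z^2) - 1) = norm z ^ 2 / norm (1 + z^2)"
    proof -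
      have "inverse (1 + z^2) - 1 = - (z^2 / (1 + z^2))" using ne by (simp add: field_simps)
      then show ?thesis by (simp add: norm_divide norm_power)
    qed
    also have "\<dots> \<le> norm z ^ 2 / (1/2)" using low by (intro divide_left_mono) (auto simp: ne)
    also have "\<dots> \<le> 2 * norm \<tau> ^ 2" using power_mono[OF nz(1), of 2] by simp
    finally show "norm (inverse (1 + z^2) - 1) \<le> 2 * norm \<tau> ^ 2" .
  qed
  have "norm ((Arctan \<tau> - \<tau>) - (Arctan 0 - 0)) \<le> 2 * norm \<tau> ^ 2 * norm (\<tau> - 0)"
    by (rule field_differentiable_bound[where S = S, OF _ der bd]) (auto simp: S_def)
  then show ?thesis by (simp add: power3_eq_cube power2_eq_square)
qed

lemma sin_Arctan_eq:
  fixes \<tau> :: complex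
  assumes "norm \<tau> \<le> 1/2"
  shows "sin (Arctan \<tau>) = \<tau> * cos (Arctan \<tau>)"
proof -
  have "norm (\<tau>^2) \<le> (1/2)^2" unfolding norm_power by (rule power_mono[OF assms]) simp
  then have "\<tau>^2 \<noteq> -1" by (auto simp: power2_eq_square)
  then have tan: "tan (Arctan \<tau>) = \<tau>" by simp
  have "cos (Arctan \<tau>) \<noteq> 0"
  proof
    assume c: "cos (Arctan \<tau>) = 0"
    then have "\<tau> = 0" using tan by (simp add: tan_def)
    then show False using c by simp
  qed
  then show ?thesis using tan by (simp add: tan_def field_simps)
qed

lemma cos_approx:
  fixes b :: complex
  assumes "norm b \<le> 1"
  shows "norm (cos b - 1) \<le> 3 * norm b ^ 2"
proof -
  define S where "S = cball (0::complex) (norm b)"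
  have e: "exp 1 \<le> (3::real)" using exp_le by simp
  have sin_le: "norm (sin z) \<le> 3 * norm z" if "norm z \<le> 1" for z :: complex
  proof -
    have "norm (sin z - sin 0) \<le> 3 * norm (z - 0)"
    proof (rule field_differentiable_bound[where S = "cball 0 1" and f' = cos])
      fix w :: complex assume "w \<in> cball 0 1"
      then have "norm (cos w) \<le> exp 1" using norm_cos_le[of w] by (smt (verit) exp_le_cancel_iff mem_cball_0)
      then show "norm (cos w) \<le> 3" using e by simp
    qed (use that in \<open>auto intro: derivative_eq_intros\<close>)
    then show ?thesis by simp
  qed
  have "norm (cos b - cos 0) \<le> (3 * norm b) * norm (b - 0)"
  proof (rule field_differentiable_bound[where S = S and f' = "\<lambda>z. - sin z"])
    fix w :: complex assume "w \<in> S"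
    then show "norm (- sin w) \<le> 3 * norm b" using sin_le[of w] assms by (simp add: S_def)
  qed (auto simp: S_def intro!: derivative_eq_intros)
  then show ?thesis by (simp add: power2_eq_square)
qed

text \<open>
  The coordinate \<open>e\<close> of a point \<open>x\<close> is given by \<open>x = - \<epsilon> cot (\<epsilon> e)\<close>. In it the map
  \<open>x \<mapsto> x + (x\<^sup>2 + \<epsilon>\<^sup>2)\<close> is nearly the translation by one, since by the addition theorem of the
  tangent the translation amount is exactly \<open>Arctan (\<epsilon> s / (1 + x s)) / \<epsilon>\<close>, an expression that is
  regular at the fixed points \<open>\<plusminus> \<i> \<epsilon>\<close>. The second estimate records how the factor \<open>sin (\<epsilon> e)\<close>
  changes: its logarithm decreases by \<open>x\<close>, up to an error of second order.
\<close>

lemma cot_coordinate_step: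
  fixes q :: complex
  assumes C: "C > 0"
  obtains K r1 where "K > 0" "r1 > 0"
    "\<And>\<epsilon> x s e Z. \<epsilon> \<noteq> 0 \<Longrightarrow> Z < r1 \<Longrightarrow> norm x ^ 2 + norm \<epsilon> ^ 2 \<le> Z \<Longrightarrow>
       norm (s - 1 - (q + 1) * x) \<le> C * Z \<Longrightarrow> x * sin (\<epsilon> * e) = - \<epsilon> * cos (\<epsilon> * e) \<Longrightarrow>
       \<exists>e' \<kappa>. (x + (x^2 + \<epsilon>^2) * s) * sin (\<epsilon> * e') = - \<epsilon> * cos (\<epsilon> * e') \<and>
         norm (e' - e - 1 - q * x) \<le> K * Z \<and>
         sin (\<epsilon> * e') = sin (\<epsilon> * e) * (1 - x + \<kappa>) \<and> norm \<kappa> \<le> K * Z"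
proof -
  define Q where "Q = norm (q + 1)"
  define K0 where "K0 = 2 * (2 * C + Q + 2 * norm q)"
  define K where "K = K0 + 128 + 2 * (192 + Q + C + 2)"
  \<comment> \<open>\<open>r1\<close> keeps \<open>\<bar>x\<bar>\<close> and \<open>\<bar>\<epsilon>\<bar>\<close> below \<open>1/10\<close> and \<open>\<bar>s - 1\<bar>\<close> below \<open>1/2\<close>\<close>
  define r1 where "r1 = min (1/100) (min (1 / (4 * C)) ((1 / (4 * (Q + 1)))^2))"
  have Q: "Q \<ge> 0" by (simp add: Q_def)
  have K0: "K0 \<ge> 0" using C Q by (simp add: K0_def)
  have K: "K > 0" using C Q K0 by (simp add: K_def add_nonneg_pos)
  have r1: "r1 > 0" using C Q by (simp add: r1_def add_nonneg_pos)
  show thesis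
  proof (rule that[OF K r1])
    fix \<epsilon> x s e :: complex and Z
    assume \<epsilon>: "\<epsilon> \<noteq> 0" and Zr: "Z < r1" and Z: "norm x ^ 2 + norm \<epsilon> ^ 2 \<le> Z"
      and s: "norm (s - 1 - (q + 1) * x) \<le> C * Z" and e: "x * sin (\<epsilon> * e) = - \<epsilon> * cos (\<epsilon> * e)"
    have Z': "norm x ^ 2 \<le> Z" "norm \<epsilon> ^ 2 \<le> Z" "Z \<ge> 0"
      using Z zero_le_power2[of "norm x"] zero_le_power2[of "norm \<epsilon>"] by linarith+
    have "norm x ^ 2 < (1 / (4 * (Q + 1)))^2" "norm x ^ 2 < (1/10)^2" "norm \<epsilon> ^ 2 < (1/10)^2"
      using Z' Zr by (auto simp: r1_def power2_eq_square)
    then have x: "norm x < 1 / (4 * (Q + 1))" "norm x < 1/10" and \<epsilon>s: "norm \<epsilon> < 1/10"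
      using Q power_less_imp_less_base[of "norm x" 2 "1 / (4 * (Q + 1))"]
        power_less_imp_less_base[of "norm x" 2 "1/10"] power_less_imp_less_base[of "norm \<epsilon>" 2 "1/10"]
      by simp_all
    have CZ: "C * Z \<le> 1/4"
    proof -
      have "Z \<le> 1 / (4 * C)" using Zr by (simp add: r1_def)
      then show ?thesis using C by (simp add: field_simps)
    qed
    have Qx: "Q * norm x \<le> 1/4"
    proof -
      have "(Q + 1) * norm x \<le> 1/4" using x(1) Q by (simp add: field_simps)
      moreover have "Q * norm x \<le> (Q + 1) * norm x" by (rule mult_right_mono) auto
      ultimately show ?thesis by linarith
    qed
    define \<sigma> where "\<sigma> = s - 1 - (q + 1) * x"
    have \<sigma>: "norm \<sigma> \<le> C * Z" using s by (simp add: \<sigma>_def)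
    have s1: "norm (s - 1) \<le> Q * norm x + C * Z"
      using norm_triangle_ineq[of "(q + 1) * x" \<sigma>] \<sigma> by (simp add: \<sigma>_def Q_def norm_mult)
    then have s1': "norm (s - 1) \<le> 1/2" using CZ Qx by linarith
    then have s2: "norm s \<le> 2" using norm_triangle_ineq[of "s - 1" 1] by simp
    define d where "d = 1 + x * s"
    have "norm (x * s) \<le> 1/10 * 2" unfolding norm_mult by (intro mult_mono) (use x s2 in auto)
    then have dlow: "norm d \<ge> 1/2"
      using norm_triangle_ineq4[of d "x * s"] by (simp add: d_def)
    then have d0: "d \<noteq> 0" by auto
    have xs1: "norm (x * (s - 1)) \<le> (Q + C) * Z"
    proof -
      have "norm (x * (s - 1)) \<le> norm x * (Q * norm x + C * Z)"
        unfolding norm_mult by (intro mult_left_mono s1) simp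
      also have "\<dots> = Q * norm x ^ 2 + norm x * (C * Z)" by (simp add: algebra_simps power2_eq_square)
      also have "\<dots> \<le> Q * Z + 1 * (C * Z)"
        using x C Z' Q by (intro add_mono mult_left_mono mult_right_mono) auto
      finally show ?thesis by (simp add: algebra_simps)
    qed
    have x2s: "norm (x^2 * s) \<le> 2 * Z"
    proof -
      have "norm (x^2 * s) \<le> Z * 2"
        unfolding norm_mult norm_power using Z' s2 by (intro mult_mono) auto
      then show ?thesis by simp
    qed
    \<comment> \<open>the tangent of \<open>\<epsilon> (e' - e)\<close>\<close>
    define \<tau> where "\<tau> = \<epsilon> * s / d"
    have \<tau>4: "norm \<tau> \<le> 4 * norm \<epsilon>"
    proof -
      have "norm \<tau> \<le> norm \<epsilon> * 2 / (1/2)"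
        unfolding \<tau>_def norm_divide norm_mult using s2 dlow
        by (intro frac_le mult_left_mono) auto
      then show ?thesis by simp
    qed
    then have \<tau>h: "norm \<tau> \<le> 1/2" using \<epsilon>s by simp
    define b where "b = Arctan \<tau>"
    have b1: "norm (b - \<tau>) \<le> 2 * norm \<tau> ^ 3" using Arctan_approx[OF \<tau>h] by (simp add: b_def)
    have sinb: "sin b = \<tau> * cos b" unfolding b_def by (rule sin_Arctan_eq[OF \<tau>h])
    have \<tau>3: "norm \<tau> ^ 3 \<le> 64 * norm \<epsilon> * Z"
    proof -
      have "norm \<tau> ^ 3 \<le> (4 * norm \<epsilon>) ^ 3" by (rule power_mono[OF \<tau>4]) simp
      also have "\<dots> = 64 * norm \<epsilon> * norm \<epsilon> ^ 2" by (simp add: power2_eq_square power3_eq_cube)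
      also have "\<dots> \<le> 64 * norm \<epsilon> * Z" using Z' by (intro mult_left_mono) auto
      finally show ?thesis .
    qed
    have b8: "norm b \<le> 8 * norm \<epsilon>"
    proof -
      have "norm \<tau> * norm \<tau> ^ 2 \<le> norm \<tau> * (1/2)^2"
        using power_mono[OF \<tau>h, of 2] by (intro mult_left_mono) auto
      then have "norm \<tau> ^ 3 \<le> norm \<tau> * (1/4)"
        by (simp add: power3_eq_cube power2_eq_square)
      then have "norm (b - \<tau>) \<le> norm \<tau>"
        using b1 norm_ge_zero[of \<tau>] by linarith
      then show ?thesis using norm_triangle_ineq[of "b - \<tau>" \<tau>] \<tau>4 by simp
    qed
    have cosb1: "norm (cos b - 1) \<le> 192 * Z"
    proof -
      have "norm (cos b - 1) \<le> 3 * norm b ^ 2" using b8 \<epsilon>s by (intro cos_approx) simp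
      also have "\<dots> \<le> 3 * (8 * norm \<epsilon>) ^ 2" by (intro mult_left_mono power_mono b8) auto
      also have "\<dots> = 192 * norm \<epsilon> ^ 2" by (simp add: power2_eq_square)
      also have "\<dots> \<le> 192 * Z" using Z' by simp
      finally show ?thesis .
    qed
    define e' where "e' = e + b / \<epsilon>"
    have \<epsilon>e': "\<epsilon> * e' = \<epsilon> * e + b" using \<epsilon> by (simp add: e'_def field_simps)
    have cose: "cos (\<epsilon> * e) = - (x / \<epsilon>) * sin (\<epsilon> * e)"
      using e \<epsilon> by (simp add: field_simps)
    have x\<tau>: "1 - x * \<tau> / \<epsilon> = 1 / d" "x + \<epsilon> * \<tau> = (x + (x^2 + \<epsilon>^2) * s) / d"
    proof -
      have "x * \<tau> / \<epsilon> = x * s / d" using \<epsilon> by (simp add: \<tau>_def)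
      moreover have "1 - x * s / d = (d - x * s) / d" using d0 by (simp add: diff_divide_distrib)
      ultimately show "1 - x * \<tau> / \<epsilon> = 1 / d" by (simp add: d_def)
      have "x + \<epsilon> * \<tau> = (x * d + \<epsilon>^2 * s) / d"
        using d0 by (simp add: \<tau>_def add_divide_distrib power2_eq_square)
      then show "x + \<epsilon> * \<tau> = (x + (x^2 + \<epsilon>^2) * s) / d"
        by (simp add: d_def algebra_simps power2_eq_square)
    qed
    have sine': "sin (\<epsilon> * e') = sin (\<epsilon> * e) * (cos b / d)"
    proof -
      have "sin (\<epsilon> * e') = sin (\<epsilon> * e) * cos b * (1 - x * \<tau> / \<epsilon>)"
        using \<epsilon> unfolding \<epsilon>e' sin_add cose sinb by (simp add: field_simps)
      then show ?thesis by (simp add: x\<tau>)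
    qed
    have cose': "\<epsilon> * cos (\<epsilon> * e') = - (sin (\<epsilon> * e) * cos b * (x + \<epsilon> * \<tau>))"
      using \<epsilon> unfolding \<epsilon>e' cos_add cose sinb by (simp add: field_simps)
    define \<kappa> where "\<kappa> = cos b / d - 1 + x"
    have 1: "(x + (x^2 + \<epsilon>^2) * s) * sin (\<epsilon> * e') = - \<epsilon> * cos (\<epsilon> * e')"
      using cose' by (simp add: sine' x\<tau>)
    have 2: "norm (e' - e - 1 - q * x) \<le> K * Z"
    proof -
      have "norm (b / \<epsilon> - \<tau> / \<epsilon>) \<le> 128 * Z"
      proof -
        have "norm (b - \<tau>) \<le> norm \<epsilon> * (128 * Z)" using b1 \<tau>3 by simp
        then show ?thesis using \<epsilon>
          by (simp add: norm_divide divide_le_eq mult.commute flip: diff_divide_distrib)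
      qed
      moreover have "norm (\<tau> / \<epsilon> - 1 - q * x) \<le> K0 * Z"
      proof -
        have "\<tau> / \<epsilon> - 1 - q * x = (\<sigma> - x * (s - 1) - q * (x^2 * s)) / d"
        proof -
          have "\<tau> / \<epsilon> = s / d" using \<epsilon> by (simp add: \<tau>_def)
          moreover have "s / d - 1 - q * x = (s - (1 + q * x) * d) / d"
            using d0 by (simp add: diff_divide_distrib)
          moreover have "s - (1 + q * x) * d = \<sigma> - x * (s - 1) - q * (x^2 * s)"
            by (simp add: d_def \<sigma>_def algebra_simps power2_eq_square)
          ultimately show ?thesis by simp
        qed
        also have "norm \<dots> \<le> (C * Z + (Q + C) * Z + norm q * (2 * Z)) / (1/2)"
          unfolding norm_divide
        proof (rule frac_le)
          have "norm (\<sigma> - x * (s - 1) - q * (x^2 * s)) \<le> norm \<sigma> + norm (x * (s - 1)) + norm (q * (x^2 * s))"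
            by (rule order_trans[OF norm_triangle_ineq4 add_right_mono[OF norm_triangle_ineq4]])
          also have "\<dots> \<le> C * Z + (Q + C) * Z + norm q * (2 * Z)"
            using \<sigma> xs1 mult_left_mono[OF x2s norm_ge_zero[of q]] norm_mult[of q "x^2 * s"] by linarith
          finally show "norm (\<sigma> - x * (s - 1) - q * (x^2 * s)) \<le> C * Z + (Q + C) * Z + norm q * (2 * Z)" .
        qed (use dlow C Q Z' in auto)
        also have "\<dots> = K0 * Z" by (simp add: K0_def algebra_simps)
        finally show ?thesis .
      qed
      ultimately have "norm ((b / \<epsilon> - \<tau> / \<epsilon>) + (\<tau> / \<epsilon> - 1 - q * x)) \<le> 128 * Z + K0 * Z"
        by (rule norm_triangle_mono)
      also have "\<dots> \<le> K * Z"
        using C Q Z'(3) unfolding K_def distrib_right[symmetric] by (intro mult_right_mono) auto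
      finally show ?thesis by (simp add: e'_def algebra_simps)
    qed
    have 3: "sin (\<epsilon> * e') = sin (\<epsilon> * e) * (1 - x + \<kappa>)"
      by (simp add: sine' \<kappa>_def)
    have 4: "norm \<kappa> \<le> K * Z"
    proof -
      have "\<kappa> = ((cos b - 1) - x * (s - 1) + x^2 * s) / d"
      proof -
        have "\<kappa> = (cos b - (1 - x) * d) / d"
          using d0 by (simp add: \<kappa>_def diff_divide_distrib)
        moreover have "cos b - (1 - x) * d = (cos b - 1) - x * (s - 1) + x^2 * s"
          by (simp add: d_def algebra_simps power2_eq_square)
        ultimately show ?thesis by simp
      qed
      also have "norm \<dots> \<le> (192 * Z + (Q + C) * Z + 2 * Z) / (1/2)"
        unfolding norm_divide
      proof (rule frac_le)
        have "norm ((cos b - 1) - x * (s - 1) + x^2 * s) \<le> norm (cos b - 1) + norm (x * (s - 1)) + norm (x^2 * s)"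
          by (rule order_trans[OF norm_triangle_ineq add_right_mono[OF norm_triangle_ineq4]])
        also have "\<dots> \<le> 192 * Z + (Q + C) * Z + 2 * Z" using cosb1 xs1 x2s by linarith
        finally show "norm ((cos b - 1) - x * (s - 1) + x^2 * s) \<le> 192 * Z + (Q + C) * Z + 2 * Z" .
      qed (use dlow C Q Z' in auto)
      also have "\<dots> = 2 * (192 + Q + C + 2) * Z" by (simp add: algebra_simps)
      also have "\<dots> \<le> K * Z" using K0 Z'(3) unfolding K_def by (intro mult_right_mono) auto
      finally show ?thesis .
    qed
    show "\<exists>e' \<kappa>. (x + (x^2 + \<epsilon>^2) * s) * sin (\<epsilon> * e') = - \<epsilon> * cos (\<epsilon> * e') \<and>
         norm (e' - e - 1 - q * x) \<le> K * Z \<and>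
         sin (\<epsilon> * e') = sin (\<epsilon> * e) * (1 - x + \<kappa>) \<and> norm \<kappa> \<le> K * Z"
      using 1 2 3 4 by (intro exI[of _ e'] exI[of _ \<kappa>] conjI)
  qed
qed

text \<open>Both arguments lie within \<open>\<pi>/2\<close> of zero, so no branch of the logarithm is crossed.\<close>

lemma Ln_diff_right_half_plane:
  assumes "Re u > 0" "Re v > 0"
  shows "Ln (v / u) = Ln v - Ln u"
proof (rule Ln_unique)
  have "u \<noteq> 0" "v \<noteq> 0" using assms by auto
  then show "exp (Ln v - Ln u) = v / u" by (simp add: exp_diff)
  show "- pi < Im (Ln v - Ln u)" "Im (Ln v - Ln u) \<le> pi"
    using Re_Ln_pos_lt_imp[OF assms(1)] Re_Ln_pos_lt_imp[OF assms(2)] by auto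
qed

lemma norm_one_plus_le_exp: "norm (1 + z :: complex) \<le> exp (Re z + norm z ^ 2)"
proof -
  have "norm (1 + z) ^ 2 = 1 + (2 * Re z + norm z ^ 2)"
    unfolding cmod_power2 by (simp add: power2_eq_square algebra_simps)
  also have "\<dots> \<le> exp (2 * Re z + norm z ^ 2)" by (rule exp_ge_add_one_self)
  also have "\<dots> \<le> exp (Re z + norm z ^ 2) ^ 2"
    by (simp add: exp_double[symmetric] power2_eq_square flip: exp_add)
  finally show ?thesis by (rule power2_le_imp_le) simp
qed

text \<open>
  The two corrected quantities: \<open>e + q Ln (sin (\<epsilon> e))\<close> advances by nearly one, and \<open>\<bar>y\<bar> \<bar>sin (\<epsilon> e)\<bar>\<^sup>\<rho>\<close>
  grows by a factor close to one at most. Their errors \<open>K Z\<close> are summable along an orbit, whereas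
  \<open>e\<close> and \<open>ln \<bar>y\<bar>\<close> alone have errors of the order of \<open>x\<close>, which add up to a logarithm.
\<close>

definition nearly_invariant ::
    "map_family \<Rightarrow> complex \<Rightarrow> real \<Rightarrow> real \<Rightarrow> real \<Rightarrow> bool" where
  "nearly_invariant F q \<rho> K r1 \<longleftrightarrow>
     (\<forall>\<epsilon> x y e Z. \<epsilon> \<noteq> 0 \<longrightarrow> Z = norm x ^ 2 + norm y + norm \<epsilon> ^ 2 \<longrightarrow> Z < r1 \<longrightarrow>
       x * sin (\<epsilon> * e) = - \<epsilon> * cos (\<epsilon> * e) \<longrightarrow>
       (\<exists>e'. fst (F \<epsilon> (x, y)) * sin (\<epsilon> * e') = - \<epsilon> * cos (\<epsilon> * e') \<and> norm (e' - e - 1) \<le> 1/2 \<and>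
         (Re (sin (\<epsilon> * e)) > 0 \<longrightarrow> Re (sin (\<epsilon> * e')) > 0 \<longrightarrow>
            norm ((e' + q * Ln (sin (\<epsilon> * e'))) - (e + q * Ln (sin (\<epsilon> * e))) - 1) \<le> K * Z) \<and>
         norm (snd (F \<epsilon> (x, y))) * norm (sin (\<epsilon> * e')) powr \<rho>
           \<le> norm y * norm (sin (\<epsilon> * e)) powr \<rho> * exp (K * Z)))"

lemma nearly_invariant_step:
  fixes F :: map_family
  assumes gf: "gate_form F \<rho> q C r" and \<rho>: "\<rho> > 0"
  obtains K r1 where "K > 0" "r1 > 0"
    "nearly_invariant F q \<rho> K r1"
proof -
  note C = gate_form_pos(1)[OF gf] and r = gate_form_pos(2)[OF gf]
  show thesis
  proof (rule cot_coordinate_step[OF C, of q])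
    fix K1 r1
    assume K1: "K1 > 0" and r1: "r1 > 0" and step: "\<And>\<epsilon> x s e Z. \<epsilon> \<noteq> 0 \<Longrightarrow> Z < r1 \<Longrightarrow> norm x ^ 2 + norm \<epsilon> ^ 2 \<le> Z \<Longrightarrow>
       norm (s - 1 - (q + 1) * x) \<le> C * Z \<Longrightarrow> x * sin (\<epsilon> * e) = - \<epsilon> * cos (\<epsilon> * e) \<Longrightarrow>
       \<exists>e' \<kappa>. (x + (x^2 + \<epsilon>^2) * s) * sin (\<epsilon> * e') = - \<epsilon> * cos (\<epsilon> * e') \<and>
         norm (e' - e - 1 - q * x) \<le> K1 * Z \<and>
         sin (\<epsilon> * e') = sin (\<epsilon> * e) * (1 - x + \<kappa>) \<and> norm \<kappa> \<le> K1 * Z"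
    define KL where "KL = K1 + 4 + 4 * K1^2"
    define KW where "KW = K1 + norm q * KL"
    define KY where "KY = C + 2 * \<rho>^2 + 2 * C^2 + \<rho> * (K1 + 2 + 2 * K1^2)"
    define K where "K = KW + KY"
    define r2 where "r2 = min (min r1 (min r (r^2))) (min (1 / (4 * K1)) (min (1/16) ((1 / (4 * (norm q + 1)))^2)))"
    have KL: "KL > 0" using K1 by (simp add: KL_def add_pos_nonneg)
    have KW: "KW > 0" using K1 KL by (simp add: KW_def add_pos_nonneg)
    have KY: "KY > 0" using K1 C \<rho> by (simp add: KY_def add_pos_nonneg)
    have "0 < 1 / (4 * (norm q + 1))" by (simp add: add_nonneg_pos)
    then have r2: "r2 > 0" using r1 r K1 unfolding r2_def by simp
    show thesis
    proof (rule that[of K r2])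
      show "K > 0" "r2 > 0" using KW KY r2 by (simp_all add: K_def)
      show "nearly_invariant F q \<rho> K r2"
        unfolding nearly_invariant_def
      proof (intro allI impI)
      fix \<epsilon> x y e :: complex and Z
      assume \<epsilon>: "\<epsilon> \<noteq> 0" and Z_eq: "Z = norm x ^ 2 + norm y + norm \<epsilon> ^ 2" and Zr: "Z < r2"
        and e: "x * sin (\<epsilon> * e) = - \<epsilon> * cos (\<epsilon> * e)"
      have Z: "norm x ^ 2 \<le> Z" "norm y \<le> Z" "norm \<epsilon> ^ 2 \<le> Z" "norm x ^ 2 + norm \<epsilon> ^ 2 \<le> Z" "Z \<ge> 0"
        by (simp_all add: Z_eq)
      have Zs: "Z < r1" "Z < r" "Z < r^2" "Z < 1 / (4 * K1)" "Z < 1/16" "Z < (1 / (4 * (norm q + 1)))^2"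
        using Zr by (simp_all add: r2_def)
      have small: "norm x < c" if "Z < c^2" "c \<ge> 0" for c
        using power_less_imp_less_base[of "norm x" 2 c] Z(1) that by simp
      have small\<epsilon>: "norm \<epsilon> < c" if "Z < c^2" "c \<ge> 0" for c
        using power_less_imp_less_base[of "norm \<epsilon>" 2 c] Z(3) that by simp
      have x: "norm x < r" "norm x < 1/4" "norm x < 1 / (4 * (norm q + 1))"
        using small[of r] small[of "1/4"] small[of "1 / (4 * (norm q + 1))"] Zs r
        by (auto simp: power2_eq_square)
      have KZ: "K1 * Z \<le> 1/4" using Zs(4) K1 by (simp add: field_simps)
      have ny: "norm y < r" using Z(2) Zs(2) by simp
      obtain s m where Feq: "F \<epsilon> (x, y) = (x + (x^2 + \<epsilon>^2) * s, y * m)"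
        and s: "norm (s - 1 - (q + 1) * x) \<le> C * Z" and m: "norm (m - 1 - of_real \<rho> * x) \<le> C * Z"
        by (rule gate_formE[OF gf small\<epsilon>[OF Zs(3) less_imp_le[OF r]] x(1) ny])
          (rule that[unfolded Z_eq])
      obtain e' \<kappa> where e': "(x + (x^2 + \<epsilon>^2) * s) * sin (\<epsilon> * e') = - \<epsilon> * cos (\<epsilon> * e')"
        "norm (e' - e - 1 - q * x) \<le> K1 * Z"
        "sin (\<epsilon> * e') = sin (\<epsilon> * e) * (1 - x + \<kappa>)" and \<kappa>: "norm \<kappa> \<le> K1 * Z"
        using step[OF \<epsilon> Zs(1) Z(4) s e] by blast
      have qx: "norm (q * x) \<le> 1/4"
      proof -
        have "(norm q + 1) * norm x \<le> 1/4"
          using x(3) add_nonneg_pos[of "norm q" 1] by (simp add: field_simps)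
        moreover have "norm q * norm x \<le> (norm q + 1) * norm x" by (rule mult_right_mono) auto
        ultimately show ?thesis unfolding norm_mult by linarith
      qed
      have 1: "norm (e' - e - 1) \<le> 1/2"
        using norm_triangle_ineq[of "e' - e - 1 - q * x" "q * x"] e'(2) KZ qx by simp
      \<comment> \<open>the perturbation of the factor of the sine\<close>
      define z where "z = - x + \<kappa>"
      have z: "norm z \<le> norm x + K1 * Z" using norm_triangle_ineq[of "- x" \<kappa>] \<kappa> by (simp add: z_def)
      have LZ: "(L * Z)^2 \<le> L^2 * Z" for L
      proof -
        have "Z * Z \<le> 1 * Z" using Zs(5) Z(5) by (intro mult_right_mono) auto
        then have "L^2 * (Z * Z) \<le> L^2 * Z" by (intro mult_left_mono) auto
        then show ?thesis by (simp add: power2_eq_square mult_ac)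
      qed
      have sq: "(a + b)^2 \<le> 2 * a^2 + 2 * b^2" for a b :: real
        using zero_le_power2[of "a - b"] by (simp add: power2_eq_square algebra_simps)
      have z2: "norm z ^ 2 \<le> (2 + 2 * K1^2) * Z"
      proof -
        have "norm z ^ 2 \<le> (norm x + K1 * Z)^2" by (rule power_mono[OF z]) simp
        also have "\<dots> \<le> 2 * norm x ^ 2 + 2 * (K1 * Z)^2" by (rule sq)
        also have "\<dots> \<le> 2 * Z + 2 * (K1^2 * Z)" using Z(1) LZ[of K1] by simp
        finally show ?thesis by (simp add: algebra_simps)
      qed
      have zh: "norm z \<le> 1/2" using z x(2) KZ by simp
      have sinz: "sin (\<epsilon> * e') = sin (\<epsilon> * e) * (1 + z)" by (simp add: e'(3) z_def)
      have 2: "norm ((e' + q * Ln (sin (\<epsilon> * e'))) - (e + q * Ln (sin (\<epsilon> * e))) - 1) \<le> K * Z"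
        if pos: "Re (sin (\<epsilon> * e)) > 0" "Re (sin (\<epsilon> * e')) > 0"
      proof -
        have "sin (\<epsilon> * e) \<noteq> 0" using pos(1) by auto
        then have "Ln (sin (\<epsilon> * e')) - Ln (sin (\<epsilon> * e)) = Ln (1 + z)"
          using Ln_diff_right_half_plane[OF pos] by (simp add: sinz)
        moreover have "norm (Ln (1 + z) - z) \<le> (4 + 4 * K1^2) * Z"
        proof -
          have "norm (Ln (1 + z) - z) \<le> norm z ^ 2 / (1 - norm z)"
            using zh by (intro Ln_approx_linear) simp
          also have "\<dots> \<le> norm z ^ 2 / (1/2)" using zh by (intro divide_left_mono) auto
          also have "\<dots> \<le> (4 + 4 * K1^2) * Z" using z2 by (simp add: algebra_simps)
          finally show ?thesis .
        qed
        ultimately have "norm (Ln (sin (\<epsilon> * e')) - Ln (sin (\<epsilon> * e)) + x) \<le> (4 + 4 * K1^2) * Z + K1 * Z"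
          using norm_triangle_ineq[of "Ln (1 + z) - z" \<kappa>] \<kappa> by (simp add: z_def)
        then have L: "norm (Ln (sin (\<epsilon> * e')) - Ln (sin (\<epsilon> * e)) + x) \<le> KL * Z"
          by (simp add: KL_def algebra_simps)
        have "(e' + q * Ln (sin (\<epsilon> * e'))) - (e + q * Ln (sin (\<epsilon> * e))) - 1
            = (e' - e - 1 - q * x) + q * (Ln (sin (\<epsilon> * e')) - Ln (sin (\<epsilon> * e)) + x)"
          by (simp add: algebra_simps)
        also have "norm \<dots> \<le> K1 * Z + norm q * (KL * Z)"
          using e'(2) mult_left_mono[OF L, of "norm q"]
          by (intro norm_triangle_mono) (simp_all add: norm_mult)
        also have "\<dots> = KW * Z" by (simp add: KW_def algebra_simps)
        also have "\<dots> \<le> K * Z" using KY Z(5) by (intro mult_right_mono) (simp_all add: K_def)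
        finally show ?thesis .
      qed
      have 3: "norm (y * m) * norm (sin (\<epsilon> * e')) powr \<rho> \<le> norm y * norm (sin (\<epsilon> * e)) powr \<rho> * exp (K * Z)"
      proof -
        have "norm (1 + z) \<le> exp (- Re x + (K1 + 2 + 2 * K1^2) * Z)"
        proof -
          have "Re z \<le> - Re x + K1 * Z" using complex_Re_le_cmod[of \<kappa>] \<kappa> by (simp add: z_def)
          then have "Re z + norm z ^ 2 \<le> - Re x + (K1 + 2 + 2 * K1^2) * Z"
            using z2 by (simp add: algebra_simps)
          then show ?thesis using norm_one_plus_le_exp[of z] by (meson exp_le_cancel_iff order_trans)
        qed
        then have "norm (1 + z) powr \<rho> \<le> exp (- Re x + (K1 + 2 + 2 * K1^2) * Z) powr \<rho>"
          using \<rho> by (intro powr_mono2) auto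
        also have "\<dots> = exp (\<rho> * (- Re x + (K1 + 2 + 2 * K1^2) * Z))" by (simp add: powr_def)
        finally have A: "norm (1 + z) powr \<rho> \<le> exp (\<rho> * (- Re x + (K1 + 2 + 2 * K1^2) * Z))" .
        define w where "w = m - 1"
        define w' where "w' = m - 1 - of_real \<rho> * x"
        have w': "norm w' \<le> C * Z" using m by (simp add: w'_def)
        have ww: "w = of_real \<rho> * x + w'" by (simp add: w_def w'_def)
        have w2: "norm w ^ 2 \<le> 2 * \<rho>^2 * Z + 2 * C^2 * Z"
        proof -
          have "norm w \<le> \<rho> * norm x + C * Z"
            unfolding ww using w' \<rho> by (intro norm_triangle_mono) (simp_all add: norm_mult)
          then have "norm w ^ 2 \<le> (\<rho> * norm x + C * Z)^2" by (rule power_mono) simp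
          also have "\<dots> \<le> 2 * (\<rho> * norm x)^2 + 2 * (C * Z)^2" by (rule sq)
          also have "(C * Z)^2 \<le> C^2 * Z" by (rule LZ)
          also have "(\<rho> * norm x)^2 \<le> \<rho>^2 * Z" using Z(1) by (simp add: power_mult_distrib mult_left_mono)
          finally show ?thesis by simp
        qed
        have "Re w \<le> \<rho> * Re x + C * Z"
          using complex_Re_le_cmod[of w'] w' by (simp add: ww)
        then have "Re w + norm w ^ 2 \<le> \<rho> * Re x + (C + 2 * \<rho>^2 + 2 * C^2) * Z"
          using w2 by (simp add: algebra_simps)
        then have B: "norm m \<le> exp (\<rho> * Re x + (C + 2 * \<rho>^2 + 2 * C^2) * Z)"
          using norm_one_plus_le_exp[of w] by (simp add: w_def) (meson exp_le_cancel_iff order_trans)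
        have "norm m * norm (1 + z) powr \<rho> \<le>
            exp (\<rho> * Re x + (C + 2 * \<rho>^2 + 2 * C^2) * Z) * exp (\<rho> * (- Re x + (K1 + 2 + 2 * K1^2) * Z))"
          by (intro mult_mono A B) simp_all
        also have "\<dots> = exp (KY * Z)" by (simp add: KY_def algebra_simps flip: exp_add)
        also have "\<dots> \<le> exp (K * Z)" using KW Z(5) by (simp add: K_def mult_right_mono)
        finally have "norm y * norm (sin (\<epsilon> * e)) powr \<rho> * (norm m * norm (1 + z) powr \<rho>)
            \<le> norm y * norm (sin (\<epsilon> * e)) powr \<rho> * exp (K * Z)"
          by (rule mult_left_mono) simp
        then show ?thesis by (simp add: sinz norm_mult powr_mult mult_ac)
      qed
      show "\<exists>e'. fst (F \<epsilon> (x, y)) * sin (\<epsilon> * e') = - \<epsilon> * cos (\<epsilon> * e') \<and> norm (e' - e - 1) \<le> 1/2 \<and>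
         (Re (sin (\<epsilon> * e)) > 0 \<longrightarrow> Re (sin (\<epsilon> * e')) > 0 \<longrightarrow>
            norm ((e' + q * Ln (sin (\<epsilon> * e'))) - (e + q * Ln (sin (\<epsilon> * e))) - 1) \<le> K * Z) \<and>
         norm (snd (F \<epsilon> (x, y))) * norm (sin (\<epsilon> * e')) powr \<rho>
           \<le> norm y * norm (sin (\<epsilon> * e)) powr \<rho> * exp (K * Z)"
        using e'(1) 1 2 3 unfolding Feq fst_conv snd_conv by (intro exI[of _ e'] conjI impI)
      qed
    qed
  qed
qed

section \<open>Passing through the gate\<close>

text \<open>The first zero of \<open>sin z / z\<close> is at distance \<open>\<pi> > 3\<close> from the origin.\<close>

lemma sin_comparable_identity:
  obtains a b :: real where "0 < a" "a \<le> b" "1 \<le> b"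
    "\<And>z::complex. norm z \<le> 3 \<Longrightarrow> a * norm z \<le> norm (sin z)"
    "\<And>z::complex. norm z \<le> 3 \<Longrightarrow> norm (sin z) \<le> b * norm z"
    "\<And>z::complex. norm z \<le> 3 \<Longrightarrow> norm (cos z) \<le> b"
proof -
  have "sin holomorphic_on ball (0::complex) pi" by (intro holomorphic_intros)
  then obtain h where h: "h holomorphic_on ball (0::complex) pi" "\<And>z. norm z < pi \<Longrightarrow> sin z = z * h z" "deriv sin 0 = h 0"
    using Schwarz3[of sin pi] by auto
  have "deriv sin (0::complex) = cos 0" by (rule DERIV_imp_deriv[OF DERIV_sin])
  then have h0: "h 0 = 1" using h(3) by (metis cos_zero)
  have sub: "cball (0::complex) 3 \<subseteq> ball 0 pi" using pi_gt3 by auto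
  have cont: "continuous_on (cball 0 3) (\<lambda>z. norm (h z))"
    by (intro continuous_on_norm continuous_on_subset[OF holomorphic_on_imp_continuous_on[OF h(1)] sub])
  have nz: "h z \<noteq> 0" if z: "z \<in> cball 0 3" for z
  proof
    assume "h z = 0"
    then have z0: "z \<noteq> 0" and "sin z = 0" using h0 h(2)[of z] z sub by auto
    then obtain n :: int where n: "z = of_real (n * pi)" by (auto simp: sin_eq_0)
    then have "n \<noteq> 0" using z0 by auto
    then have "\<bar>real_of_int n\<bar> \<ge> 1" by linarith
    then have "norm z \<ge> 1 * pi" unfolding n norm_of_real abs_mult by (intro mult_mono) auto
    then show False using z pi_gt3 by simp
  qed
  obtain z1 where z1: "z1 \<in> cball 0 3" "\<And>z. z \<in> cball 0 3 \<Longrightarrow> norm (h z1) \<le> norm (h z)"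
    using continuous_attains_inf[OF compact_cball _ cont] by auto
  obtain z2 where z2: "z2 \<in> cball 0 3" "\<And>z. z \<in> cball 0 3 \<Longrightarrow> norm (h z) \<le> norm (h z2)"
    using continuous_attains_sup[OF compact_cball _ cont] by auto
  have sin_eq: "norm (sin z) = norm (h z) * norm z" if "norm z \<le> 3" for z
    using h(2)[of z] that pi_gt3 by (simp add: norm_mult mult.commute)
  show thesis
  proof (rule that[of "norm (h z1)" "max (norm (h z2)) (exp 3)"])
    show "0 < norm (h z1)" using nz[OF z1(1)] by simp
    show "norm (h z1) \<le> max (norm (h z2)) (exp 3)" using z1(2)[OF z2(1)] by simp
    show "1 \<le> max (norm (h z2)) (exp 3)" by (simp add: le_max_iff_disj)
    fix z :: complex assume z: "norm z \<le> 3"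
    show "norm (h z1) * norm z \<le> norm (sin z)"
      unfolding sin_eq[OF z] using z1(2)[of z] z by (intro mult_right_mono) auto
    show "norm (sin z) \<le> max (norm (h z2)) (exp 3) * norm z"
      unfolding sin_eq[OF z] using z2(2)[of z] z by (intro mult_right_mono) auto
    have "norm (cos z) \<le> exp 3" using norm_cos_le[of z] z by (meson exp_le_cancel_iff order_trans)
    then show "norm (cos z) \<le> max (norm (h z2)) (exp 3)" by simp
  qed
qed

text \<open>
  For \<open>\<epsilon> = \<pi> / (k - t)\<close> the function \<open>cot (\<epsilon> e)\<close> has the period \<open>\<pi> / \<epsilon> = k - t\<close> in \<open>e\<close>. A point with
  \<open>e\<close> near the real number \<open>u\<close> is at distance about \<open>min u (k - u)\<close> from the two ends of the period,
  and the symmetry \<open>e \<mapsto> \<pi> / \<epsilon> - e\<close> reduces the exit to the entrance.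
\<close>

definition gate_bounds :: "real \<Rightarrow> bool" where
  "gate_bounds a \<longleftrightarrow> (\<forall>k t u e x \<epsilon>. k > 0 \<longrightarrow> 0 < u \<longrightarrow> u < k \<longrightarrow> norm t \<le> k / 20 \<longrightarrow> norm t \<le> (k - u) / 4 \<longrightarrow>
       norm (e - of_real u) \<le> min u (k - u) / 4 \<longrightarrow> \<epsilon> = of_real pi / (of_real k - t) \<longrightarrow>
       x * sin (\<epsilon> * e) = - \<epsilon> * cos (\<epsilon> * e) \<longrightarrow>
       Re (sin (\<epsilon> * e)) > 0 \<and> a * (norm \<epsilon> * min u (k - u)) \<le> norm (sin (\<epsilon> * e)) \<and>
       norm (sin (\<epsilon> * e)) \<le> norm \<epsilon> * min u (k - u) / a \<and>
       norm x \<le> 1 / (a * min u (k - u)) \<and> norm \<epsilon> \<le> 4 / min u (k - u))"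

lemma gate_geometry:
  obtains a where "0 < a" "a \<le> (1::real)"
    "gate_bounds a"
proof (rule sin_comparable_identity)
  fix a b :: real
  assume ab: "0 < a" "a \<le> b" "1 \<le> b"
    and low: "\<And>z::complex. norm z \<le> 3 \<Longrightarrow> a * norm z \<le> norm (sin z)"
    and up: "\<And>z::complex. norm z \<le> 3 \<Longrightarrow> norm (sin z) \<le> b * norm z"
    and cosb: "\<And>z::complex. norm z \<le> 3 \<Longrightarrow> norm (cos z) \<le> b"
  define c where "c = min (a / (2 * b)) (1 / (2 * b))"
  have c: "0 < c" "c \<le> 1" "c \<le> a / 2" "c \<le> a / (2 * b)" "c * (3/2 * b) \<le> 1"
  proof -
    show "0 < c" using ab by (simp add: c_def)
    have "1 / (2 * b) \<le> 1" using ab(3) by simp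
    then show "c \<le> 1" by (simp add: c_def min.coboundedI2)
    have "a / (2 * b) \<le> a / (2 * 1)" using ab by (intro divide_left_mono) auto
    then show "c \<le> a / 2" by (simp add: c_def min.coboundedI1)
    show "c \<le> a / (2 * b)" by (simp add: c_def)
    have "c * (3/2 * b) \<le> 1 / (2 * b) * (3/2 * b)" using ab by (intro mult_right_mono) (auto simp: c_def)
    moreover have "1 / (2 * b) * (3/2 * b) = 3/4" using ab by simp
    ultimately show "c * (3/2 * b) \<le> 1" by linarith
  qed
  \<comment> \<open>one end of the period\<close>
  have half: "Re (sin (\<epsilon> * \<zeta>)) > 0 \<and> c * (norm \<epsilon> * u) \<le> norm (sin (\<epsilon> * \<zeta>)) \<and>
      norm (sin (\<epsilon> * \<zeta>)) \<le> norm \<epsilon> * u / c \<and> (\<forall>x::complex. norm x * norm (sin (\<epsilon> * \<zeta>)) = norm \<epsilon> * norm (cos (\<epsilon> * \<zeta>)) \<longrightarrow>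
      norm x \<le> 1 / (c * u)) \<and> norm \<epsilon> \<le> 4 / u"
    if k: "k > 0" and u: "0 < u" "u \<le> k / 2" and t: "norm t \<le> k / 20" and \<zeta>: "norm (\<zeta> - of_real u) \<le> u / 2"
      and \<epsilon>: "\<epsilon> = of_real pi / (of_real k - t)" for k u t \<zeta> \<epsilon>
  proof -
    have nk: "norm (of_real k - t) \<ge> 19/20 * k"
      using norm_triangle_ineq2[of "of_real k" t] t k by simp
    then have kt: "of_real k - t \<noteq> 0" using k by auto
    have n\<epsilon>: "norm \<epsilon> \<le> pi / (19/20 * k)"
    proof -
      have "norm \<epsilon> = pi / norm (of_real k - t)" by (simp add: \<epsilon> norm_divide)
      also have "\<dots> \<le> pi / (19/20 * k)" using nk k kt by (intro divide_left_mono) auto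
      finally show ?thesis .
    qed
    have \<epsilon>0: "norm \<epsilon> > 0" using kt by (simp add: \<epsilon>)
    have \<epsilon>u: "norm \<epsilon> * u \<le> 5/3"
    proof -
      have "norm \<epsilon> * u \<le> pi / (19/20 * k) * (k / 2)" using n\<epsilon> u k by (intro mult_mono) auto
      also have "\<dots> = pi * (10/19)" using k by simp
      also have "\<dots> \<le> 5/3" using pi_approx by simp
      finally show ?thesis .
    qed
    have n\<zeta>: "norm \<zeta> \<le> 3/2 * u" "norm \<zeta> \<ge> u / 2"
      using norm_triangle_ineq[of "\<zeta> - of_real u" "of_real u"] norm_triangle_ineq2[of "of_real u" "of_real u - \<zeta>"] \<zeta> u
      by (simp_all add: norm_minus_commute)
    have nz: "norm (\<epsilon> * \<zeta>) \<le> norm \<epsilon> * (3/2 * u)" "norm \<epsilon> * (u / 2) \<le> norm (\<epsilon> * \<zeta>)"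
      unfolding norm_mult using n\<zeta> by (intro mult_left_mono norm_ge_zero; simp)+
    have z3: "norm (\<epsilon> * \<zeta>) \<le> 5/2" using nz(1) \<epsilon>u by simp
    have Re: "Re (\<epsilon> * \<zeta>) > 0"
    proof -
      define \<alpha> \<beta> where "\<alpha> = t / (of_real k - t)" and "\<beta> = (\<zeta> - of_real u) / of_real u"
      have \<alpha>: "norm \<alpha> \<le> 1/19"
      proof -
        have "norm \<alpha> \<le> (k / 20) / (19/20 * k)"
          unfolding \<alpha>_def norm_divide using t nk k by (intro frac_le) auto
        then show ?thesis using k by simp
      qed
      have \<beta>: "norm \<beta> \<le> 1/2" using \<zeta> u by (simp add: \<beta>_def norm_divide field_simps)
      have eq: "\<epsilon> * \<zeta> = of_real (pi / k * u) * ((1 + \<alpha>) * (1 + \<beta>))"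
        using kt k u by (simp add: \<epsilon> \<alpha>_def \<beta>_def field_simps)
      have "norm (\<alpha> + \<beta> + \<alpha> * \<beta>) \<le> norm \<alpha> + norm \<beta> + norm \<alpha> * norm \<beta>"
        by (intro norm_triangle_mono) (simp_all add: norm_mult)
      also have "\<dots> \<le> 1/19 + 1/2 + 1/19 * (1/2)" using \<alpha> \<beta> by (intro add_mono mult_mono) auto
      finally have "Re (\<alpha> + \<beta> + \<alpha> * \<beta>) > - 1"
        using abs_Re_le_cmod[of "\<alpha> + \<beta> + \<alpha> * \<beta>"] by linarith
      then have "Re ((1 + \<alpha>) * (1 + \<beta>)) > 0" by (simp add: algebra_simps)
      then show ?thesis unfolding eq using k u by (simp only: Re_complex_of_real Im_complex_of_real times_complex.sel) simp
    qed
    have "Re (\<epsilon> * \<zeta>) < pi" using complex_Re_le_cmod[of "\<epsilon> * \<zeta>"] z3 pi_gt3 by linarith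
    then have 1: "Re (sin (\<epsilon> * \<zeta>)) > 0" using Re_sin_pos Re by blast
    have 2: "a * (norm \<epsilon> * (u / 2)) \<le> norm (sin (\<epsilon> * \<zeta>))"
      using low[of "\<epsilon> * \<zeta>"] mult_left_mono[OF nz(2), of a] z3 ab by linarith
    have "c * (norm \<epsilon> * u) \<le> a / 2 * (norm \<epsilon> * u)" using c(3) u by (intro mult_right_mono) auto
    then have low2: "c * (norm \<epsilon> * u) \<le> norm (sin (\<epsilon> * \<zeta>))" using 2 by simp
    have 3: "norm (sin (\<epsilon> * \<zeta>)) \<le> norm \<epsilon> * u / c"
    proof -
      have "norm (sin (\<epsilon> * \<zeta>)) \<le> b * (norm \<epsilon> * (3/2 * u))"
        using up[of "\<epsilon> * \<zeta>"] mult_left_mono[OF nz(1), of b] z3 ab by linarith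
      also have "\<dots> = norm \<epsilon> * u * (3/2 * b)" by simp
      also have "\<dots> \<le> norm \<epsilon> * u * (1 / c)" using c(1,5) u by (intro mult_left_mono) (auto simp: field_simps)
      finally show ?thesis by simp
    qed
    have 4: "norm x \<le> 1 / (c * u)" if x: "norm x * norm (sin (\<epsilon> * \<zeta>)) = norm \<epsilon> * norm (cos (\<epsilon> * \<zeta>))" for x :: complex
    proof -
      have "norm x * (a * (norm \<epsilon> * (u / 2))) \<le> norm x * norm (sin (\<epsilon> * \<zeta>))"
        using 2 by (intro mult_left_mono) auto
      also have "\<dots> \<le> norm \<epsilon> * b" unfolding x using cosb[of "\<epsilon> * \<zeta>"] z3 by (intro mult_left_mono) auto
      finally have "norm \<epsilon> * (norm x * (a * (u / 2))) \<le> norm \<epsilon> * b" by (simp add: mult_ac)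
      then have "norm x * (a * (u / 2)) \<le> b" using \<epsilon>0 by simp
      then have "norm x * (a / (2 * b) * u) \<le> 1" using ab by (simp add: field_simps)
      moreover have "norm x * (c * u) \<le> norm x * (a / (2 * b) * u)"
        using c(4) u by (intro mult_left_mono mult_right_mono) auto
      ultimately have "norm x * (c * u) \<le> 1" by linarith
      then show ?thesis using c(1) u by (simp add: pos_le_divide_eq)
    qed
    have 5: "norm \<epsilon> \<le> 4 / u" using \<epsilon>u u by (simp add: pos_le_divide_eq)
    show ?thesis using 1 low2 3 4 5 by blast
  qed
  show thesis
  proof (rule that[OF c(1,2)], unfold gate_bounds_def, intro allI impI)
    fix k u :: real and t e x \<epsilon> :: complex
    assume k: "k > 0" and u: "0 < u" "u < k" and t: "norm t \<le> k / 20" "norm t \<le> (k - u) / 4"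
      and e: "norm (e - of_real u) \<le> min u (k - u) / 4" and \<epsilon>: "\<epsilon> = of_real pi / (of_real k - t)"
      and x: "x * sin (\<epsilon> * e) = - \<epsilon> * cos (\<epsilon> * e)"
    have nx: "norm x * norm (sin (\<epsilon> * e)) = norm \<epsilon> * norm (cos (\<epsilon> * e))"
      using arg_cong[OF x, of norm] by (simp add: norm_mult)
    show "Re (sin (\<epsilon> * e)) > 0 \<and> c * (norm \<epsilon> * min u (k - u)) \<le> norm (sin (\<epsilon> * e)) \<and>
       norm (sin (\<epsilon> * e)) \<le> norm \<epsilon> * min u (k - u) / c \<and>
       norm x \<le> 1 / (c * min u (k - u)) \<and> norm \<epsilon> \<le> 4 / min u (k - u)"
    proof (cases "u \<le> k - u")
      case True
      then have m: "min u (k - u) = u" by simp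
      have "u \<le> k / 2" "norm (e - of_real u) \<le> u / 2" using e u True unfolding m by simp_all
      from half[OF k u(1) this(1) t(1) this(2) \<epsilon>] show ?thesis
        using nx unfolding m by blast
    next
      case False
      then have m: "min u (k - u) = k - u" by simp
      define f where "f = (of_real k - t) - e"
      have "norm (of_real k - t) \<ge> 19/20 * k"
        using norm_triangle_ineq2[of "of_real k" t] t k by simp
      then have kt: "of_real k - t \<noteq> 0" using k by auto
      have "\<epsilon> * f = of_real pi - \<epsilon> * e" using kt by (simp add: f_def \<epsilon> field_simps)
      then have sc: "sin (\<epsilon> * f) = sin (\<epsilon> * e)" "cos (\<epsilon> * f) = - cos (\<epsilon> * e)"
        by (simp_all add: sin_diff cos_diff flip: sin_of_real cos_of_real)
      have "f - of_real (k - u) = - (t + (e - of_real u))" by (simp add: f_def)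
      then have "norm (f - of_real (k - u)) \<le> norm t + norm (e - of_real u)"
        by (simp only: norm_minus_cancel norm_triangle_ineq)
      then have "norm (f - of_real (k - u)) \<le> (k - u) / 2" using t(2) e m by simp
      moreover have "0 < k - u" "k - u \<le> k / 2" using u False by simp_all
      ultimately have H: "Re (sin (\<epsilon> * f)) > 0 \<and> c * (norm \<epsilon> * (k - u)) \<le> norm (sin (\<epsilon> * f)) \<and>
        norm (sin (\<epsilon> * f)) \<le> norm \<epsilon> * (k - u) / c \<and>
        (\<forall>x::complex. norm x * norm (sin (\<epsilon> * f)) = norm \<epsilon> * norm (cos (\<epsilon> * f)) \<longrightarrow>
          norm x \<le> 1 / (c * (k - u))) \<and> norm \<epsilon> \<le> 4 / (k - u)"
        by (intro half[OF k _ _ t(1) _ \<epsilon>])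
      have "norm (cos (\<epsilon> * f)) = norm (cos (\<epsilon> * e))" by (simp add: sc)
      then show ?thesis using H nx unfolding m sc(1) by simp
    qed
  qed
qed

text \<open>
  The orbit inside the gate, by a bootstrap over the number of steps. Here \<open>d j\<close> is the distance of
  the expected position \<open>A + j\<close> to the nearer end of the period. As long as \<open>e\<close> stays near \<open>A + j\<close>, both
  \<open>\<bar>x\<bar>\<close> and \<open>\<bar>\<epsilon>\<bar>\<close> are of the order \<open>1 / d j\<close>, and \<open>\<bar>y\<bar>\<close> is at most \<open>d j\<close> to the power \<open>- \<rho>\<close>. The errors
  of the nearly invariant quantities are then of the order of \<open>d j\<close> to the power \<open>- \<sigma>\<close>, and their sum
  converges because \<open>\<rho> > 1\<close> implies \<open>\<sigma> > 1\<close>. The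
  quantity \<open>e + q Ln (sin (\<epsilon> e))\<close> then determines \<open>e\<close> up to a multiple of \<open>ln (d j / A)\<close>, which for large \<open>A\<close>
  is a small fraction of \<open>d j\<close>. No logarithm of \<open>k\<close> survives at the exit, since there \<open>sin (\<epsilon> e)\<close> has
  returned to the size that it had at the entrance, up to a factor comparable to \<open>M / A\<close>.
\<close>

lemma gate_orbit:
  fixes F :: map_family and A M k :: nat
  assumes K: "K > 0"
    and step: "nearly_invariant F q \<rho> K r1"
    and a: "0 < a" "a \<le> 1"
    and geom: "gate_bounds a"
    and \<rho>: "\<rho> > 1" and \<sigma>: "\<sigma> = min \<rho> 2" and B: "B = 1 / a^2 + 17"
    and tail: "\<And>J. finite J \<Longrightarrow> (\<Sum>m\<in>J. real (m + A) powr - \<sigma>) \<le> T"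
    and T: "2 * (K * B * T) \<le> 1" "B * T < r1"
    and A: "A \<ge> 8" "16 * (3/2 + norm q * (ln (1 / a^2) + pi)) \<le> real A" "16 * norm q \<le> real A"
    and M: "A \<le> M" and k: "20 * M \<le> k" and t: "norm t \<le> real M / 4"
    and \<epsilon>: "\<epsilon> = of_real pi / (of_nat k - t)"
    and start: "fst z * sin (\<epsilon> * e0) = - \<epsilon> * cos (\<epsilon> * e0)" "norm (e0 - of_nat A) \<le> 1/2"
    and y0: "norm (snd z) * exp 1 * (real A / a^2) powr \<rho> \<le> 1"
    and j: "j \<le> k - A - M"
  defines "d \<equiv> \<lambda>j. min (real (A + j)) (real k - real (A + j))"
  shows "\<exists>e. fst ((F \<epsilon> ^^ j) z) * sin (\<epsilon> * e) = - \<epsilon> * cos (\<epsilon> * e) \<and>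
     norm (e - of_nat (A + j)) \<le> d j / 8 \<and> norm (fst ((F \<epsilon> ^^ j) z)) \<le> 1 / (a * d j) \<and>
     norm (snd ((F \<epsilon> ^^ j) z)) \<le> d j powr - \<sigma>"
proof -
  define N where "N = k - A - M"
  have kAM: "A + N + M = k" using k M by (simp add: N_def)
  have d_ge: "real A \<le> d i" if "i \<le> N" for i
    using that kAM M by (simp add: d_def)
  have d0: "d 0 = real A" using kAM M by (simp add: d_def)
  have A0: "real A > 0" "real A \<ge> 8" using A by simp_all
  have d_pos: "d i > 0" "d i \<ge> 1" if "i \<le> N" for i using d_ge[OF that] A0 by linarith+
  have d_Suc: "d i \<le> d (Suc i) + 1" for i by (simp add: d_def)
  have kt: "of_nat k - t \<noteq> 0"
  proof
    assume "of_nat k - t = 0"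
    then have "norm t = real k" by (metis eq_iff_diff_eq_0 norm_of_nat)
    then show False using t k M A by simp
  qed
  have \<epsilon>0: "\<epsilon> \<noteq> 0" using kt by (simp add: \<epsilon>)
  have \<sigma>1: "\<sigma> > 1" "\<sigma> \<le> \<rho>" "\<sigma> \<le> 2" using \<rho> by (simp_all add: \<sigma>)
  have T0: "0 \<le> T" using tail[of "{}"] by simp
  have B0: "B \<ge> 17" using a by (simp add: B)
  have dT: "d i powr - \<sigma> \<le> T" if "i \<le> N" for i
  proof -
    have "d i powr - \<sigma> \<le> real A powr - \<sigma>"
      using d_ge[OF that] A0 \<sigma>1 by (intro powr_mono2') auto
    also have "\<dots> \<le> T" using tail[of "{0}"] by simp
    finally show ?thesis .
  qed
  define S where "S j = (\<Sum>i<j. d i powr - \<sigma>)" for j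
  have S_bound: "S j \<le> 2 * T" if j: "j \<le> N" for j
  proof -
    have "S j \<le> (\<Sum>i<j. real (i + A) powr - \<sigma> + real (k - A - i) powr - \<sigma>)"
      unfolding S_def
    proof (rule sum_mono)
      fix i assume "i \<in> {..<j}"
      then have "real k - real (A + i) = real (k - A - i)" using j kAM by simp
      then have "d i = min (real (i + A)) (real (k - A - i))"
        unfolding d_def by (simp only: add.commute[of A i])
      then have "d i = real (i + A) \<or> d i = real (k - A - i)" by linarith
      then show "d i powr - \<sigma> \<le> real (i + A) powr - \<sigma> + real (k - A - i) powr - \<sigma>" by auto
    qed
    also have "\<dots> = (\<Sum>i<j. real (i + A) powr - \<sigma>) + (\<Sum>i<j. real (k - A - i) powr - \<sigma>)"
      by (rule sum.distrib)
    also have "(\<Sum>i<j. real (k - A - i) powr - \<sigma>) = (\<Sum>m\<in>(\<lambda>i. k - A - i - A) ` {..<j}. real (m + A) powr - \<sigma>)"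
    proof (subst sum.reindex)
      show "inj_on (\<lambda>i. k - A - i - A) {..<j}"
      proof (rule inj_onI)
        fix i i' assume "i \<in> {..<j}" "i' \<in> {..<j}" "k - A - i - A = k - A - i' - A"
        then show "i = i'" using j kAM M by simp
      qed
      have "k - A - i - A + A = k - A - i" if "i < j" for i using that j kAM M by simp
      then show "(\<Sum>i<j. real (k - A - i) powr - \<sigma>)
          = sum ((\<lambda>m. real (m + A) powr - \<sigma>) \<circ> (\<lambda>i. k - A - i - A)) {..<j}"
        by (intro sum.cong refl) (simp only: o_apply lessThan_iff)
    qed
    finally show ?thesis using tail[of "{..<j}"] tail[of "(\<lambda>i. k - A - i - A) ` {..<j}"] by simp
  qed
  have KBS: "K * B * S j \<le> 1" if "j \<le> N" for j
  proof -
    have "K * B * S j \<le> K * B * (2 * T)" using S_bound[OF that] K B0 by (intro mult_left_mono) auto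
    then show ?thesis using T(1) by simp
  qed
  define X where "X j = (F \<epsilon> ^^ j) z" for j
  have geo: "Re (sin (\<epsilon> * e)) > 0 \<and> a * (norm \<epsilon> * d i) \<le> norm (sin (\<epsilon> * e)) \<and>
       norm (sin (\<epsilon> * e)) \<le> norm \<epsilon> * d i / a \<and> norm x \<le> 1 / (a * d i) \<and> norm \<epsilon> \<le> 4 / d i"
    if i: "i \<le> N" and e: "norm (e - of_nat (A + i)) \<le> d i / 4"
      and x: "x * sin (\<epsilon> * e) = - \<epsilon> * cos (\<epsilon> * e)" for i e x
  proof -
    have "real k > 0" "0 < real (A + i)" "real (A + i) < real k" "norm t \<le> real k / 20"
      "norm t \<le> (real k - real (A + i)) / 4"
      using i kAM M A0 t k by (simp_all)
    from geom[unfolded gate_bounds_def, rule_format, OF this _ _ x] show ?thesis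
      using e \<epsilon> unfolding d_def of_real_of_nat_eq by blast
  qed
  have e0: "norm (e0 - of_nat (A + 0)) \<le> d 0 / 4" using start(2) A0 by (simp add: d0)
  note geo0 = geo[OF _ e0 start(1), simplified d0]
  define W where "W e = e + q * Ln (sin (\<epsilon> * e))" for e
  define inv where "inv j e \<longleftrightarrow> fst (X j) * sin (\<epsilon> * e) = - \<epsilon> * cos (\<epsilon> * e) \<and>
      norm (e - of_nat (A + j)) \<le> d j / 4 \<and> norm (W e - W e0 - of_nat j) \<le> K * B * S j \<and>
      norm (snd (X j)) * norm (sin (\<epsilon> * e)) powr \<rho>
        \<le> norm (snd z) * norm (sin (\<epsilon> * e0)) powr \<rho> * exp (K * B * S j)" for j e
  \<comment> \<open>the nearly invariant quantities turn the a priori bound \<open>d / 4\<close> into \<open>d / 8\<close>\<close>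
  have strong: "norm (e - of_nat (A + j)) \<le> d j / 8 \<and> norm (fst (X j)) \<le> 1 / (a * d j) \<and>
      norm (snd (X j)) \<le> d j powr - \<sigma> \<and>
      norm (fst (X j)) ^ 2 + norm (snd (X j)) + norm \<epsilon> ^ 2 \<le> B * d j powr - \<sigma> \<and>
      Re (sin (\<epsilon> * e)) > 0"
    if I: "inv j e" and j: "j \<le> N" for j e
  proof -
    have Ie: "fst (X j) * sin (\<epsilon> * e) = - \<epsilon> * cos (\<epsilon> * e)" "norm (e - of_nat (A + j)) \<le> d j / 4"
      and IW: "norm (W e - W e0 - of_nat j) \<le> K * B * S j"
      and IY: "norm (snd (X j)) * norm (sin (\<epsilon> * e)) powr \<rho>
        \<le> norm (snd z) * norm (sin (\<epsilon> * e0)) powr \<rho> * exp (K * B * S j)"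
      using I unfolding inv_def by blast+
    note G = geo[OF j Ie(2,1)]
    note dj = d_pos[OF j] d_ge[OF j]
    define s s0 where "s = sin (\<epsilon> * e)" and "s0 = sin (\<epsilon> * e0)"
    have n\<epsilon>: "norm \<epsilon> > 0" using \<epsilon>0 by simp
    have s: "a * (norm \<epsilon> * d j) \<le> norm s" "norm s \<le> norm \<epsilon> * d j / a" "Re s > 0"
      and s0: "a * (norm \<epsilon> * real A) \<le> norm s0" "norm s0 \<le> norm \<epsilon> * real A / a" "Re s0 > 0"
      using G geo0 by (simp_all add: s_def s0_def)
    have pos: "norm s > 0" "norm s0 > 0" using s(3) s0(3) by auto
    have ratio: "norm s / norm s0 \<le> d j / real A * (1 / a^2)"
    proof -
      have "norm s / norm s0 \<le> (norm \<epsilon> * d j / a) / (a * (norm \<epsilon> * real A))"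
        using s(2) s0(1) n\<epsilon> A0 a dj by (intro frac_le) auto
      also have "\<dots> = d j / real A * (1 / a^2)" using n\<epsilon> a by (simp add: power2_eq_square)
      finally show ?thesis .
    qed
    have ratio': "norm s0 / norm s \<le> real A / a^2 / d j"
    proof -
      have "norm s0 / norm s \<le> (norm \<epsilon> * real A / a) / (a * (norm \<epsilon> * d j))"
        using s(1) s0(2) n\<epsilon> A0 a dj by (intro frac_le) auto
      also have "\<dots> = real A / a^2 / d j" using n\<epsilon> a by (simp add: power2_eq_square)
      finally show ?thesis .
    qed
    have "ln (norm s) - ln (norm s0) \<le> ln (d j / real A * (1 / a^2))"
    proof -
      have "0 < d j / real A * (1 / a^2)" using dj A0 a by simp
      then have "ln (norm s / norm s0) \<le> ln (d j / real A * (1 / a^2))"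
        using ratio pos by (subst ln_le_cancel_iff) auto
      then show ?thesis using pos by (simp add: ln_div)
    qed
    also have "\<dots> = ln (d j / real A) + ln (1 / a^2)"
      using dj A0 a by (intro ln_mult_pos) auto
    also have "\<dots> \<le> d j / real A + ln (1 / a^2)"
      using dj A0 ln_bound[of "d j / real A"] by simp
    finally have up: "ln (norm s) - ln (norm s0) \<le> d j / real A + ln (1 / a^2)" .
    have "ln (norm s0) - ln (norm s) \<le> ln (real A / a^2 / d j)"
    proof -
      have "0 < real A / a^2 / d j" using dj A0 a by simp
      then have "ln (norm s0 / norm s) \<le> ln (real A / a^2 / d j)"
        using ratio' pos by (subst ln_le_cancel_iff) auto
      then show ?thesis using pos by (simp add: ln_div)
    qed
    also have "\<dots> \<le> ln (1 / a^2)"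
      using dj A0 a by (subst ln_le_cancel_iff) (auto simp: field_simps)
    also have "\<dots> \<le> d j / real A + ln (1 / a^2)" using dj A0 by simp
    finally have lnb: "\<bar>ln (norm s) - ln (norm s0)\<bar> \<le> d j / real A + ln (1 / a^2)" using up by linarith
    have LL: "norm (Ln s - Ln s0) \<le> d j / real A + ln (1 / a^2) + pi"
    proof -
      have "\<bar>Im (Ln s - Ln s0)\<bar> \<le> pi"
        using Re_Ln_pos_lt_imp[OF s(3)] Re_Ln_pos_lt_imp[OF s0(3)] by simp
      moreover have "Re (Ln s - Ln s0) = ln (norm s) - ln (norm s0)"
        using pos by (simp add: Re_Ln)
      ultimately show ?thesis using cmod_le[of "Ln s - Ln s0"] lnb by linarith
    qed
    have "e - of_nat (A + j) = (W e - W e0 - of_nat j) + (e0 - of_nat A) - q * (Ln s - Ln s0)"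
      by (simp add: W_def s_def s0_def algebra_simps)
    then have "norm (e - of_nat (A + j)) \<le> norm (W e - W e0 - of_nat j) + norm (e0 - of_nat A) + norm (q * (Ln s - Ln s0))"
      by (simp only: order_trans[OF norm_triangle_ineq4 add_right_mono[OF norm_triangle_ineq]])
    also have "\<dots> \<le> 1 + 1/2 + norm q * (d j / real A + ln (1 / a^2) + pi)"
      using IW KBS[OF j] start(2) LL by (intro add_mono) (auto simp: norm_mult intro: mult_left_mono)
    also have "\<dots> = (3/2 + norm q * (ln (1 / a^2) + pi)) + norm q * (d j / real A)"
      by (simp add: algebra_simps)
    also have "\<dots> \<le> d j / 16 + d j / 16"
    proof (rule add_mono)
      show "3/2 + norm q * (ln (1 / a^2) + pi) \<le> d j / 16" using A(2) dj by simp
      have "norm q * (d j / real A) = norm q / real A * d j" by simp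
      also have "\<dots> \<le> 1/16 * d j" using A(3) A0 dj by (intro mult_right_mono) (auto simp: field_simps)
      finally show "norm q * (d j / real A) \<le> d j / 16" by simp
    qed
    finally have 1: "norm (e - of_nat (A + j)) \<le> d j / 8" by simp
    have 2: "norm (fst (X j)) \<le> 1 / (a * d j)" using G by blast
    have 3: "norm (snd (X j)) \<le> d j powr - \<sigma>"
    proof -
      have "norm (snd (X j)) * norm s powr \<rho> \<le> norm (snd z) * norm s0 powr \<rho> * exp 1"
      proof -
        have "exp (K * B * S j) \<le> exp 1" using KBS[OF j] by simp
        then have "norm (snd z) * norm s0 powr \<rho> * exp (K * B * S j) \<le> norm (snd z) * norm s0 powr \<rho> * exp 1"
          by (intro mult_left_mono) auto
        then show ?thesis using IY by (simp add: s_def s0_def)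
      qed
      then have "norm (snd (X j)) \<le> norm (snd z) * norm s0 powr \<rho> * exp 1 / norm s powr \<rho>"
        using pos by (simp add: pos_le_divide_eq)
      also have "\<dots> = norm (snd z) * exp 1 * (norm s0 / norm s) powr \<rho>"
        using pos by (simp add: powr_divide)
      also have "\<dots> \<le> norm (snd z) * exp 1 * (real A / a^2 / d j) powr \<rho>"
        using ratio' pos \<rho> by (intro mult_left_mono powr_mono2) auto
      also have "\<dots> = norm (snd z) * exp 1 * (real A / a^2) powr \<rho> * d j powr - \<rho>"
        using dj A0 a by (simp add: powr_divide powr_minus_divide powr_mult)
      also have "\<dots> \<le> 1 * d j powr - \<rho>" using y0 by (intro mult_right_mono) auto
      also have "\<dots> \<le> d j powr - \<sigma>" using dj \<sigma>1 by (simp add: powr_mono)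
      finally show ?thesis .
    qed
    have d2: "1 / d j ^ 2 \<le> d j powr - \<sigma>"
    proof -
      have "d j powr - 2 \<le> d j powr - \<sigma>" using dj \<sigma>1 by (intro powr_mono) auto
      then show ?thesis using dj by (simp add: powr_minus_divide)
    qed
    have "norm (fst (X j)) ^ 2 \<le> (1 / (a * d j))^2" by (rule power_mono[OF 2]) simp
    also have "\<dots> = 1 / a^2 * (1 / d j ^ 2)" by (simp add: power_divide power_mult_distrib)
    finally have x2: "norm (fst (X j)) ^ 2 \<le> 1 / a^2 * (1 / d j ^ 2)" .
    have "norm \<epsilon> ^ 2 \<le> (4 / d j)^2" using G by (intro power_mono) auto
    also have "\<dots> = 16 * (1 / d j ^ 2)" by (simp add: power_divide)
    finally have \<epsilon>2: "norm \<epsilon> ^ 2 \<le> 16 * (1 / d j ^ 2)" .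
    have "1 / a^2 * (1 / d j ^ 2) \<le> 1 / a^2 * d j powr - \<sigma>"
      using d2 by (rule mult_left_mono) simp
    then have 4: "norm (fst (X j)) ^ 2 + norm (snd (X j)) + norm \<epsilon> ^ 2 \<le> B * d j powr - \<sigma>"
      using x2 \<epsilon>2 3 d2 unfolding B distrib_right by linarith
    show ?thesis using 1 2 3 4 s(3) unfolding s_def by blast
  qed
  have "\<exists>e. inv j e" if "j \<le> N" for j
    using that
  proof (induction j)
    case 0
    have "inv 0 e0" unfolding inv_def using start(1) e0 by (simp add: X_def S_def)
    then show ?case ..
  next
    case (Suc j)
    then obtain e where I: "inv j e" by auto
    have jN: "j \<le> N" using Suc.prems by simp
    note st = strong[OF I jN]
    define Z where "Z = norm (fst (X j)) ^ 2 + norm (snd (X j)) + norm \<epsilon> ^ 2"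
    have Zb: "Z \<le> B * d j powr - \<sigma>" using st by (simp add: Z_def)
    also have "\<dots> \<le> B * T" using dT[OF jN] B0 by (intro mult_left_mono) auto
    finally have Zr: "Z < r1" using T(2) by simp
    have eq: "fst (X j) * sin (\<epsilon> * e) = - \<epsilon> * cos (\<epsilon> * e)" using I unfolding inv_def by blast
    obtain e' where e': "fst (F \<epsilon> (fst (X j), snd (X j))) * sin (\<epsilon> * e') = - \<epsilon> * cos (\<epsilon> * e')"
      "norm (e' - e - 1) \<le> 1/2"
      "Re (sin (\<epsilon> * e)) > 0 \<longrightarrow> Re (sin (\<epsilon> * e')) > 0 \<longrightarrow>
            norm ((e' + q * Ln (sin (\<epsilon> * e'))) - (e + q * Ln (sin (\<epsilon> * e))) - 1) \<le> K * Z"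
      "norm (snd (F \<epsilon> (fst (X j), snd (X j)))) * norm (sin (\<epsilon> * e')) powr \<rho>
           \<le> norm (snd (X j)) * norm (sin (\<epsilon> * e)) powr \<rho> * exp (K * Z)"
      using step[unfolded nearly_invariant_def, rule_format, OF \<epsilon>0 Z_def Zr eq] by blast
    have XS: "F \<epsilon> (fst (X j), snd (X j)) = X (Suc j)" by (simp add: X_def)
    have KZ: "K * Z \<le> K * B * d j powr - \<sigma>" using mult_left_mono[OF Zb, of K] K by simp
    have SS: "K * B * S (Suc j) = K * B * S j + K * B * d j powr - \<sigma>"
      by (simp add: S_def algebra_simps)
    have "e' - of_nat (A + Suc j) = (e' - e - 1) + (e - of_nat (A + j))" by simp
    also have "norm \<dots> \<le> 1/2 + d j / 8" using e'(2) st by (intro norm_triangle_mono) auto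
    also have "\<dots> \<le> d (Suc j) / 4" using d_Suc[of j] d_ge[OF Suc.prems] A0 by simp
    finally have 1: "norm (e' - of_nat (A + Suc j)) \<le> d (Suc j) / 4" .
    have 0: "fst (X (Suc j)) * sin (\<epsilon> * e') = - \<epsilon> * cos (\<epsilon> * e')" using e'(1) by (simp only: XS)
    have "Re (sin (\<epsilon> * e')) > 0" using geo[OF Suc.prems 1 0] by blast
    then have "norm (W e' - W e - 1) \<le> K * Z" using e'(3) st unfolding W_def by blast
    then have "norm ((W e - W e0 - of_nat j) + (W e' - W e - 1)) \<le> K * B * S j + K * B * d j powr - \<sigma>"
      using I KZ unfolding inv_def by (intro norm_triangle_mono) auto
    then have 2: "norm (W e' - W e0 - of_nat (Suc j)) \<le> K * B * S (Suc j)"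
      unfolding SS by (simp add: algebra_simps)
    have "norm (snd (X (Suc j))) * norm (sin (\<epsilon> * e')) powr \<rho>
        \<le> norm (snd (X j)) * norm (sin (\<epsilon> * e)) powr \<rho> * exp (K * Z)"
      using e'(4) by (simp only: XS)
    also have "\<dots> \<le> norm (snd z) * norm (sin (\<epsilon> * e0)) powr \<rho> * exp (K * B * S j) * exp (K * B * d j powr - \<sigma>)"
    proof (rule mult_mono)
      show "norm (snd (X j)) * norm (sin (\<epsilon> * e)) powr \<rho>
          \<le> norm (snd z) * norm (sin (\<epsilon> * e0)) powr \<rho> * exp (K * B * S j)"
        using I unfolding inv_def by blast
      show "exp (K * Z) \<le> exp (K * B * d j powr - \<sigma>)" using KZ by simp
    qed auto
    also have "\<dots> = norm (snd z) * norm (sin (\<epsilon> * e0)) powr \<rho> * exp (K * B * S (Suc j))"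
      unfolding SS exp_add by simp
    finally have "inv (Suc j) e'" unfolding inv_def using 0 1 2 by blast
    then show ?case ..
  qed
  then obtain e where "inv j e" using j by (auto simp: N_def)
  then show ?thesis
    using strong[of j e] j unfolding inv_def X_def N_def by blast
qed

definition gate_param :: "nat \<Rightarrow> complex \<Rightarrow> complex" where
  "gate_param k t = of_real pi / (of_nat k - t)"

lemma gate_param_bounds:
  assumes k: "k > 0" and t: "norm t \<le> real k / 20"
  shows "of_nat k - t \<noteq> 0" "gate_param k t \<noteq> 0" "norm (gate_param k t) \<le> 4 / real k"
proof -
  have nk: "norm (of_nat k - t) \<ge> 19/20 * real k"
    using norm_triangle_ineq2[of "of_nat k" t] t k by simp
  show kt: "of_nat k - t \<noteq> 0" using nk k by auto
  then show "gate_param k t \<noteq> 0" by (simp add: gate_param_def)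
  have "norm (gate_param k t) = pi / norm (of_nat k - t)" by (simp add: gate_param_def norm_divide)
  also have "\<dots> \<le> pi / (19/20 * real k)"
    using nk k kt by (intro divide_left_mono mult_pos_pos) auto
  also have "\<dots> = (pi * (20/19)) / real k" by simp
  also have "\<dots> \<le> 4 / real k" using pi_approx k by (intro divide_right_mono) auto
  finally show "norm (gate_param k t) \<le> 4 / real k" .
qed

text \<open>For small \<open>\<epsilon>\<close> the coordinate of \<open>x0\<close> is close to \<open>- 1 / x0\<close>, as \<open>cot z\<close> is close to \<open>1 / z\<close>.\<close>

lemma gate_entrance:
  fixes x0 \<epsilon> :: complex and A :: nat
  assumes A0: "real A \<ge> 8" and x0p: "norm (x0 + 1 / of_nat A) \<le> 1 / (8 * real A ^ 2)"
    and \<epsilon>0: "\<epsilon> \<noteq> 0" and \<epsilon>A: "norm \<epsilon> * (8 * real A ^ 2) \<le> 1"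
  obtains e0 where "x0 * sin (\<epsilon> * e0) = - \<epsilon> * cos (\<epsilon> * e0)" "norm (e0 - of_nat A) \<le> 1/2"
proof -
  have "1 / (8 * real A ^ 2) \<le> 1 / (2 * real A)"
    using A0 by (intro divide_left_mono) (auto simp: power2_eq_square)
  moreover have "norm (1 / of_nat A :: complex) = 1 / real A" by (simp add: norm_divide)
  ultimately have x0low: "norm x0 \<ge> 1 / (2 * real A)"
    using norm_triangle_ineq4[of "x0 + 1 / of_nat A" x0] x0p by (simp add: field_simps)
  have "0 < 1 / (2 * real A)" using A0 by simp
  then have x00: "norm x0 > 0" using x0low by linarith
  have inv_x0: "norm (1 / x0) \<le> 2 * real A"
    using x0low x00 A0 by (simp add: norm_divide field_simps)
  define \<tau>0 where "\<tau>0 = - \<epsilon> / x0"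
  have \<tau>0: "norm \<tau>0 \<le> norm \<epsilon> * (2 * real A)"
    using mult_left_mono[OF inv_x0, of "norm \<epsilon>"] by (simp add: \<tau>0_def norm_divide)
  have AA: "real A \<le> real A ^ 2" using A0 by (simp add: power2_eq_square)
  have "norm \<epsilon> * (2 * real A) \<le> norm \<epsilon> * (2 * real A ^ 2)"
    using AA by (intro mult_left_mono) auto
  then have \<tau>4: "norm \<tau>0 \<le> 1/4" using \<tau>0 \<epsilon>A by linarith
  define b where "b = Arctan \<tau>0"
  have b1: "norm (b - \<tau>0) \<le> 2 * norm \<tau>0 ^ 3" using Arctan_approx \<tau>4 by (simp add: b_def)
  define e0 where "e0 = b / \<epsilon>"
  have \<epsilon>e0: "\<epsilon> * e0 = b" using \<epsilon>0 by (simp add: e0_def)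
  have sinb: "sin b = \<tau>0 * cos b" unfolding b_def using \<tau>4 by (intro sin_Arctan_eq) simp
  have start1: "x0 * sin (\<epsilon> * e0) = - \<epsilon> * cos (\<epsilon> * e0)"
    using x00 unfolding \<epsilon>e0 sinb by (simp add: \<tau>0_def)
  have start2: "norm (e0 - of_nat A) \<le> 1/2"
  proof -
    have "norm (e0 - (- 1 / x0)) = norm (b - \<tau>0) / norm \<epsilon>"
      using \<epsilon>0 by (simp add: e0_def \<tau>0_def add_divide_distrib flip: norm_divide)
    also have "\<dots> \<le> (2 * (norm \<epsilon> * (2 * real A)) ^ 3) / norm \<epsilon>"
      using b1 power_mono[OF \<tau>0 norm_ge_zero, of 3] by (intro divide_right_mono norm_ge_zero) linarith
    also have "\<dots> = 16 * real A ^ 3 * norm \<epsilon> ^ 2"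
      using \<epsilon>0 by (simp add: power3_eq_cube power2_eq_square)
    also have "\<dots> \<le> 1/4"
    proof -
      have "(norm \<epsilon> * (8 * real A ^ 2))^2 \<le> 1^2" by (rule power_mono[OF \<epsilon>A]) simp
      then have "64 * (real A ^ 2 * real A ^ 2 * norm \<epsilon> ^ 2) \<le> 1"
        by (simp add: power_mult_distrib power2_eq_square mult_ac)
      moreover have "real A ^ 3 * norm \<epsilon> ^ 2 \<le> real A ^ 2 * real A ^ 2 * norm \<epsilon> ^ 2"
        using A0 by (intro mult_right_mono) (auto simp: power2_eq_square power3_eq_cube)
      ultimately show ?thesis by simp
    qed
    finally have 1: "norm (e0 - (- 1 / x0)) \<le> 1/4" .
    have "- 1 / x0 - of_nat A = - ((of_nat A / x0) * (x0 + 1 / of_nat A))"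
      using x00 A0 by (simp add: field_simps)
    then have "norm (- 1 / x0 - of_nat A) = real A * norm (1 / x0) * norm (x0 + 1 / of_nat A)"
      by (simp add: norm_mult norm_divide)
    also have "\<dots> \<le> real A * (2 * real A) * (1 / (8 * real A ^ 2))"
      using inv_x0 x0p by (intro mult_mono) auto
    also have "\<dots> = 1/4" using A0 by (simp add: power2_eq_square)
    finally have 2: "norm (- 1 / x0 - of_nat A) \<le> 1/4" .
    show ?thesis using norm_triangle_mono[OF 1 2] by simp
  qed
  show ?thesis using that[OF start1 start2] .
qed

lemma gate_exit:
  obtains \<kappa> :: real where "\<kappa> > 0"
    "\<And>\<epsilon> f x :: complex. \<epsilon> \<noteq> 0 \<Longrightarrow> norm (\<epsilon> * f) < \<kappa> \<Longrightarrow> x * sin (\<epsilon> * f) = \<epsilon> * cos (\<epsilon> * f) \<Longrightarrow>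
       x \<noteq> 0 \<and> norm (1 / x - f) \<le> 1/64 * norm f"
proof -
  have "(tan has_derivative (*) 1) (at (0::complex))"
    using DERIV_tan[of "0::complex"] by (simp add: has_field_derivative_def)
  then have "\<forall>e>0. \<exists>d>0. \<forall>y. norm (y - 0) < d \<longrightarrow> norm (tan y - tan (0::complex) - 1 * (y - 0)) \<le> e * norm (y - 0)"
    unfolding has_derivative_at_alt by blast
  then obtain d0 where d0: "d0 > 0" "\<And>y::complex. norm y < d0 \<Longrightarrow> norm (tan y - y) \<le> 1/64 * norm y"
    by (metis (no_types) diff_zero divide_pos_pos mult_1 tan_zero zero_less_numeral zero_less_one)
  define \<kappa> where "\<kappa> = min d0 (1/2)"
  have \<kappa>: "\<kappa> > 0" using d0(1) by (simp add: \<kappa>_def)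
  have cos0: "cos z \<noteq> 0" if "norm z < \<kappa>" for z :: complex
  proof
    assume "cos z = 0"
    then have "1 \<le> 3 * norm z ^ 2" using cos_approx[of z] that by (simp add: \<kappa>_def)
    moreover have "norm z ^ 2 \<le> (1/2)^2" using that by (intro power_mono) (auto simp: \<kappa>_def)
    ultimately show False by (simp add: power2_eq_square)
  qed
  show thesis
  proof (rule that[OF \<kappa>])
    fix \<epsilon> f x :: complex
    assume \<epsilon>0: "\<epsilon> \<noteq> 0" and \<epsilon>f: "norm (\<epsilon> * f) < \<kappa>" and eq: "x * sin (\<epsilon> * f) = \<epsilon> * cos (\<epsilon> * f)"
    note c0 = cos0[OF \<epsilon>f]
    have x0: "x \<noteq> 0" using eq c0 \<epsilon>0 by auto
    have "1 / x = tan (\<epsilon> * f) / \<epsilon>"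
      using eq x0 c0 \<epsilon>0 by (simp add: tan_def field_simps)
    then have "1 / x - f = (tan (\<epsilon> * f) - \<epsilon> * f) / \<epsilon>" using \<epsilon>0 by (simp add: diff_divide_distrib)
    then have "norm (1 / x - f) = norm (tan (\<epsilon> * f) - \<epsilon> * f) / norm \<epsilon>" by (simp add: norm_divide)
    also have "\<dots> \<le> (1/64 * norm (\<epsilon> * f)) / norm \<epsilon>"
      using d0(2)[of "\<epsilon> * f"] \<epsilon>f by (intro divide_right_mono) (auto simp: \<kappa>_def)
    also have "\<dots> = 1/64 * norm f" using \<epsilon>0 by (simp add: norm_mult)
    finally show "x \<noteq> 0 \<and> norm (1 / x - f) \<le> 1/64 * norm f" using x0 by blast
  qed
qed

text \<open>
  The whole passage. The starting point \<open>p = (-1/A, 0)\<close> and the radius \<open>c\<close> do not depend on the exit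
  depth \<open>M\<close>. The parameter \<open>t\<close> is the phase. Over the disc of radius \<open>M / 4\<close> the quantity \<open>M - t\<close> varies
  by more than the error \<open>3 M / 16\<close> on either side, so the exit position does depend on \<open>t\<close>.
\<close>

lemma gate_passage:
  fixes F :: map_family
  assumes gf: "gate_form F \<rho> q C r" and \<rho>: "\<rho> > 1"
  obtains A :: nat and p :: "complex \<times> complex" and c :: real where "c > 0"
    "\<And>M. M \<ge> A \<Longrightarrow> \<exists>k0. \<forall>k\<ge>k0. \<forall>t. norm t \<le> real M / 4 \<longrightarrow>
       (\<forall>z\<in>ball p c. \<forall>j\<le>k - A - M. norm ((F (gate_param k t) ^^ j) z) \<le> 1) \<and>
       fst ((F (gate_param k t) ^^ (k - A - M)) p) \<noteq> 0 \<and>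
       norm (1 / fst ((F (gate_param k t) ^^ (k - A - M)) p) - (of_nat M - t)) \<le> 3/16 * real M"
proof (rule nearly_invariant_step[OF gf])
  show "\<rho> > 0" using \<rho> by simp
  fix K r1
  assume K: "K > 0" and r1: "r1 > 0" and step: "nearly_invariant F q \<rho> K r1"
  show thesis
  proof (rule gate_geometry)
    fix a :: real
    assume a: "0 < a" "a \<le> 1" and geom: "gate_bounds a"
    define \<sigma> where "\<sigma> = min \<rho> 2"
    define B where "B = 1 / a^2 + 17"
    have \<sigma>1: "\<sigma> > 1" using \<rho> by (simp add: \<sigma>_def)
    have B0: "B > 0" using a by (simp add: B_def add_nonneg_pos)
    have summ: "summable (\<lambda>m. real m powr - \<sigma>)"
      using \<sigma>1 by (simp add: summable_real_powr_iff)
    define \<tau> where "\<tau> = min (1 / (2 * K * B)) (r1 / B)"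
    have \<tau>: "\<tau> > 0" using K B0 r1 by (simp add: \<tau>_def)
    obtain N0 where N0: "\<forall>n\<ge>N0. norm (\<Sum>i. real (i + n) powr - \<sigma>) < \<tau>"
      using suminf_exist_split[OF \<tau> summ] by blast
    \<comment> \<open>\<open>N0\<close> makes the errors along any orbit add up to at most one, and \<open>L\<close> makes the
      logarithmic drift a small fraction of \<open>d j\<close>\<close>
    define L where "L = max (16 * (3/2 + norm q * (ln (1 / a^2) + pi))) (max (16 * norm q) (2 / a))"
    obtain A1 :: nat where A1: "L \<le> real A1" using real_arch_simple by blast
    define A where "A = max N0 (max A1 8)"
    have A: "A \<ge> 8" "16 * (3/2 + norm q * (ln (1 / a^2) + pi)) \<le> real A" "16 * norm q \<le> real A" "2 / a \<le> real A"
    proof -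
      show "A \<ge> 8" by (simp add: A_def)
      have "L \<le> real A" using A1 by (simp add: A_def of_nat_max le_max_iff_disj)
      then show "16 * (3/2 + norm q * (ln (1 / a^2) + pi)) \<le> real A" "16 * norm q \<le> real A" "2 / a \<le> real A"
        by (simp_all add: L_def)
    qed
    have A0: "real A \<ge> 8" using A(1) by simp
    define T where "T = (\<Sum>i. real (i + A) powr - \<sigma>)"
    have tail: "(\<Sum>m\<in>J. real (m + A) powr - \<sigma>) \<le> T" if "finite J" for J
      unfolding T_def using summ that by (intro sum_le_suminf summable_ignore_initial_segment) auto
    have "T < \<tau>" using N0 unfolding T_def A_def by (simp add: abs_less_iff)
    then have T1: "T < 1 / (2 * K * B)" and T2: "T < r1 / B" by (simp_all add: \<tau>_def)
    have T: "2 * (K * B * T) \<le> 1" "B * T < r1"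
      using T1 T2 K B0 by (simp_all add: field_simps)
    define Y where "Y = exp 1 * (real A / a^2) powr \<rho>"
    have Y: "Y > 0" using A0 a by (simp add: Y_def)
    define c where "c = min (1 / (8 * real A ^ 2)) (1 / Y)"
    have c: "c > 0" "c \<le> 1 / (8 * real A ^ 2)" "c \<le> 1 / Y" using A0 Y by (simp_all add: c_def)
    define p where "p = (- 1 / of_nat A :: complex, 0 :: complex)"
    obtain \<kappa> where \<kappa>: "\<kappa> > 0" and
      cot: "\<And>\<epsilon> f x :: complex. \<epsilon> \<noteq> 0 \<Longrightarrow> norm (\<epsilon> * f) < \<kappa> \<Longrightarrow> x * sin (\<epsilon> * f) = \<epsilon> * cos (\<epsilon> * f) \<Longrightarrow>
         x \<noteq> 0 \<and> norm (1 / x - f) \<le> 1/64 * norm f"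
      by (rule gate_exit) (rule that, assumption, blast)
    show thesis
    proof (rule that[of c A p])
      show "c > 0" by (rule c(1))
      fix M :: nat assume M: "M \<ge> A"
      obtain k0 :: nat where k0: "max (20 * real M) (max (32 * real A ^ 2) (6 * real M / \<kappa> + 1)) \<le> real k0"
        using real_arch_simple by blast
      have main: "(\<forall>z\<in>ball p c. \<forall>j\<le>k - A - M. norm ((F (gate_param k t) ^^ j) z) \<le> 1) \<and>
       fst ((F (gate_param k t) ^^ (k - A - M)) p) \<noteq> 0 \<and>
       norm (1 / fst ((F (gate_param k t) ^^ (k - A - M)) p) - (of_nat M - t)) \<le> 3/16 * real M"
        if kk: "k \<ge> k0" and t: "norm t \<le> real M / 4" for k t
      proof -
        have "real k0 \<le> real k" using kk by simp
        then have k: "20 * real M \<le> real k" "32 * real A ^ 2 \<le> real k" "6 * real M / \<kappa> < real k"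
          using k0 by simp_all
        have kM: "20 * M \<le> k" using k(1) by linarith
        have M8: "real M \<ge> 8" using M A by simp
        define \<epsilon> where "\<epsilon> = gate_param k t"
        have \<epsilon>_eq: "\<epsilon> = of_real pi / (of_nat k - t)" by (simp add: \<epsilon>_def gate_param_def)
        have k00: "k > 0" "real k > 0" using k(1) M8 by simp_all
        have tk: "norm t \<le> real k / 20" using t k(1) by linarith
        note par = gate_param_bounds[OF k00(1) tk, folded \<epsilon>_def]
        note kt = par(1) and \<epsilon>0 = par(2) and n\<epsilon> = par(3)
        have orbit: "\<exists>e. fst ((F \<epsilon> ^^ j) z) * sin (\<epsilon> * e) = - \<epsilon> * cos (\<epsilon> * e) \<and>
            norm (e - of_nat (A + j)) \<le> min (real (A + j)) (real k - real (A + j)) / 8 \<and>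
            norm (fst ((F \<epsilon> ^^ j) z)) \<le> 1 / (a * min (real (A + j)) (real k - real (A + j))) \<and>
            norm (snd ((F \<epsilon> ^^ j) z)) \<le> min (real (A + j)) (real k - real (A + j)) powr - \<sigma>"
          if z: "z \<in> ball p c" and j: "j \<le> k - A - M" for z j
        proof -
          have nz: "norm (z - p) < c" using z by (simp add: dist_norm norm_minus_commute)
          have x0p: "norm (fst z + 1 / of_nat A) < c"
            using norm_fst_le_norm[of "z - p"] nz by (simp add: p_def)
          have y0c: "norm (snd z) < c"
            using norm_snd_le_norm[of "z - p"] nz by (simp add: p_def)
          have \<epsilon>A: "norm \<epsilon> * (8 * real A ^ 2) \<le> 1"
          proof -
            have "norm \<epsilon> * (8 * real A ^ 2) \<le> 4 / real k * (8 * real A ^ 2)"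
              by (rule mult_right_mono[OF n\<epsilon>]) simp
            also have "\<dots> = (32 * real A ^ 2) / real k" by simp
            also have "\<dots> \<le> 1" using k(2) k00 by simp
            finally show ?thesis .
          qed
          obtain e0 where start1: "fst z * sin (\<epsilon> * e0) = - \<epsilon> * cos (\<epsilon> * e0)"
            and start2: "norm (e0 - of_nat A) \<le> 1/2"
            by (rule gate_entrance[OF A0 order_trans[OF less_imp_le[OF x0p] c(2)] \<epsilon>0 \<epsilon>A])
          have "norm (snd z) * Y \<le> 1"
          proof -
            have "norm (snd z) * Y \<le> 1 / Y * Y" using y0c c(3) Y by (intro mult_right_mono) auto
            then show ?thesis using Y by simp
          qed
          then have y0: "norm (snd z) * exp 1 * (real A / a^2) powr \<rho> \<le> 1" by (simp add: Y_def mult.assoc)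
          show ?thesis
            by (rule gate_orbit[OF K step a geom \<rho> \<sigma>_def B_def tail T A(1-3) M kM t \<epsilon>_eq start1 start2 y0 j])
        qed
        have bounded: "norm ((F \<epsilon> ^^ j) z) \<le> 1" if z: "z \<in> ball p c" and j: "j \<le> k - A - M" for z j
        proof -
          define d where "d = min (real (A + j)) (real k - real (A + j))"
          have dA: "d \<ge> real A" using j M kM by (simp add: d_def)
          have b: "norm (fst ((F \<epsilon> ^^ j) z)) \<le> 1 / (a * d)" "norm (snd ((F \<epsilon> ^^ j) z)) \<le> d powr - \<sigma>"
            using orbit[OF z j] unfolding d_def by blast+
          have "2 \<le> a * real A" using A(4) a by (simp add: field_simps)
          also have "\<dots> \<le> a * d" using dA a by (intro mult_left_mono) auto
          finally have "1 / (a * d) \<le> 1/2" by (simp add: field_simps)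
          moreover have "d powr - \<sigma> \<le> 1/2"
          proof -
            have "d powr - \<sigma> \<le> d powr - 1" using dA A0 \<sigma>1 by (intro powr_mono) auto
            also have "\<dots> = 1 / d" using dA A0 by (simp add: powr_minus_divide)
            also have "\<dots> \<le> 1/2" using dA A0 by (simp add: field_simps)
            finally show ?thesis .
          qed
          ultimately have "norm (fst ((F \<epsilon> ^^ j) z)) + norm (snd ((F \<epsilon> ^^ j) z)) \<le> 1"
            using b by linarith
          then show ?thesis using norm_Pair_le[of "fst ((F \<epsilon> ^^ j) z)" "snd ((F \<epsilon> ^^ j) z)"] by simp
        qed
        have exit: "fst ((F \<epsilon> ^^ (k - A - M)) p) \<noteq> 0 \<and>
          norm (1 / fst ((F \<epsilon> ^^ (k - A - M)) p) - (of_nat M - t)) \<le> 3/16 * real M"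
        proof -
          define x where "x = fst ((F \<epsilon> ^^ (k - A - M)) p)"
          have AN: "A + (k - A - M) = k - M" using kM M by simp
          have dN: "min (real (k - M)) (real k - real (k - M)) = real M" using kM by simp
          have "p \<in> ball p c" using c(1) by simp
          from orbit[OF this order_refl, unfolded AN dN]
          obtain e where e: "x * sin (\<epsilon> * e) = - \<epsilon> * cos (\<epsilon> * e)" "norm (e - of_nat (k - M)) \<le> real M / 8"
            unfolding x_def by blast
          define f where "f = (of_nat k - t) - e"
          have "\<epsilon> * f = of_real pi - \<epsilon> * e" using kt by (simp add: f_def \<epsilon>_eq field_simps)
          then have sc: "sin (\<epsilon> * f) = sin (\<epsilon> * e)" "cos (\<epsilon> * f) = - cos (\<epsilon> * e)"
            by (simp_all add: sin_diff cos_diff flip: sin_of_real cos_of_real)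
          have kM': "of_nat (k - M) = (of_nat k - of_nat M :: complex)" using kM by (simp add: of_nat_diff)
          have fM: "norm (f - (of_nat M - t)) \<le> real M / 8"
          proof -
            have "f - (of_nat M - t) = - (e - of_nat (k - M))" by (simp add: f_def kM')
            then show ?thesis using e(2) by (simp only: norm_minus_cancel)
          qed
          have nf: "norm f \<le> 3/2 * real M"
          proof -
            have "norm (of_nat M - t) \<le> real M + real M / 4"
              using norm_triangle_ineq4[of "of_nat M" t] t by simp
            then show ?thesis using norm_triangle_ineq[of "f - (of_nat M - t)" "of_nat M - t"] fM by simp
          qed
          have \<epsilon>f: "norm (\<epsilon> * f) < \<kappa>"
          proof -
            have "norm (\<epsilon> * f) \<le> 4 / real k * (3/2 * real M)"
              unfolding norm_mult using n\<epsilon> nf by (intro mult_mono) auto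
            also have "\<dots> = 6 * real M / real k" by simp
            also have "\<dots> < \<kappa>" using k(3) k00 \<kappa> by (simp add: field_simps)
            finally show ?thesis .
          qed
          have "x * sin (\<epsilon> * f) = \<epsilon> * cos (\<epsilon> * f)" using e(1) by (simp add: sc)
          from cot[OF \<epsilon>0 \<epsilon>f this] have x0: "x \<noteq> 0" and xf: "norm (1 / x - f) \<le> 3/128 * real M"
            using nf by simp_all
          have "norm ((1 / x - f) + (f - (of_nat M - t))) \<le> 3/128 * real M + real M / 8"
            using xf fM by (rule norm_triangle_mono)
          then have "norm (1 / x - (of_nat M - t)) \<le> 3/128 * real M + real M / 8"
            by (simp only: add_diff_eq diff_add_cancel)
          also have "\<dots> \<le> 3/16 * real M" by simp
          finally show ?thesis using x0 by (simp add: x_def)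
        qed
        show ?thesis using bounded exit unfolding \<epsilon>_def by blast
      qed
      then show "\<exists>k0. \<forall>k\<ge>k0. \<forall>t. norm t \<le> real M / 4 \<longrightarrow>
       (\<forall>z\<in>ball p c. \<forall>j\<le>k - A - M. norm ((F (gate_param k t) ^^ j) z) \<le> 1) \<and>
       fst ((F (gate_param k t) ^^ (k - A - M)) p) \<noteq> 0 \<and>
       norm (1 / fst ((F (gate_param k t) ^^ (k - A - M)) p) - (of_nat M - t)) \<le> 3/16 * real M" by blast
    qed
  qed
qed

section \<open>Discontinuity of the filled Julia set\<close>

text \<open>
  Nonemptiness of \<open>X\<close> matters: the value of \<open>infdist\<close> is \<open>0\<close> for the empty set. Boundedness makes the
  distances bounded above, without which their supremum would be an arbitrary value.
\<close>

lemma hausdorff_near_point: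
  fixes p :: "'a::metric_space"
  assumes "hausdorff_distance X Y < c" "p \<in> Y" "X \<noteq> {}" "bounded X" "bounded Y"
  obtains z where "z \<in> X" "dist p z < c"
proof -
  obtain x where x: "x \<in> X" using assms(3) by blast
  obtain b where b: "\<And>y. y \<in> Y \<Longrightarrow> dist x y \<le> b"
    using assms(5) unfolding bounded_any_center[of Y x] by blast
  have "bdd_above ((\<lambda>y. infdist y X) ` Y)"
  proof (rule bdd_aboveI2)
    fix y assume "y \<in> Y"
    then show "infdist y X \<le> b" using infdist_le[OF x, of y] b[of y] by (simp add: dist_commute)
  qed
  then have "infdist p X \<le> (SUP y\<in>Y. infdist y X)" using assms(2) by (intro cSUP_upper)
  also have "\<dots> \<le> hausdorff_distance X Y" by (simp add: hausdorff_distance_def)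
  finally have "(INF z\<in>X. dist p z) < c" using assms(1,3) by (simp add: infdist_notempty)
  then obtain z where "z \<in> X" "dist p z < c"
    using assms(3) by (subst (asm) cINF_less_iff) auto
  then show ?thesis using that by blast
qed

text \<open>
  If \<open>K\<close> were continuous at \<open>0\<close>, points of \<open>K(F\<^sub>\<epsilon>)\<close> would accumulate at \<open>p\<close>, and the
  passage maps, being uniformly Lipschitz at \<open>p\<close>, would keep the orbit of \<open>p\<close> itself within
  bounded distance of \<open>K(F\<^sub>\<epsilon>)\<close>, for all phases \<open>t\<close> in an arbitrarily large disc. The exit position is
  then a bounded holomorphic function of \<open>t\<close> on large discs, hence nearly constant, as in Liouville's
  theorem. But it is close to \<open>1 / (M - t)\<close>.
\<close>

lemma filled_Julia_discontinuous:
  fixes F :: map_family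
  assumes gf: "gate_form F \<rho> q C r" and \<rho>: "\<rho> > 1"
    and hol: "holo_on (\<lambda>(\<epsilon>, z). F \<epsilon> z) (D \<times> UNIV)"
    and \<delta>: "\<delta> > 0" "ball 0 \<delta> \<subseteq> D" and R: "R \<ge> 1"
    and esc: "\<And>\<epsilon> z. norm \<epsilon> < \<delta> \<Longrightarrow> norm z \<ge> R \<Longrightarrow> norm (F \<epsilon> z) \<ge> 2 * norm z"
  shows "\<not> hausdorff_continuous_at (\<lambda>\<epsilon>. filled_Julia (F \<epsilon>)) 0"
proof
  assume cont: "hausdorff_continuous_at (\<lambda>\<epsilon>. filled_Julia (F \<epsilon>)) 0"
  note r = gate_form_pos(2)[OF gf]
  have KR: "norm ((F \<epsilon> ^^ n) z) < R" if "norm \<epsilon> < \<delta>" "z \<in> filled_Julia (F \<epsilon>)" for \<epsilon> z n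
    using that by (intro filled_Julia_iterate_bound[OF esc R]) auto
  have Kbd: "bounded (filled_Julia (F \<epsilon>))" if "norm \<epsilon> < \<delta>" for \<epsilon>
    unfolding bounded_iff using KR[OF that, of _ 0] by (intro exI[of _ R]) (auto intro: less_imp_le)
  have contn: "continuous_on (D \<times> UNIV) (\<lambda>p. (F (fst p) ^^ n) (snd p))" for n
    using continuous_on_iterate[OF hol, of n] by (simp add: case_prod_unfold)
  have holn: "holo_on (\<lambda>p. (F (fst p) ^^ n) (snd p)) (D \<times> UNIV)" for n
    using holo_on_iterate[OF hol, of n] by (simp add: case_prod_unfold)
  have D0: "0 \<in> D" using \<delta> by auto
  show False
  proof (rule gate_passage[OF gf \<rho>])
    fix A :: nat and p :: "complex \<times> complex" and c :: real
    assume c: "c > 0" and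
      passage: "\<And>M. M \<ge> A \<Longrightarrow> \<exists>k0. \<forall>k\<ge>k0. \<forall>t. norm t \<le> real M / 4 \<longrightarrow>
       (\<forall>z\<in>ball p c. \<forall>j\<le>k - A - M. norm ((F (gate_param k t) ^^ j) z) \<le> 1) \<and>
       fst ((F (gate_param k t) ^^ (k - A - M)) p) \<noteq> 0 \<and>
       norm (1 / fst ((F (gate_param k t) ^^ (k - A - M)) p) - (of_nat M - t)) \<le> 3/16 * real M"
    have bounded1: "\<exists>k0. \<forall>k\<ge>k0. \<forall>t. norm t \<le> real M / 4 \<longrightarrow>
        (\<forall>z\<in>ball p c. \<forall>j\<le>k - A - M. norm ((F (gate_param k t) ^^ j) z) \<le> 1)" if "M \<ge> A" for M
      using passage[OF that] by blast
    have pc: "p \<in> ball p c" using c by simp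
    \<comment> \<open>the starting point has a bounded orbit under the limit map\<close>
    have pK: "p \<in> filled_Julia (F 0)"
    proof -
      obtain k0 where k0: "\<forall>k\<ge>k0. \<forall>t. norm t \<le> real A / 4 \<longrightarrow>
          (\<forall>z\<in>ball p c. \<forall>j\<le>k - A - A. norm ((F (gate_param k t) ^^ j) z) \<le> 1)"
        using bounded1[of A] by blast
      have "norm ((F 0 ^^ j) p) \<le> 1" for j
      proof -
        have "(\<lambda>k. gate_param k 0) \<longlonglongrightarrow> 0"
          unfolding gate_param_def using tendsto_divide_0[OF tendsto_const tendsto_of_nat, of "complex_of_real pi"] by simp
        then have "((\<lambda>k. (gate_param k 0, p)) \<longlongrightarrow> (0, p)) sequentially" by (intro tendsto_intros)
        moreover have "isCont (\<lambda>p. (F (fst p) ^^ j) (snd p)) (0, p)"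
          by (rule holo_on_imp_isCont[OF holn]) (simp add: D0)
        ultimately have "(\<lambda>k. (F (gate_param k 0) ^^ j) p) \<longlonglongrightarrow> (F 0 ^^ j) p"
          using isCont_tendsto_compose[of "(0, p)" "\<lambda>p. (F (fst p) ^^ j) (snd p)" "\<lambda>k. (gate_param k 0, p)"] by simp
        then have "(\<lambda>k. norm ((F (gate_param k 0) ^^ j) p)) \<longlonglongrightarrow> norm ((F 0 ^^ j) p)" by (rule tendsto_norm)
        moreover have "\<forall>\<^sub>F k in sequentially. norm ((F (gate_param k 0) ^^ j) p) \<le> 1"
          using eventually_ge_at_top[of "max k0 (2 * A + j)"]
        proof eventually_elim
          case (elim k)
          then have "k \<ge> k0" "2 * A + j \<le> k" by simp_all
          then have "k \<ge> k0" "j \<le> k - A - A" by arith+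
          then show ?case using k0 pc by simp
        qed
        ultimately show ?thesis by (rule tendsto_upperbound) simp
      qed
      then show ?thesis unfolding filled_Julia_def bounded_iff by auto
    qed
    define M0 where "M0 = A + 1"
    have M0: "M0 \<ge> A" "real M0 > 0" by (simp_all add: M0_def)
    define h where "h k t = fst ((F (gate_param k t) ^^ (k - A - M0)) p)" for k t
    have h_bounded: "\<exists>k1. \<forall>k\<ge>k1. \<forall>t. norm t \<le> real M / 4 \<longrightarrow> norm (h k t) \<le> R + 1"
      if M: "M \<ge> M0" for M
    proof -
      define m where "m = M - M0"
      obtain k0 where k0: "\<forall>k\<ge>k0. \<forall>t. norm t \<le> real M / 4 \<longrightarrow>
          (\<forall>z\<in>ball p c. \<forall>j\<le>k - A - M. norm ((F (gate_param k t) ^^ j) z) \<le> 1)"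
        using bounded1[of M] M M0 by auto
      define Q where "Q = cball (0::complex) (\<delta> / 2) \<times> cball (0::complex \<times> complex) 1"
      have "Q \<subseteq> D \<times> UNIV" using \<delta> by (auto simp: Q_def)
      moreover have "compact Q" unfolding Q_def by (intro compact_Times compact_cball)
      ultimately have "uniformly_continuous_on Q (\<lambda>p. (F (fst p) ^^ m) (snd p))"
        by (intro compact_uniformly_continuous continuous_on_subset[OF contn])
      then obtain \<eta> where \<eta>: "\<eta> > 0" and
        uc: "\<And>x y. x \<in> Q \<Longrightarrow> y \<in> Q \<Longrightarrow> dist y x < \<eta> \<Longrightarrow>
            dist ((F (fst y) ^^ m) (snd y)) ((F (fst x) ^^ m) (snd x)) < 1"
        unfolding uniformly_continuous_on_def by (metis zero_less_one)
      define c' where "c' = min c (\<eta> * c / 8)"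
      have c': "c' > 0" "c' \<le> c" "c' \<le> \<eta> * c / 8" using c \<eta> by (simp_all add: c'_def)
      have "\<forall>\<^sub>F \<epsilon> in at 0. hausdorff_distance (filled_Julia (F \<epsilon>)) (filled_Julia (F 0)) < c'"
        using cont c'(1) unfolding hausdorff_continuous_at_def by (rule order_tendstoD(2))
      then obtain e where e: "e > 0" and
        hd: "\<And>\<epsilon>. \<epsilon> \<noteq> 0 \<Longrightarrow> norm \<epsilon> < e \<Longrightarrow> hausdorff_distance (filled_Julia (F \<epsilon>)) (filled_Julia (F 0)) < c'"
        unfolding eventually_at by auto
      define e' where "e' = min (min e r) (\<delta> / 2)"
      have e': "e' > 0" using e r \<delta> by (simp add: e'_def)
      obtain k2 :: nat where k2: "max (max (20 * real M) 1) (4 / e' + 1) \<le> real k2"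
        using real_arch_simple by blast
      have "norm (h k t) \<le> R + 1" if k: "k \<ge> max (max k0 k2) (A + M)" and t: "norm t \<le> real M / 4" for k t
      proof -
        have "real k2 \<le> real k" using k by simp
        then have kk: "20 * real M \<le> real k" "1 \<le> real k" "4 / e' < real k" using k2 by simp_all
        then have k00: "k > 0" and tk: "norm t \<le> real k / 20" using t by simp_all
        define \<epsilon> where "\<epsilon> = gate_param k t"
        have \<epsilon>0: "\<epsilon> \<noteq> 0" and "norm \<epsilon> \<le> 4 / real k" using gate_param_bounds[OF k00 tk] by (simp_all add: \<epsilon>_def)
        moreover have "4 / real k < e'" using kk(2,3) e' by (simp add: field_simps)
        ultimately have \<epsilon>: "norm \<epsilon> < e" "norm \<epsilon> < r" "norm \<epsilon> < \<delta> / 2" "norm \<epsilon> < \<delta>"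
          using \<delta> by (simp_all add: e'_def)
        have \<epsilon>D: "\<epsilon> \<in> D" using \<epsilon>(4) \<delta>(2) by auto
        define \<Lambda> where "\<Lambda> = F \<epsilon> ^^ (k - A - M)"
        have \<Lambda>1: "norm (\<Lambda> z) \<le> 1" if "z \<in> ball p c" for z
          using k0 k t that by (simp add: \<Lambda>_def \<epsilon>_def)
        obtain z where z: "z \<in> filled_Julia (F \<epsilon>)" "dist p z < c'"
        proof (rule hausdorff_near_point[OF hd[OF \<epsilon>0 \<epsilon>(1)] pK])
          show "filled_Julia (F \<epsilon>) \<noteq> {}" using gate_form_fixed_point[OF gf \<epsilon>(2)] by blast
        qed (use Kbd \<epsilon>(4) \<delta>(1) in auto)
        have zc: "z \<in> ball p c" using z(2) c'(2) by simp
        have "holo_on (\<lambda>z. (\<epsilon>, z)) (ball p c)" by (intro holo_on_Pair holo_on_const holo_on_id)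
        from holo_on_compose[OF this holn[of "k - A - M"]] have "holo_on \<Lambda> (ball p c)"
          using \<epsilon>D by (simp add: \<Lambda>_def)
        from bounded_holo_Lipschitz_centre[OF this \<Lambda>1 zc]
        have "norm (\<Lambda> z - \<Lambda> p) \<le> 4 / c * norm (z - p)" by simp
        also have "\<dots> \<le> 4 / c * (\<eta> * c / 8)"
          using z(2) c'(3) c by (intro mult_left_mono) (auto simp: dist_norm norm_minus_commute)
        also have "\<dots> < \<eta>" using c \<eta> by simp
        finally have "dist (\<epsilon>, \<Lambda> p) (\<epsilon>, \<Lambda> z) < \<eta>"
          by (simp add: dist_Pair_Pair dist_norm norm_minus_commute)
        then have close: "dist ((F \<epsilon> ^^ m) (\<Lambda> p)) ((F \<epsilon> ^^ m) (\<Lambda> z)) < 1"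
          using uc[of "(\<epsilon>, \<Lambda> z)" "(\<epsilon>, \<Lambda> p)"] \<epsilon>(3) \<Lambda>1[OF zc] \<Lambda>1[OF pc] by (simp add: Q_def)
        have "norm ((F \<epsilon> ^^ (m + (k - A - M))) z) < R" using KR[OF \<epsilon>(4) z(1)] .
        then have "norm ((F \<epsilon> ^^ m) (\<Lambda> p)) < R + 1"
          using close norm_triangle_ineq2[of "(F \<epsilon> ^^ m) (\<Lambda> p)" "(F \<epsilon> ^^ m) (\<Lambda> z)"]
          by (simp add: funpow_add \<Lambda>_def dist_norm)
        moreover have "m + (k - A - M) = k - A - M0" using k M by (simp add: m_def)
        then have "(F \<epsilon> ^^ m) (\<Lambda> p) = (F \<epsilon> ^^ (k - A - M0)) p"
          unfolding \<Lambda>_def by (metis funpow_add o_apply)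
        ultimately show ?thesis
          using norm_fst_le_norm[of "(F \<epsilon> ^^ (k - A - M0)) p"] by (simp add: h_def \<epsilon>_def)
      qed
      then show ?thesis by blast
    qed
    obtain k3 where k3: "\<forall>k\<ge>k3. \<forall>t. norm t \<le> real M0 / 4 \<longrightarrow> h k t \<noteq> 0 \<and>
        norm (1 / h k t - (of_nat M0 - t)) \<le> 3/16 * real M0"
      using passage[OF M0(1)] unfolding h_def by blast
    \<comment> \<open>large enough for the variation \<open>4 (R + 1) M0 / M\<close> to drop below the gap \<open>1 / (18 M0)\<close> that the
      exit positions at the phases \<open>\<plusminus> M0 / 4\<close> have\<close>
    obtain M :: nat where "max (real M0 + 1) (72 * (R + 1) * real M0 ^ 2 + 1) \<le> real M"
      using real_arch_simple by blast
    then have M: "M \<ge> M0" "real M > real M0" "real M > 72 * (R + 1) * real M0 ^ 2" by simp_all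
    obtain k1 where k1: "\<forall>k\<ge>k1. \<forall>t. norm t \<le> real M / 4 \<longrightarrow> norm (h k t) \<le> R + 1"
      using h_bounded[OF M(1)] by blast
    obtain k4 :: nat where k4: "max (max (20 * real M) 1) (4 / \<delta> + 1) \<le> real k4"
      using real_arch_simple by blast
    define k where "k = max (max k1 k3) k4"
    have "real k4 \<le> real k" by (simp add: k_def)
    then have kk: "20 * real M \<le> real k" "1 \<le> real k" "4 / \<delta> < real k" using k4 by simp_all
    have Ek: "of_nat k - t \<noteq> 0" "gate_param k t \<in> D" if "norm t \<le> real M / 4" for t
    proof -
      have "k > 0" "norm t \<le> real k / 20" using kk that by simp_all
      note * = gate_param_bounds[OF this]
      show "of_nat k - t \<noteq> 0" by (rule *(1))
      have "4 / real k < \<delta>" using kk(2,3) \<delta>(1) by (simp add: field_simps)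
      then show "gate_param k t \<in> D" using *(3) \<delta>(2) by auto
    qed
    have "holo_on (gate_param k) (ball 0 (real M / 4))"
      unfolding gate_param_def using Ek(1)
      by (intro holomorphic_on_imp_holo_on holomorphic_intros) auto
    then have "holo_on (\<lambda>t. (gate_param k t, p)) (ball 0 (real M / 4))"
      by (rule holo_on_Pair) (rule holo_on_const)
    from holo_on_compose[OF this holn[of "k - A - M0"]]
    have "holo_on (\<lambda>t. (F (gate_param k t) ^^ (k - A - M0)) p) (ball 0 (real M / 4))"
      using Ek(2) by simp
    then have holh: "h k holomorphic_on ball 0 (real M / 4)"
      unfolding h_def by (intro holo_on_imp_holomorphic_on holo_on_fst)
    have near: "norm (h k t - h k 0) \<le> 2 * (R + 1) * real M0 / real M" if t: "norm t = real M0 / 4" for t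
    proof -
      have "norm (h k t - h k 0) \<le> 2 * (R + 1) / (real M / 4) * norm (t - 0)"
        using k1 t M(2) by (intro bounded_holomorphic_Lipschitz_centre[OF holh]) (auto simp: k_def)
      also have "\<dots> = 2 * (R + 1) / (real M / 4) * (real M0 / 4)" using t by (simp only: diff_zero)
      also have "\<dots> = 2 * (R + 1) * real M0 / real M"
      proof -
        have "a / (m / 4) * (n / 4) = a * n / m" for a m n :: real by simp
        then show ?thesis .
      qed
      finally show ?thesis .
    qed
    define t where "t = complex_of_real (real M0 / 4)"
    have nt: "norm t = real M0 / 4" "norm (- t) = real M0 / 4"
      by (simp_all add: t_def norm_divide)
    define u v where "u = h k t" and "v = h k (- t)"
    have uv: "u \<noteq> 0" "v \<noteq> 0" "norm (1 / u - (of_nat M0 - t)) \<le> 3/16 * real M0"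
      "norm (1 / v - (of_nat M0 + t)) \<le> 3/16 * real M0"
      using k3[rule_format, of k t] k3[rule_format, of k "- t"] nt by (simp_all add: u_def v_def k_def)
    have "norm (u - v) \<le> norm (h k t - h k 0) + norm (h k (- t) - h k 0)"
      using norm_triangle_ineq4[of "h k t - h k 0" "h k (- t) - h k 0"] by (simp add: u_def v_def)
    also have "\<dots> \<le> 2 * (2 * (R + 1) * real M0 / real M)"
      using near[OF nt(1)] near[OF nt(2)] by linarith
    also have "\<dots> = 4 * (R + 1) * real M0 / real M" by simp
    also have "\<dots> < 1 / (18 * real M0)"
      using M M0 R by (simp add: field_simps power2_eq_square)
    finally have upper: "norm (u - v) < 1 / (18 * real M0)" .
    have "norm (of_nat M0 - t) \<le> 5/4 * real M0" "norm (of_nat M0 + t) \<le> 5/4 * real M0"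
      using norm_triangle_ineq4[of "of_nat M0" t] norm_triangle_ineq[of "of_nat M0" t] nt by simp_all
    then have iu: "norm (1 / u) \<le> 3/2 * real M0" and iv: "norm (1 / v) \<le> 3/2 * real M0"
      using norm_triangle_ineq[of "1 / u - (of_nat M0 - t)" "of_nat M0 - t"]
        norm_triangle_ineq[of "1 / v - (of_nat M0 + t)" "of_nat M0 + t"] uv(3,4) by simp_all
    have "2 * t = (1 / v - 1 / u) - ((1 / v - (of_nat M0 + t)) - (1 / u - (of_nat M0 - t)))" by simp
    then have "norm (2 * t) \<le> norm (1 / v - 1 / u) + (norm (1 / v - (of_nat M0 + t)) + norm (1 / u - (of_nat M0 - t)))"
      by (metis (no_types, lifting) add_left_mono norm_triangle_ineq4 order_trans)
    then have "real M0 / 8 \<le> norm (1 / v - 1 / u)"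
      using uv(3,4) nt by (simp add: norm_mult)
    also have "1 / v - 1 / u = (u - v) * (1 / u) * (1 / v)" using uv(1,2) by (simp add: field_simps)
    also have "norm \<dots> \<le> norm (u - v) * (3/2 * real M0) * (3/2 * real M0)"
      unfolding norm_mult by (intro mult_mono iu iv) auto
    also have "\<dots> < 1 / (18 * real M0) * (3/2 * real M0) * (3/2 * real M0)"
      using upper M0 by (intro mult_strict_right_mono) auto
    also have "\<dots> = real M0 / 8" using M0 by (simp add: field_simps)
    finally show False by simp
  qed
qed

theorem theorem1p6:
  fixes D :: "complex set"
    and F :: "complex \<Rightarrow> complex \<times> complex \<Rightarrow> complex \<times> complex"
    and \<rho> :: real and q r :: complex
    and A B A' B' :: "complex \<times> complex \<times> complex \<Rightarrow> complex"
  assumes "open D" and "0 \<in> D"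
    and "holo_family_regular D F"
    and "\<rho> > 1"
    and "A \<in> big_O [\<lambda>(\<epsilon>, x, y). x^2, \<lambda>(\<epsilon>, x, y). x * y, \<lambda>(\<epsilon>, x, y). y^2]"
    and "B \<in> big_O [\<lambda>(\<epsilon>, x, y). \<epsilon>^2]"
    and "A' \<in> big_O [\<lambda>(\<epsilon>, x, y). x^2, \<lambda>(\<epsilon>, x, y). x * y, \<lambda>(\<epsilon>, x, y). y^2]"
    and "B' \<in> big_O [\<lambda>(\<epsilon>, x, y). \<epsilon>^2]"
    and "\<forall>\<^sub>F (\<epsilon>, x, y) in nhds 0. F \<epsilon> (x, y) =
           (x + (x^2 + \<epsilon>^2) * (1 + (q + 1) * x + r * y + A (\<epsilon>, x, y) + B (\<epsilon>, x, y)),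
            y * (1 + of_real \<rho> * x + A' (\<epsilon>, x, y) + B' (\<epsilon>, x, y)))"
  shows "(\<forall>\<gamma> R s \<alpha> eps n U T.
            admissible_sector (F 0) \<gamma> R s \<and> lavaurs_map F (sector \<gamma> R s) \<alpha> eps n U T \<longrightarrow>
            set_limsup (\<lambda>\<nu>. filled_Julia (F (eps \<nu>))) \<subseteq> filled_Lavaurs_Julia (F 0) U T) \<and>
         \<not> hausdorff_continuous_at (\<lambda>\<epsilon>. filled_Julia (F \<epsilon>)) 0"
proof (rule gate_formI[OF assms(5-9)])
  fix C r'
  assume gf: "gate_form F \<rho> q C r'"
  have hol: "holo_on (\<lambda>(\<epsilon>, z). F \<epsilon> z) (D \<times> UNIV)"
    using assms(3) unfolding holo_family_regular_def by blast
  show ?thesis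
  proof (rule uniform_escape[OF gf assms(3,1,2)])
    fix \<delta> R :: real
    assume \<delta>: "\<delta> > 0" and R: "R \<ge> 1" and \<delta>D: "ball 0 \<delta> \<subseteq> D"
      and esc: "\<And>\<epsilon> z. norm \<epsilon> < \<delta> \<Longrightarrow> norm z \<ge> R \<Longrightarrow> norm (F \<epsilon> z) \<ge> 2 * norm z"
    show ?thesis
    proof (intro conjI allI impI, elim conjE)
      fix \<gamma> R' s \<alpha> eps n U T
      assume lav: "lavaurs_map F (sector \<gamma> R' s) \<alpha> eps n U T"
      show "set_limsup (\<lambda>\<nu>. filled_Julia (F (eps \<nu>))) \<subseteq> filled_Lavaurs_Julia (F 0) U T"
        by (rule limsup_filled_Julia_subset[OF hol assms(1,2) \<delta> R _ lav]) (rule esc)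
    next
      show "\<not> hausdorff_continuous_at (\<lambda>\<epsilon>. filled_Julia (F \<epsilon>)) 0"
        by (rule filled_Julia_discontinuous[OF gf assms(4) hol \<delta> \<delta>D R]) (rule esc)
    qed
  qed
qed

end
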